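(* Let $\{F_{a,b}\}$ be a family of lifts in Class $\mathcal{N}$. Fix $b_0$ above the critical line, and consider the one-parameter family $\{F_{a,b_0}\}_{a\in\mathbb{R}}$. Let $\frac{p}{q}$ be higher than $\frac{p'}{q'}$ on the Farey tree. If there exists an $a$ such that $F_{a,b_0}$ is $\frac{p'}{q'}$-locked, i.e. $Rot(F_{a,b_0})=\{\frac{p'}{q'}\}$, then the line $b=b_0$ intersects the $\frac{p}{q}$-locking region $Lock_{\frac{p}{q}}$ in a segment of positive length.
   Context: A degree-one lift is a continuous $F:\mathbb{R}\to\mathbb{R}$ with $F(x+1)=F(x)+1$ for all $x$. Its rotation set $Rot(F)$ is the set of all values $\lim_{m\to\infty}\frac{F^m(x)-x}{m}$ over those $x\in\mathbb{R}$ for which the limit exists; it is a single point or a nondegenerate closed interval. Its lower and upper monotone bounds are $F_l(x)=\inf\{F(y)\mid y\ge x\}$ and $F_u(x)=\sup\{F(y)\mid y\le x\}$. Class $\mathcal{B}$: lifts $F$ of degree-one circle maps that are $C^3$, piecewise strictly monotone, have at most two critical points (per fundamental domain $[0,1)$), both turning points when there are two, and have negative Schwarzian derivative $S(F)=\frac{F'''}{F'}-\frac32\left(\frac{F''}{F'}\right)^2$ (where defined) when they have two critical points. Class $\mathcal{N}$: two-parameter families of lifts $\{F_{a,b}\}$ (with $a\in\mathbb{R}$ and $b$ real) such that (i) each $F_{a,b}$ is in Class $\mathcal{B}$; (ii) $F_{a,b}$ and $\frac{d}{dx}F_{a,b}$ depend continuously on $(a,b)$; (iii) $a$ is a translation parameter: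 $F_{a,b}=F_{0,b}+a$; (iv) the Hausdorff distance $\Delta$ between (the graphs of) the upper and lower monotone bounds of $F_{a,b}$ is a nondecreasing function of $b$ such that the value $0$ can be attained and the value $1$ can be exceeded. The critical line is the horizontal line $b=\max\{b\mid\Delta=0\}$. On it $F_{a,b}$ has a unique critical point in $[0,1)$, and above it $F_{a,b}$ has two. When $F_{a,b}$ has two turning points per fundamental domain, with maximum at $C$ and minimum at $K$, the origin is chosen so that $0\le C<K<1$; with $K^-$ the closest point below $K$ with the same image as $K$ and $C^+$ the closest point above $C$ with the same image as $C$, one assumes $0<K^-\le C\le K\le C^+<1$ when $0\le\Delta<1$ (all four points being equal to the unique critical point on the critical line). $Lock_\omega$ (the frequency-locking region with frequency $\omega$) is the set of $(a,b)$ with $Rot(F_{a,b})=\{\omega\}$. Farey tree: all fractions are in lowest terms and in $[0,1]$. Fractions $\frac{p_1}{q_1},\frac{p_2}{q_2}$ are Farey neighbors if $p_1q_2-p_2q_1=\pm1$; their Farey sum is then $\frac{p_1}{q_1}\oplus\frac{p_2}{q_2}=\frac{p_1+p_2}{q_1+q_2}$. Every rational in $(0,1)$ is uniquely a Farey sum $\frac{p}{q}=\frac{p_1}{q_1}\oplus\frac{p_2}{q_2}$ with $\frac{p_1}{q_1}<\frac{p_2}{q_2}$ (left and right parents). For such $\frac pq$ set $l_j=\frac{jp+p_1}{jq+q_1}$, $r_j=\frac{jp+p_2}{jq+q_2}$; for $\frac01$ only $r_j$ is defined, with $\frac{p_2}{q_2}=\frac11$; for $\frac11$ only $l_j$ is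 defined, with $\frac{p_1}{q_1}=\frac01$. The first children of $\frac pq$ are $l_1$ and $r_1$ (those that are defined). The Farey tree has vertex set $\mathbb{Q}\cap[0,1]$ with one edge between every fraction and each of its first children. Vertices $\frac01,\frac11$ are at level $0$, and the vertices at level $n>0$ are the first children of the vertices at level $n-1$ (so $\frac12$ is at level 1, $\frac13,\frac23$ at level 2, etc.). If two fractions, at levels $m$ and $n$, are joined by a path in the tree that is monotone with respect to levels and $m<n$, the one at level $m$ is said to be higher than the one at level $n$. *)

theory Defs
  imports "HOL-Analysis.Analysis"
begin

section \<open>Degree-one lifts, rotation sets and monotone bounds\<close>

definition degree_one_lift :: "(real \<Rightarrow> real) \<Rightarrow> bool" where
  "degree_one_lift F \<longleftrightarrow> continuous_on UNIV F \<and> (\<forall>x. F (x + 1) = F x + 1)"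

definition Rot :: "(real \<Rightarrow> real) \<Rightarrow> real set" where
  "Rot F = {\<omega>. \<exists>x. (\<lambda>m. ((F ^^ m) x - x) / real m) \<longlonglongrightarrow> \<omega>}"

definition lower_bound :: "(real \<Rightarrow> real) \<Rightarrow> real \<Rightarrow> real" where
  "lower_bound F x = (INF y\<in>{x..}. F y)"

definition upper_bound :: "(real \<Rightarrow> real) \<Rightarrow> real \<Rightarrow> real" where
  "upper_bound F x = (SUP y\<in>{..x}. F y)"

(* Real-valued suprema: meaningful only when each set stays within bounded distance of the
   other, which holds for the graphs of two degree-one lifts. *)
definition hausdorff_dist :: "'a::metric_space set \<Rightarrow> 'a set \<Rightarrow> real" where
  "hausdorff_dist A B = max (SUP x\<in>A. infdist x B) (SUP y\<in>B. infdist y A)"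

definition graph_of :: "(real \<Rightarrow> real) \<Rightarrow> (real \<times> real) set" where
  "graph_of f = range (\<lambda>x. (x, f x))"

definition bound_gap :: "(real \<Rightarrow> real) \<Rightarrow> real" where
  "bound_gap F = hausdorff_dist (graph_of (upper_bound F)) (graph_of (lower_bound F))"

section \<open>Class B\<close>

definition C3 :: "(real \<Rightarrow> real) \<Rightarrow> bool" where
  "C3 F \<longleftrightarrow> (\<forall>k<3. \<forall>x. (deriv ^^ k) F differentiable (at x)) \<and>
           continuous_on UNIV ((deriv ^^ 3) F)"

definition piecewise_strictly_monotone :: "(real \<Rightarrow> real) \<Rightarrow> bool" where
  "piecewise_strictly_monotone F \<longleftrightarrow>
     (\<exists>(n::nat) t. t 0 = 0 \<and> t n = 1 \<and>
        (\<forall>i<n. t i < t (Suc i) \<and>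
           (strict_mono_on {t i..t (Suc i)} F \<or> strict_antimono_on {t i..t (Suc i)} F)))"

definition critical_points :: "(real \<Rightarrow> real) \<Rightarrow> real set" where
  "critical_points F = {x \<in> {0..<1}. deriv F x = 0}"

definition turning_max :: "(real \<Rightarrow> real) \<Rightarrow> real \<Rightarrow> bool" where
  "turning_max F c \<longleftrightarrow>
     (\<exists>e>0. strict_mono_on {c - e..c} F \<and> strict_antimono_on {c..c + e} F)"

definition turning_min :: "(real \<Rightarrow> real) \<Rightarrow> real \<Rightarrow> bool" where
  "turning_min F c \<longleftrightarrow>
     (\<exists>e>0. strict_antimono_on {c - e..c} F \<and> strict_mono_on {c..c + e} F)"

definition turning_point :: "(real \<Rightarrow> real) \<Rightarrow> real \<Rightarrow> bool" where
  "turning_point F c \<longleftrightarrow> turning_max F c \<or> turning_min F c"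

definition schwarzian :: "(real \<Rightarrow> real) \<Rightarrow> real \<Rightarrow> real" where
  "schwarzian F x =
     (deriv ^^ 3) F x / deriv F x - 3 / 2 * ((deriv ^^ 2) F x / deriv F x) ^ 2"

definition class_B :: "(real \<Rightarrow> real) \<Rightarrow> bool" where
  "class_B F \<longleftrightarrow>
     degree_one_lift F \<and> C3 F \<and> piecewise_strictly_monotone F \<and>
     finite (critical_points F) \<and> card (critical_points F) \<le> 2 \<and>
     (card (critical_points F) = 2 \<longrightarrow>
        (\<forall>c\<in>critical_points F. turning_point F c) \<and>
        (\<forall>x. deriv F x \<noteq> 0 \<longrightarrow> schwarzian F x < 0))"

section \<open>Class N\<close>

text \<open>A family is a function \<open>F\<close> with \<open>F a b x\<close> the value of the lift with parameters
  \<open>(a, b)\<close> at \<open>x\<close>.\<close>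

(* The gap of F a b does not depend on a when a is a translation parameter. *)
definition critical_level :: "(real \<Rightarrow> real \<Rightarrow> real \<Rightarrow> real) \<Rightarrow> real" where
  "critical_level F = (GREATEST b. bound_gap (F 0 b) = 0)"

definition K_minus :: "(real \<Rightarrow> real) \<Rightarrow> real \<Rightarrow> real" where
  "K_minus F K = Sup {x. x < K \<and> F x = F K}"

definition C_plus :: "(real \<Rightarrow> real) \<Rightarrow> real \<Rightarrow> real" where
  "C_plus F C = Inf {x. x > C \<and> F x = F C}"

(* Convention on the origin.  The last requirement below is imposed only while F C - F K < 1,
   that is, while the uniform distance of the two monotone bounds is below 1.  It forces
   F C - F K < 1, because C_plus < 1 < K_minus + 1 lie on one increasing branch.  Imposing it
   whenever the Hausdorff distance of the graphs is below 1 would leave no family at all: that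
   distance is still below 1 at the parameter where F C - F K first reaches 1.  Since the
   Hausdorff distance never exceeds the uniform distance, the form used here is the weaker
   assumption. *)
definition normalized_origin :: "(real \<Rightarrow> real \<Rightarrow> real \<Rightarrow> real) \<Rightarrow> bool" where
  "normalized_origin F \<longleftrightarrow>
     (\<forall>a b. card (critical_points (F a b)) = 2 \<longrightarrow>
        (\<exists>C K. 0 \<le> C \<and> C < K \<and> K < 1 \<and>
           turning_max (F a b) C \<and> turning_min (F a b) K \<and>
           (F a b C - F a b K < 1 \<longrightarrow>
              0 < K_minus (F a b) K \<and> K_minus (F a b) K \<le> C \<and>
              K \<le> C_plus (F a b) C \<and> C_plus (F a b) C < 1))) \<and>
     (\<forall>a. \<forall>c\<in>critical_points (F a (critical_level F)). 0 < c)"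

(* For lifts, joint continuity in (a, b, x) is the same as continuity of the parameter
   dependence in the uniform topology, by periodicity in x. *)
definition class_N :: "(real \<Rightarrow> real \<Rightarrow> real \<Rightarrow> real) \<Rightarrow> bool" where
  "class_N F \<longleftrightarrow>
     (\<forall>a b. class_B (F a b)) \<and>
     continuous_on UNIV (\<lambda>(a, b, x). F a b x) \<and>
     continuous_on UNIV (\<lambda>(a, b, x). deriv (F a b) x) \<and>
     (\<forall>a b x. F a b x = F 0 b x + a) \<and>
     (\<forall>a. mono (\<lambda>b. bound_gap (F a b)) \<and>
          (\<exists>b. bound_gap (F a b) = 0) \<and> (\<exists>b. bound_gap (F a b) > 1)) \<and>
     normalized_origin F"

definition Lock :: "(real \<Rightarrow> real \<Rightarrow> real \<Rightarrow> real) \<Rightarrow> real \<Rightarrow> (real \<times> real) set" where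
  "Lock F \<omega> = {(a, b). Rot (F a b) = {\<omega>}}"

section \<open>The Farey tree\<close>

text \<open>Fractions in lowest terms are rationals; \<^const>\<open>quotient_of\<close> yields the reduced
  numerator and (positive) denominator.\<close>

definition num :: "rat \<Rightarrow> int" where "num x = fst (quotient_of x)"
definition den :: "rat \<Rightarrow> int" where "den x = snd (quotient_of x)"

definition farey_neighbors :: "rat \<Rightarrow> rat \<Rightarrow> bool" where
  "farey_neighbors x y \<longleftrightarrow> \<bar>num x * den y - num y * den x\<bar> = 1"

definition farey_sum :: "rat \<Rightarrow> rat \<Rightarrow> rat" where
  "farey_sum x y = Fract (num x + num y) (den x + den y)"

definition farey_parents :: "rat \<Rightarrow> rat \<Rightarrow> rat \<Rightarrow> bool" where
  "farey_parents x l r \<longleftrightarrow>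
     l \<in> {0..1} \<and> r \<in> {0..1} \<and> l < r \<and> farey_neighbors l r \<and> x = farey_sum l r"

(* first_child x y: y is a first child l_1 = (p + p1)/(q + q1) or r_1 = (p + p2)/(q + q2)
   of x = p/q, where p1/q1 and p2/q2 are the left and right parents of p/q. *)
inductive first_child :: "rat \<Rightarrow> rat \<Rightarrow> bool" where
  zero: "first_child 0 (farey_sum 0 1)"
| one: "first_child 1 (farey_sum 1 0)"
| left: "farey_parents x l r \<Longrightarrow> first_child x (farey_sum x l)"
| right: "farey_parents x l r \<Longrightarrow> first_child x (farey_sum x r)"

primrec farey_row :: "nat \<Rightarrow> rat set" where
  "farey_row 0 = {0, 1}"
| "farey_row (Suc n) = {y. \<exists>x\<in>farey_row n. first_child x y}"

(* Each rational in [0,1] lies in exactly one row. *)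
definition farey_level :: "rat \<Rightarrow> nat" where
  "farey_level x = (LEAST n. x \<in> farey_row n)"

definition farey_edge :: "rat \<Rightarrow> rat \<Rightarrow> bool" where
  "farey_edge x y \<longleftrightarrow> first_child x y \<or> first_child y x"

definition farey_path :: "rat list \<Rightarrow> bool" where
  "farey_path xs \<longleftrightarrow>
     xs \<noteq> [] \<and> set xs \<subseteq> {0..1} \<and> distinct xs \<and> successively farey_edge xs"

definition farey_higher :: "rat \<Rightarrow> rat \<Rightarrow> bool" where
  "farey_higher x y \<longleftrightarrow>
     farey_level x < farey_level y \<and>
     (\<exists>xs. farey_path xs \<and> hd xs = x \<and> last xs = y \<and> sorted (map farey_level xs))"

end

theory Submission
  imports Defs
begin

text \<open>Write \<open>L\<close> and \<open>U\<close> for the lower and upper bounds of a lift \<open>f\<close> and \<open>L\<^sub>a = L + a\<close>, \<open>U\<^sub>a = U + a\<close>. Then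
  \<open>f + a\<close> is \<open>p/q\<close>-locked iff \<open>L\<^sub>a\<^sup>q x \<ge> x + p\<close> for some \<open>x\<close> and \<open>U\<^sub>a\<^sup>q y \<le> y + p\<close> for some
  \<open>y\<close>, and the set of these \<open>a\<close> is a compact interval. For bimodal \<open>f\<close>, \<open>L\<close> is constant on
  \<open>[Km, K]\<close> and \<open>U\<close> on \<open>[C, Cp]\<close>, where \<open>C\<close> is the maximum and \<open>K\<close> the minimum.

  Let \<open>p'/q'\<close> be the Farey sum of \<open>p/q\<close> and another Farey neighbor. At the left end of the
  \<open>p'/q'\<close>-interval let \<open>y 0 \<le> Km < y 1\<close> be adjacent points of a periodic orbit of \<open>L\<^sub>a\<close>. Expansion of
  cross ratios, the only consequence of negative Schwarzian derivative that is used, forces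
  \<open>Cp \<le> y 1\<close>. At the parameter where \<open>Km\<close> itself is \<open>p/q\<close>-periodic under \<open>L\<^sub>a\<close>, let \<open>x 1\<close> be the
  point of its orbit after \<open>Km\<close>. Monotonicity in \<open>a\<close> and the arithmetic of Farey neighbors give
  \<open>y 1 < x 1\<close>, so this orbit avoids both flat pieces and is periodic for \<open>U\<^sub>a\<close> as well: \<open>f + a\<close> is
  \<open>p/q\<close>-locked. By cross ratio expansion again the return map is not the identity near the orbit, and
  the locking persists to one side.\<close>

section \<open>Monotone degree-one maps\<close>

text \<open>The obstacle is that the flat pieces \<open>[Km, K]\<close> of \<open>L\<close> and
  \<open>[C, Cp]\<close> of \<open>U\<close> overlap: an orbit on which \<open>L\<close>,
  \<open>U\<close> and \<open>f\<close> all agree must leave a gap, modulo 1, around the whole of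
  \<open>(Km, Cp)\<close>. Monotone theory alone provides no gap of that width. The orbit of the
  locked child does, and the Schwarzian condition is spent mainly on showing this. The relation p2
  q1 - p1 q2 = 1 between Farey neighbors enters as dynamics. On an ordered periodic orbit of type
  (p1 + p2)/(q1 + q2), q1 iterates move every point one place to the right and q2 iterates one place
  to the left. On an orbit of type p1/q1 the q2 iterates, and on one of type p2/q2 the q1 iterates,
  act in the same way, so gaps of orbits at different parameters can be compared. A path sorted by
  level runs along edges from parent to child, so it is enough to pass from a locked child to its
  tree parent, and only the last such step has to produce an interval of parameters. Rotation
  numbers are compared through integer inequalities; limits occur only in the link with
  \<open>Rot\<close>.\<close>

definition equivariant :: "(real \<Rightarrow> real) \<Rightarrow> bool" where
  "equivariant G \<longleftrightarrow> (\<forall>x. G (x + 1) = G x + 1)"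

lemma equivariant_add_nat: "equivariant G \<Longrightarrow> G (x + real n) = G x + real n"
proof (induction n)
  case (Suc n)
  have "G (x + real (Suc n)) = G ((x + real n) + 1)" by (simp add: algebra_simps)
  then show ?case using Suc by (simp add: equivariant_def)
qed simp

lemma equivariant_add_int:
  assumes "equivariant G"
  shows "G (x + of_int m) = G x + of_int m"
proof (cases "m \<ge> 0")
  case True
  then show ?thesis using equivariant_add_nat[OF assms, of x "nat m"] by simp
next
  case False
  then show ?thesis using equivariant_add_nat[OF assms, of "x + of_int m" "nat (- m)"] by simp
qed

lemma equivariant_funpow: "equivariant G \<Longrightarrow> equivariant (G ^^ n)"
  by (induction n) (auto simp: equivariant_def)

lemmas funpow_add_int = equivariant_add_int[OF equivariant_funpow]

section \<open>Rotation numbers compared without limits\<close>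

lemma funpow_ge_iterate:
  fixes p :: int
  assumes "mono G" "equivariant G" "(G ^^ q) x \<ge> x + of_int p"
  shows "(G ^^ (q * n)) x \<ge> x + of_int (int n * p)"
proof (induction n)
  case (Suc n)
  have "x + of_int (int (Suc n) * p) = (x + of_int p) + of_int (int n * p)"
    by (simp add: algebra_simps)
  also have "\<dots> \<le> (G ^^ q) x + of_int (int n * p)" using assms(3) by simp
  also have "\<dots> = (G ^^ q) (x + of_int (int n * p))"
    by (rule funpow_add_int[OF assms(2), symmetric])
  also have "\<dots> \<le> (G ^^ q) ((G ^^ (q * n)) x)"
    using Suc mono_pow[OF assms(1)] by (auto dest: monoD)
  also have "\<dots> = (G ^^ (q * Suc n)) x" by (simp add: funpow_add)
  finally show ?case .
qed simp

lemma funpow_le_iterate: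
  fixes p :: int
  assumes "mono G" "equivariant G" "(G ^^ q) x \<le> x + of_int p"
  shows "(G ^^ (q * n)) x \<le> x + of_int (int n * p)"
proof (induction n)
  case (Suc n)
  have "(G ^^ (q * Suc n)) x = (G ^^ q) ((G ^^ (q * n)) x)" by (simp add: funpow_add)
  also have "\<dots> \<le> (G ^^ q) (x + of_int (int n * p))"
    using Suc mono_pow[OF assms(1)] by (auto dest: monoD)
  also have "\<dots> = (G ^^ q) x + of_int (int n * p)"
    by (rule funpow_add_int[OF assms(2)])
  also have "\<dots> \<le> (x + of_int p) + of_int (int n * p)" using assms(3) by simp
  also have "\<dots> = x + of_int (int (Suc n) * p)" by (simp add: algebra_simps)
  finally show ?case .
qed simp

text \<open>Up to the common time \<open>q * q' * n\<close> the point \<open>x\<close> advances by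
  at least \<open>n * q' * p\<close> and \<open>y\<close> by at most \<open>n * q * p'\<close>,
  while monotonicity keeps the orbit of \<open>x\<close> below that of an integer translate of
  \<open>y\<close>. For large \<open>n\<close> this forces p/q \<le> p'/q'.\<close>

lemma rotation_compare:
  fixes p p' :: int
  assumes G: "mono G" "equivariant G"
    and ge: "(G ^^ q) x \<ge> x + of_int p" and le: "(G ^^ q') y \<le> y + of_int p'"
  shows "p * int q' \<le> p' * int q"
proof (rule ccontr)
  assume "\<not> ?thesis"
  then have gt: "p * int q' - p' * int q \<ge> 1" by simp
  define k where "k = \<lceil>x - y\<rceil>"
  have k: "x \<le> y + of_int k" unfolding k_def by linarith
  \<comment> \<open>Chosen to exceed the constant offset between the two orbits, so that a surplus
    of at least 1 per unit of \<open>n\<close> is contradictory.\<close>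
  define n where "n = nat (\<bar>\<lceil>y - x\<rceil> + k\<bar> + 1)"
  have "x + of_int (int (q' * n) * p) \<le> (G ^^ (q * (q' * n))) x"
    by (rule funpow_ge_iterate[OF G ge])
  also have "\<dots> \<le> (G ^^ (q * (q' * n))) (y + of_int k)"
    using k mono_pow[OF G(1)] by (auto dest: monoD)
  also have "\<dots> = (G ^^ (q' * (q * n))) y + of_int k"
    using funpow_add_int[OF G(2)] by (simp add: ac_simps)
  also have "\<dots> \<le> y + of_int (int (q * n) * p') + of_int k"
    using funpow_le_iterate[OF G le, of "q * n"] by simp
  finally have "of_int (int n * (p * int q' - p' * int q)) \<le> y - x + of_int k"
    by (simp add: algebra_simps)
  also have "\<dots> \<le> of_int (\<lceil>y - x\<rceil> + k)" by simp
  finally have "int n * (p * int q' - p' * int q) \<le> \<lceil>y - x\<rceil> + k"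
    by (simp only: of_int_le_iff)
  moreover have "int n * (p * int q' - p' * int q) \<ge> int n * 1"
    using gt by (intro mult_left_mono) auto
  moreover have "int n = \<bar>\<lceil>y - x\<rceil> + k\<bar> + 1" unfolding n_def by simp
  ultimately show False by linarith
qed

section \<open>Ordered periodic orbits\<close>

text \<open>The coefficient of \<open>p\<close> will count iterations and therefore has to be a
  natural number; reducing it modulo \<open>q\<close> achieves this.\<close>

lemma coprime_bezout_nat:
  fixes p l :: int
  assumes "coprime p (int q)" "q > 0"
  obtains n :: nat and m :: int where "int n * p + m * int q = l"
proof -
  obtain u v where uv: "u * p + v * int q = 1"
    using bezout_int[of p "int q"] assms(1) by auto
  define n where "n = (u * l) mod int q"
  have n: "n \<ge> 0" using assms(2) by (simp add: n_def)
  have "l - n * p = l - (u * l - int q * ((u * l) div int q)) * p"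
    unfolding n_def by (simp add: minus_mult_div_eq_mod)
  also have "\<dots> = l * (1 - u * p) + int q * ((u * l) div int q) * p" by algebra
  also have "1 - u * p = v * int q" using uv by simp
  finally have "l - n * p = (l * v + (u * l) div int q * p) * int q" by algebra
  then show ?thesis using that[of "nat n" "l * v + (u * l) div int q * p"] n
    by (simp add: algebra_simps)
qed

text \<open>All integer translates of a periodic orbit, listed in increasing order. A shift of the
  index by \<open>q\<close> is translation by 1, and the map acts as a shift of the index by
  \<open>p\<close>, as for the rigid rotation by p/q.\<close>

definition cyclic_orbit :: "(real \<Rightarrow> real) \<Rightarrow> int \<Rightarrow> nat \<Rightarrow> (int \<Rightarrow> real) \<Rightarrow> bool" where
  "cyclic_orbit G p q x \<longleftrightarrow> strict_mono x \<and> (\<forall>i. G (x i) = x (i + p)) \<and>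
     (\<forall>i. x (i + int q) = x i + 1)"

lemma cyclic_orbit_shift: "cyclic_orbit G p q x \<Longrightarrow> x (i + m * int q) = x i + of_int m"
proof -
  assume x: "cyclic_orbit G p q x"
  have nat: "x (i + int n * int q) = x i + real n" for i n
  proof (induction n)
    case (Suc n)
    have "x (i + int (Suc n) * int q) = x ((i + int n * int q) + int q)"
      by (simp add: algebra_simps)
    then show ?case using Suc x by (simp add: cyclic_orbit_def)
  qed simp
  show ?thesis
  proof (cases "m \<ge> 0")
    case True
    then show ?thesis using nat[of i "nat m"] by simp
  next
    case False
    then show ?thesis using nat[of "i + m * int q" "nat (- m)"] by (simp add: algebra_simps)
  qed
qed

lemma cyclic_orbit_funpow: "cyclic_orbit G p q x \<Longrightarrow> (G ^^ n) (x i) = x (i + int n * p)"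
  by (induction n) (auto simp: cyclic_orbit_def algebra_simps)

lemma cyclic_orbit_reindex: "cyclic_orbit G p q x \<Longrightarrow> cyclic_orbit G p q (\<lambda>i. x (i + k))"
  by (auto simp: cyclic_orbit_def strict_mono_def algebra_simps) (metis add.assoc add.commute)+

text \<open>Every index \<open>i\<close> is \<open>n * p + m * q\<close> for a unique
  \<open>n < q\<close>, and \<open>x i\<close> is the \<open>n\<close>-th image of \<open>z\<close>
  translated by \<open>m\<close>. Order preservation is the real content: one inversion at index
  distance \<open>d\<close> spreads to all indices and contradicts
  \<open>x (i + d * q) = x i + d\<close>.\<close>

lemma cyclic_orbit_exists:
  assumes G: "mono G" "equivariant G" and z: "(G ^^ q) z = z + of_int p"
    and q: "q > 0" and cop: "coprime p (int q)"
  obtains x where "cyclic_orbit G p q x" "x 0 = z"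
proof -
  obtain u v where uv: "u * p + v * int q = 1"
    using bezout_int[of p "int q"] cop by auto
  \<comment> \<open>\<open>u\<close> inverts \<open>p\<close> modulo \<open>q\<close>, so
    \<open>u * i\<close> iterates move the index from 0 to \<open>i\<close> up to a multiple of
    \<open>q\<close>.\<close>
  define n where "n i = nat ((u * i) mod int q)" for i
  define m where "m i = (i - int (n i) * p) div int q" for i
  define x where "x i = (G ^^ n i) z + of_int (m i)" for i
  have intn: "int (n i) = (u * i) mod int q" for i using q by (simp add: n_def)
  have nm: "int (n i) * p + m i * int q = i" for i
  proof -
    have "(int (n i) * p) mod int q = (u * i * p) mod int q"
      unfolding intn by (simp add: mod_mult_left_eq)
    also have "u * i * p = i + (- v * i) * int q" using uv by algebra
    also have "(i + (- v * i) * int q) mod int q = i mod int q" by (rule mod_mult_self1)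
    finally have "int q dvd i - int (n i) * p" by (metis mod_eq_dvd_iff)
    then show ?thesis unfolding m_def by simp
  qed
  have nlt: "n i < q" for i
  proof -
    have "int (n i) < int q" unfolding intn using q by simp
    then show ?thesis by simp
  qed
  have n_unique: "n i = k" if "int k * p + l * int q = i" "k < q" for i k l
  proof -
    have "(int (n i) - int k) * p = (l - m i) * int q"
      unfolding left_diff_distrib using nm[of i] that(1) by linarith
    then have "int q dvd (int (n i) - int k) * p" by simp
    then have "int q dvd int (n i) - int k"
      using coprime_dvd_mult_left_iff[of "int q" p] cop by (metis coprime_commute)
    moreover have "\<bar>int (n i) - int k\<bar> < int q" using nlt[of i] that(2) by linarith
    ultimately have "int (n i) - int k = 0" by (metis abs_of_nat dvd_imp_le_int not_less)
    then show ?thesis by simp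
  qed
  have x_eq: "x i = (G ^^ k) z + of_int l" if "int k * p + l * int q = i" "k < q" for i k l
  proof -
    have "n i = k" using n_unique that by blast
    moreover have "m i = l" using nm[of i] that(1) q \<open>n i = k\<close> by auto
    ultimately show ?thesis by (simp add: x_def)
  qed
  have Gx: "G (x i) = x (i + p)" for i
  proof -
    have Gxi: "G (x i) = (G ^^ Suc (n i)) z + of_int (m i)"
      using equivariant_add_int[OF G(2)] by (simp add: x_def)
    show ?thesis
    proof (cases "Suc (n i) < q")
      case True
      have "x (i + p) = (G ^^ Suc (n i)) z + of_int (m i)"
        by (rule x_eq[OF _ True]) (use nm[of i] in \<open>simp add: algebra_simps\<close>)
      then show ?thesis using Gxi by simp
    next
      case False
      then have eq: "Suc (n i) = q" using nlt[of i] by simp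
      have "x (i + p) = (G ^^ 0) z + of_int (m i + p)"
      proof (rule x_eq[OF _ q])
        have "int q * p = int (Suc (n i)) * p" by (simp only: eq)
        then have "int q * p + m i * int q = i + p" using nm[of i] by (simp add: distrib_right)
        then show "int 0 * p + (m i + p) * int q = i + p" by (simp add: algebra_simps)
      qed
      then show ?thesis using Gxi z unfolding eq by simp
    qed
  qed
  have xq: "x (i + int q) = x i + 1" for i
  proof -
    have "x (i + int q) = (G ^^ n i) z + of_int (m i + 1)"
      by (rule x_eq[OF _ nlt]) (use nm[of i] in \<open>simp add: algebra_simps\<close>)
    then show ?thesis by (simp add: x_def)
  qed
  have Gn: "(G ^^ k) (x i) = x (i + int k * p)" for k i
    by (induction k) (auto simp: Gx algebra_simps)
  have xm: "x (i + l * int q) = x i + of_int l" for i l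
  proof -
    have "x (i + l * int q) = (G ^^ n i) z + of_int (m i + l)"
      by (rule x_eq[OF _ nlt]) (use nm[of i] in \<open>simp add: algebra_simps\<close>)
    then show ?thesis by (simp add: x_def)
  qed
  have "strict_mono x"
  proof (rule strict_monoI, rule ccontr)
    fix i j :: int assume "i < j" and "\<not> x i < x j"
    then have ji: "x j \<le> x i" by simp
    define d where "d = nat (j - i)"
    have d: "int d = j - i" "d > 0" using \<open>i < j\<close> by (auto simp: d_def)
    \<comment> \<open>Some iterate followed by an integer translation carries index \<open>i\<close>
      to any \<open>l\<close>, and both operations preserve the inequality.\<close>
    have all: "x (l + int d) \<le> x l" for l
    proof -
      obtain k r where kr: "int k * p + r * int q = l - i"
        using coprime_bezout_nat[OF cop q] by blast
      have l: "l = (i + int k * p) + r * int q" "l + int d = (j + int k * p) + r * int q"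
        using kr d by auto
      have "(G ^^ k) (x j) \<le> (G ^^ k) (x i)" using ji mono_pow[OF G(1)] by (auto dest: monoD)
      then show ?thesis unfolding l(2) by (subst l(1)) (simp add: xm Gn)
    qed
    have "x (i + int k * int d) \<le> x i" for k
    proof (induction k)
      case (Suc k)
      have "x (i + int (Suc k) * int d) = x ((i + int k * int d) + int d)"
        by (simp add: algebra_simps)
      then show ?case using all[of "i + int k * int d"] Suc by simp
    qed simp
    from this[of q] have "x (i + int d * int q) \<le> x i" by (simp add: mult.commute)
    then show False using xm[of i "int d"] d(2) by simp
  qed
  moreover have "x 0 = z" using x_eq[of 0 0 0] q by simp
  ultimately show ?thesis using that[of x] Gx xq by (auto simp: cyclic_orbit_def)
qed

lemma cyclic_orbit_bracket:
  assumes "cyclic_orbit G p q x" "q > 0"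
  obtains i where "x i \<le> t" "t < x (i + 1)"
proof -
  have sm: "strict_mono x" using assms by (simp add: cyclic_orbit_def)
  have sh: "x (m * int q) = x 0 + of_int m" for m
    using cyclic_orbit_shift[OF assms(1), of 0 m] by simp
  define lo where "lo = (\<lfloor>t - x 0\<rfloor>) * int q"
  have lo: "x lo \<le> t" unfolding lo_def sh by linarith
  define hi where "hi = (\<lfloor>t - x 0\<rfloor> + 1) * int q"
  have hi: "t < x hi" unfolding hi_def sh by simp linarith
  have lohi: "lo < hi" using lo hi sm by (meson not_less order.trans order_le_less_trans strict_mono_less_eq)
  define S where "S = {i. lo \<le> i \<and> i \<le> hi \<and> x i \<le> t}"
  have fin: "finite S" unfolding S_def by (rule finite_subset[of _ "{lo..hi}"]) auto
  have ne: "lo \<in> S" using lo lohi by (simp add: S_def)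
  define i where "i = Max S"
  have iS: "i \<in> S" using fin ne Max_in unfolding i_def by blast
  have "i \<noteq> hi" using iS hi by (auto simp: S_def)
  moreover have "i + 1 \<notin> S" using fin Max_ge[of S "i + 1"] by (auto simp: i_def)
  ultimately have "t < x (i + 1)" using iS by (auto simp: S_def)
  then show ?thesis using that iS by (auto simp: S_def)
qed

section \<open>Existence of the rotation number of a monotone map\<close>

text \<open>The displacement over \<open>n\<close> steps varies by at most 1 with the starting
  point, so \<open>a (m * n)\<close> is within \<open>m\<close> of \<open>m * a n\<close>. Comparing
  \<open>a m\<close> and \<open>a n\<close> with \<open>a (m * n)\<close> makes the averages
  Cauchy.\<close>

lemma rotation_limit_exists:
  assumes G: "mono G" "equivariant G"
  shows "convergent (\<lambda>n. ((G ^^ n) x - x) / real n)"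
proof -
  define a where "a n = (G ^^ n) x - x" for n
  have one: "\<bar>((G ^^ n) y - y) - a n\<bar> \<le> 1" for n y
  proof -
    define k where "k = \<lfloor>y - x\<rfloor>"
    have k: "x + of_int k \<le> y" "y \<le> x + of_int (k + 1)" unfolding k_def by linarith+
    have "(G ^^ n) (x + of_int k) \<le> (G ^^ n) y" "(G ^^ n) y \<le> (G ^^ n) (x + of_int (k + 1))"
      using k mono_pow[OF G(1)] by (auto dest: monoD)
    then have "(G ^^ n) x + of_int k \<le> (G ^^ n) y" "(G ^^ n) y \<le> (G ^^ n) x + of_int (k + 1)"
      by (simp_all only: funpow_add_int[OF G(2)])
    then show ?thesis using k unfolding a_def by simp
  qed
  have mult: "\<bar>a (m * n) - real m * a n\<bar> \<le> real m" for m n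
  proof (induction m)
    case (Suc m)
    have "a (Suc m * n) = ((G ^^ n) ((G ^^ (m * n)) x) - (G ^^ (m * n)) x) + a (m * n)"
      by (simp add: a_def funpow_add)
    then show ?case using one[of n "(G ^^ (m * n)) x"] Suc by (simp add: algebra_simps)
  qed (simp add: a_def)
  have close: "\<bar>a m / real m - a n / real n\<bar> \<le> 1 / real m + 1 / real n" if "m > 0" "n > 0" for m n
  proof -
    have "\<bar>real m * a n - real n * a m\<bar> \<le> real m + real n"
      using mult[of m n] mult[of n m] by (simp add: mult.commute)
    moreover have "a m / real m - a n / real n = (real n * a m - real m * a n) / (real m * real n)"
      "1 / real m + 1 / real n = (real m + real n) / (real m * real n)"
      using that by (simp_all add: field_simps)
    ultimately show ?thesis
      using that by (simp add: abs_minus_commute divide_right_mono)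
  qed
  have "Cauchy (\<lambda>n. a n / real n)"
  proof (rule metric_CauchyI)
    fix e :: real assume "e > 0"
    obtain N where N: "real N > 2 / e" using reals_Archimedean2 by blast
    have N0: "N > 0" using N \<open>e > 0\<close> by (metis divide_pos_pos gr0I not_less_iff_gr_or_eq of_nat_0 order.strict_trans zero_less_numeral)
    have small: "1 / real m < e / 2" if "m \<ge> N" for m
    proof -
      have "2 / e < real m" using N that by linarith
      then show ?thesis using \<open>e > 0\<close> N0 that by (simp add: field_simps)
    qed
    show "\<exists>M. \<forall>m\<ge>M. \<forall>n\<ge>M. dist (a m / real m) (a n / real n) < e"
    proof (intro exI allI impI)
      fix m n assume "m \<ge> N" "n \<ge> N"
      then show "dist (a m / real m) (a n / real n) < e"
        using close[of m n] small[of m] small[of n] N0 by (simp add: dist_real_def)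
    qed
  qed
  then show ?thesis by (simp add: a_def Cauchy_convergent_iff)
qed

section \<open>Monotone bounds of a lift\<close>

lemma lift_displacement_bounded:
  assumes "degree_one_lift f"
  obtains M where "\<And>x. \<bar>f x - x\<bar> \<le> M"
proof -
  have c: "continuous_on {0..1} (\<lambda>x. \<bar>f x - x\<bar>)"
    using assms by (auto simp: degree_one_lift_def intro!: continuous_intros elim: continuous_on_subset)
  obtain M where M: "\<And>x. x \<in> {0..1} \<Longrightarrow> \<bar>f x - x\<bar> \<le> M"
    using continuous_attains_sup[OF compact_Icc _ c] by fastforce
  have eq: "equivariant f" using assms by (simp add: equivariant_def degree_one_lift_def)
  have "\<bar>f x - x\<bar> \<le> M" for x
  proof -
    have "f x - x = f (frac x) - frac x"
      using equivariant_add_int[OF eq, of "frac x" "\<lfloor>x\<rfloor>"] by (simp add: frac_def)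
    then show ?thesis using M[of "frac x"] frac_ge_0[of x] frac_lt_1[of x]
      by (metis atLeastAtMost_iff less_eq_real_def)
  qed
  then show ?thesis using that by blast
qed

text \<open>An infimum of reals is meaningful only for a set bounded below; bounded displacement
  gives \<open>x - M\<close> as a bound on \<open>{x..}\<close>.\<close>

lemma lower_bound_le:
  assumes "degree_one_lift f" "x \<le> y"
  shows "lower_bound f x \<le> f y"
proof -
  obtain M where M: "\<And>x. \<bar>f x - x\<bar> \<le> M" using lift_displacement_bounded[OF assms(1)] by blast
  have "bdd_below (f ` {x..})"
  proof (rule bdd_belowI2)
    fix z assume "z \<in> {x..}"
    then show "x - M \<le> f z" using M[of z] by simp
  qed
  then show ?thesis unfolding lower_bound_def using assms(2) by (auto intro: cINF_lower)
qed

lemma lower_bound_greatest: "(\<And>y. x \<le> y \<Longrightarrow> c \<le> f y) \<Longrightarrow> c \<le> lower_bound f x"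
  unfolding lower_bound_def by (rule cINF_greatest) auto

lemma lower_bound_eqI:
  assumes "degree_one_lift f" "x \<le> y" "\<And>z. x \<le> z \<Longrightarrow> f y \<le> f z"
  shows "lower_bound f x = f y"
  using lower_bound_le[OF assms(1,2)] lower_bound_greatest[of x "f y" f] assms(3) by fastforce

lemma mono_lower_bound: "degree_one_lift f \<Longrightarrow> mono (lower_bound f)"
  by (rule monoI, rule lower_bound_greatest) (auto intro: lower_bound_le)

lemma equivariant_lower_bound:
  assumes "degree_one_lift f"
  shows "equivariant (lower_bound f)"
  unfolding equivariant_def
proof (intro allI antisym)
  fix x
  have f1: "f (y + 1) = f y + 1" for y using assms by (simp add: degree_one_lift_def)
  show "lower_bound f (x + 1) \<le> lower_bound f x + 1"
  proof -
    have "lower_bound f (x + 1) - 1 \<le> lower_bound f x"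
    proof (rule lower_bound_greatest)
      fix y assume "x \<le> y"
      then show "lower_bound f (x + 1) - 1 \<le> f y"
        using lower_bound_le[OF assms, of "x + 1" "y + 1"] f1[of y] by simp
    qed
    then show ?thesis by simp
  qed
  show "lower_bound f x + 1 \<le> lower_bound f (x + 1)"
  proof (rule lower_bound_greatest)
    fix y assume "x + 1 \<le> y"
    then show "lower_bound f x + 1 \<le> f y"
      using lower_bound_le[OF assms, of x "y - 1"] f1[of "y - 1"] by simp
  qed
qed

text \<open>Moving the left end of the ray from \<open>u\<close> to \<open>v\<close> discards only
  values of \<open>f\<close> on \<open>[u, v]\<close>, and near \<open>x\<close> these differ little
  from \<open>f v\<close>, which the second ray still sees.\<close>

lemma continuous_lower_bound:
  assumes "degree_one_lift f"
  shows "continuous_on UNIV (lower_bound f)"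
proof -
  let ?L = "lower_bound f"
  have fc: "isCont f x" for x
    using assms by (simp add: degree_one_lift_def continuous_on_eq_continuous_at)
  have "isCont ?L x" for x
    unfolding continuous_at_eps_delta
  proof (intro allI impI)
    fix e :: real assume "e > 0"
    then obtain d where d: "d > 0" "\<And>z. \<bar>z - x\<bar> < d \<Longrightarrow> \<bar>f z - f x\<bar> < e / 3"
      using fc[of x] unfolding continuous_at_eps_delta dist_real_def
      by (metis divide_pos_pos zero_less_numeral)
    have close: "?L v \<le> ?L u + 2 * e / 3" if "u \<le> v" "\<bar>u - x\<bar> < d" "\<bar>v - x\<bar> < d" for u v
    proof -
      have "?L v - 2 * e / 3 \<le> ?L u"
      proof (rule lower_bound_greatest)
        fix y assume "u \<le> y"
        show "?L v - 2 * e / 3 \<le> f y"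
        proof (cases "v \<le> y")
          case True
          then show ?thesis using lower_bound_le[OF assms True] \<open>e > 0\<close> by simp
        next
          case False
          then have "\<bar>y - x\<bar> < d" using that \<open>u \<le> y\<close> by linarith
          then have "\<bar>f y - f v\<bar> < 2 * e / 3" using d(2)[of y] d(2)[of v] that(3) by linarith
          then show ?thesis using lower_bound_le[OF assms, of v v] by linarith
        qed
      qed
      then show ?thesis by simp
    qed
    show "\<exists>d>0. \<forall>x'. dist x' x < d \<longrightarrow> dist (?L x') (?L x) < e"
    proof (intro exI[of _ d] conjI allI impI d(1))
      fix x' assume x': "dist x' x < d"
      show "dist (?L x') (?L x) < e"
      proof (cases "x' \<le> x")
        case True
        then show ?thesis using close[OF True] x' monoD[OF mono_lower_bound[OF assms] True] d(1) \<open>e > 0\<close>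
          by (simp add: dist_real_def)
      next
        case False
        then have "x \<le> x'" by simp
        then show ?thesis using close[OF \<open>x \<le> x'\<close>] x' monoD[OF mono_lower_bound[OF assms] \<open>x \<le> x'\<close>] d(1) \<open>e > 0\<close>
          by (simp add: dist_real_def)
      qed
    qed
  qed
  then show ?thesis by (simp add: continuous_on_eq_continuous_at)
qed

section \<open>Reflection, which exchanges the two bounds\<close>

text \<open>Conjugation by x -> -x. It swaps lower and upper bounds and negates rotation numbers, so
  each fact about lower bounds yields its dual.\<close>

definition reflect :: "(real \<Rightarrow> real) \<Rightarrow> real \<Rightarrow> real" where
  "reflect f x = - f (- x)"

lemma reflect_reflect [simp]: "reflect (reflect f) = f"
  by (auto simp: reflect_def)

lemma reflect_funpow: "(reflect f ^^ n) x = - (f ^^ n) (- x)"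
  by (induction n) (auto simp: reflect_def)

lemma degree_one_lift_reflect: "degree_one_lift f \<Longrightarrow> degree_one_lift (reflect f)"
  unfolding degree_one_lift_def reflect_def
proof safe
  assume f: "continuous_on UNIV f" "\<forall>x. f (x + 1) = f x + 1"
  show "continuous_on UNIV (\<lambda>x. - f (- x))"
    by (intro continuous_intros continuous_on_compose2[OF f(1)]) auto
  fix x show "- f (- (x + 1)) = - f (- x) + 1"
    using f(2)[rule_format, of "- x - 1"] by simp
qed

text \<open>No boundedness is required, because the infimum of a set of reals is defined as the
  negated supremum of the negated set.\<close>

lemma upper_bound_reflect: "upper_bound f = reflect (lower_bound (reflect f))"
proof
  fix x :: real
  have "{..x} = uminus ` {- x..}" by simp
  then have "f ` {..x} = (\<lambda>y. f (- y)) ` {- x..}" by (metis image_image)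
  moreover have "uminus ` (\<lambda>y. - f (- y)) ` {- x..} = (\<lambda>y. f (- y)) ` {- x..}"
    by (simp add: image_image)
  ultimately have "f ` {..x} = uminus ` (\<lambda>y. - f (- y)) ` {- x..}" by simp
  then show "upper_bound f x = reflect (lower_bound (reflect f)) x"
    by (simp add: upper_bound_def lower_bound_def reflect_def Inf_real_def)
qed

lemma upper_bound_ge: "degree_one_lift f \<Longrightarrow> y \<le> x \<Longrightarrow> f y \<le> upper_bound f x"
  using lower_bound_le[OF degree_one_lift_reflect, of f "- x" "- y"]
  by (simp add: upper_bound_reflect) (simp add: reflect_def)

lemma upper_bound_eqI:
  assumes "degree_one_lift f" "y \<le> x" "\<And>z. z \<le> x \<Longrightarrow> f z \<le> f y"
  shows "upper_bound f x = f y"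
proof -
  have "lower_bound (reflect f) (- x) = reflect f (- y)"
  proof (rule lower_bound_eqI[OF degree_one_lift_reflect[OF assms(1)]])
    show "- x \<le> - y" using assms(2) by simp
    fix z assume "- x \<le> z"
    then show "reflect f (- y) \<le> reflect f z" using assms(3)[of "- z"] by (simp add: reflect_def)
  qed
  then show ?thesis by (simp add: upper_bound_reflect) (simp add: reflect_def)
qed

lemma mono_reflect: "mono G \<Longrightarrow> mono (reflect G)"
  by (auto simp: mono_def reflect_def)

lemma equivariant_reflect: "equivariant G \<Longrightarrow> equivariant (reflect G)"
  unfolding equivariant_def reflect_def
proof
  fix x assume G: "\<forall>x. G (x + 1) = G x + 1"
  show "- G (- (x + 1)) = - G (- x) + 1" using G[rule_format, of "- x - 1"] by simp
qed

lemma mono_upper_bound: "degree_one_lift f \<Longrightarrow> mono (upper_bound f)"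
  by (simp add: upper_bound_reflect mono_reflect mono_lower_bound degree_one_lift_reflect)

lemma equivariant_upper_bound: "degree_one_lift f \<Longrightarrow> equivariant (upper_bound f)"
  by (simp add: upper_bound_reflect equivariant_reflect equivariant_lower_bound degree_one_lift_reflect)

lemma continuous_upper_bound:
  assumes "degree_one_lift f" shows "continuous_on UNIV (upper_bound f)"
  unfolding upper_bound_reflect reflect_def
  by (intro continuous_intros continuous_on_compose2[OF continuous_lower_bound[OF degree_one_lift_reflect[OF assms], unfolded reflect_def]]) auto

lemma degree_one_lift_add: "degree_one_lift f \<Longrightarrow> degree_one_lift (\<lambda>x. f x + a)"
  by (auto simp: degree_one_lift_def intro!: continuous_intros)

lemma lower_bound_add:
  assumes "degree_one_lift f"
  shows "lower_bound (\<lambda>x. f x + a) = (\<lambda>x. lower_bound f x + a)"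
proof
  fix x
  have 1: "lower_bound (\<lambda>x. f x + a) x - a \<le> lower_bound f x"
    by (rule lower_bound_greatest) (use lower_bound_le[OF degree_one_lift_add[OF assms, of a]] in fastforce)
  have 2: "lower_bound f x + a \<le> lower_bound (\<lambda>x. f x + a) x"
    by (rule lower_bound_greatest) (use lower_bound_le[OF assms] in fastforce)
  show "lower_bound (\<lambda>x. f x + a) x = lower_bound f x + a" using 1 2 by simp
qed

lemma upper_bound_add:
  assumes "degree_one_lift f"
  shows "upper_bound (\<lambda>x. f x + a) = (\<lambda>x. upper_bound f x + a)"
proof
  fix x
  have "reflect (\<lambda>x. f x + a) = (\<lambda>x. reflect f x + (- a))" by (auto simp: reflect_def)
  then show "upper_bound (\<lambda>x. f x + a) x = upper_bound f x + a"
    using lower_bound_add[OF degree_one_lift_reflect[OF assms], of "- a"]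
    by (simp add: upper_bound_reflect) (simp add: reflect_def)
qed

section \<open>Orbits shared by a lift and its lower bound\<close>

text \<open>The last point \<open>x\<close> of the level set of the lower bound works. If
  \<open>f x\<close> were above the level, \<open>f\<close> would stay above it a little to the
  right, and the lower bound could not leave the level at \<open>x\<close>.\<close>

lemma lower_bound_last_preimage:
  assumes f: "degree_one_lift f"
  obtains x where "f x = y" "lower_bound f x = y"
proof -
  let ?L = "lower_bound f"
  have eq: "equivariant ?L" by (rule equivariant_lower_bound[OF f])
  have mono: "mono ?L" by (rule mono_lower_bound[OF f])
  have cont: "continuous_on UNIV ?L" by (rule continuous_lower_bound[OF f])
  define S where "S = {x. ?L x = y}"
  define m where "m = \<lfloor>y - ?L 0\<rfloor>"
  have Lm: "?L (of_int j) = ?L 0 + of_int j" for j using equivariant_add_int[OF eq, of 0 j] by simp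
  have lo: "?L (of_int m) \<le> y" unfolding Lm m_def by linarith
  have hi: "y < ?L (of_int (m + 1))" unfolding Lm m_def by simp linarith
  have "continuous_on {of_int m..of_int (m + 1)} ?L" using cont by (rule continuous_on_subset) simp
  then have "S \<noteq> {}"
    using IVT'[of ?L "of_int m" y "of_int (m + 1)"] lo hi by (auto simp: S_def)
  moreover have bdd: "bdd_above S"
  proof (rule bdd_aboveI)
    fix x assume "x \<in> S"
    then show "x \<le> of_int (m + 1)" using hi monoD[OF mono, of "of_int (m + 1)" x]
      by (auto simp: S_def intro: leI)
  qed
  moreover have "closed S" unfolding S_def
    using continuous_closed_preimage_constant[OF cont closed_UNIV] by simp
  ultimately have Sx: "Sup S \<in> S" by (rule closed_contains_Sup)
  define x where "x = Sup S"
  have Lx: "?L x = y" using Sx by (simp add: S_def x_def)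
  have "f x \<le> y"
  proof (rule ccontr)
    assume "\<not> f x \<le> y"
    then have "f x > y" by simp
    obtain d where d: "d > 0" "\<And>z. \<bar>z - x\<bar> < d \<Longrightarrow> f z > y"
    proof -
      have "isCont f x" using f by (simp add: degree_one_lift_def continuous_on_eq_continuous_at)
      then obtain d where "d > 0" "\<And>z. \<bar>z - x\<bar> < d \<Longrightarrow> \<bar>f z - f x\<bar> < f x - y"
        using \<open>f x > y\<close> unfolding continuous_at_eps_delta dist_real_def by (metis diff_gt_0_iff_gt)
      then show ?thesis using that[of d] by fastforce
    qed
    have "?L (x + d / 2) \<le> ?L x"
    proof -
      have "min y (?L (x + d/2)) < ?L (x + d/2) \<or> ?L (x + d/2) \<le> y" by linarith
      moreover have "y < ?L (x + d/2) \<Longrightarrow> False"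
      proof -
        assume gt: "y < ?L (x + d / 2)"
        have "continuous_on {x..x + d/2} f"
          using f by (auto simp: degree_one_lift_def elim: continuous_on_subset)
        then obtain z where z: "z \<in> {x..x + d/2}" "\<And>w. w \<in> {x..x + d/2} \<Longrightarrow> f z \<le> f w"
          using continuous_attains_inf[of "{x..x + d/2}" f] d(1) by auto
        have "f z > y" using d z by auto
        \<comment> \<open>On the ray from \<open>x\<close>, points up to \<open>x + d/2\<close> have
          value at least \<open>f z\<close> and later ones at least the lower bound at
          \<open>x + d/2\<close>; both exceed \<open>y\<close>.\<close>
        have "min (f z) (?L (x + d / 2)) \<le> ?L x"
        proof (rule lower_bound_greatest)
          fix w assume "x \<le> w"
          show "min (f z) (?L (x + d / 2)) \<le> f w"
          proof (cases "w \<le> x + d / 2")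
            case True
            then show ?thesis using z(2)[of w] \<open>x \<le> w\<close> by auto
          next
            case False
            then show ?thesis using lower_bound_le[OF f, of "x + d/2" w] by auto
          qed
        qed
        then show False using gt \<open>f z > y\<close> Lx by auto
      qed
      ultimately show ?thesis using Lx by force
    qed
    then have "x + d / 2 \<in> S" using Lx monoD[OF mono, of x "x + d/2"] d(1) by (auto simp: S_def)
    then show False using cSup_upper[OF _ bdd] d(1) by (fastforce simp: x_def)
  qed
  then have "f x = y" using lower_bound_le[OF f, of x x] Lx by simp
  then show ?thesis using that Lx by blast
qed

text \<open>Following last preimages backwards gives arbitrarily long common orbit segments of a lift and
  its lower bound, and compactness a common infinite orbit.\<close>

lemma lower_bound_common_orbit:
  assumes f: "degree_one_lift f"
  obtains x where "\<And>n. (f ^^ n) x = (lower_bound f ^^ n) x"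
proof -
  let ?L = "lower_bound f"
  have eqL: "equivariant ?L" by (rule equivariant_lower_bound[OF f])
  have eqf: "equivariant f" using f by (simp add: degree_one_lift_def equivariant_def)
  have cf: "continuous_on UNIV f" using f by (simp add: degree_one_lift_def)
  have cL: "continuous_on UNIV ?L" by (rule continuous_lower_bound[OF f])
  have cfn: "continuous_on UNIV (f ^^ n)" "continuous_on UNIV (?L ^^ n)" for n
    by (induction n) (auto intro: continuous_on_compose2[OF cf] continuous_on_compose2[OF cL]
        simp: id_def o_def)
  define X where "X N = {x \<in> {0..1}. \<forall>n\<le>N. (f ^^ n) x = (?L ^^ n) x}" for N
  have seg: "\<exists>x. (?L ^^ N) x = y \<and> (\<forall>n\<le>N. (f ^^ n) x = (?L ^^ n) x)" for N y
  proof (induction N arbitrary: y)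
    case (Suc N)
    obtain x' where x': "f x' = y" "?L x' = y" using lower_bound_last_preimage[OF f] by blast
    obtain x where x: "(?L ^^ N) x = x'" "\<forall>n\<le>N. (f ^^ n) x = (?L ^^ n) x" using Suc by blast
    have "(?L ^^ Suc N) x = y" "(f ^^ Suc N) x = (?L ^^ Suc N) x" using x x' by auto
    then show ?case using x(2) by (metis le_SucE)
  qed simp
  have ne: "X N \<noteq> {}" for N
  proof -
    obtain x where x: "\<forall>n\<le>N. (f ^^ n) x = (?L ^^ n) x" using seg by blast
    have "x = frac x + of_int \<lfloor>x\<rfloor>" by (simp add: frac_def)
    then have "(f ^^ n) x = (f ^^ n) (frac x) + of_int \<lfloor>x\<rfloor>"
      "(?L ^^ n) x = (?L ^^ n) (frac x) + of_int \<lfloor>x\<rfloor>" for n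
      by (metis funpow_add_int[OF eqf], metis funpow_add_int[OF eqL])
    then have "frac x \<in> X N" using x frac_ge_0[of x] frac_lt_1[of x] by (auto simp: X_def less_imp_le)
    then show ?thesis by blast
  qed
  have cl: "closed (X N)" for N
  proof -
    have "X N = {0..1} \<inter> (\<Inter>n\<in>{..N}. {x. (f ^^ n) x = (?L ^^ n) x})" by (auto simp: X_def)
    moreover have "closed {x. (f ^^ n) x = (?L ^^ n) x}" for n
      by (rule closed_Collect_eq) (use cfn in auto)
    ultimately show ?thesis by (auto intro!: closed_Int closed_INT)
  qed
  have "(\<Inter>N. X N) \<noteq> {}"
  proof (rule compact_nest)
    show "compact (X n)" for n
    proof -
      have "{0..1} \<inter> X n = X n" by (auto simp: X_def)
      then show ?thesis using compact_Int_closed[OF compact_Icc cl[of n]] by metis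
    qed
    show "X m \<subseteq> X n" if "n \<le> m" for m n using that by (auto simp: X_def)
  qed (use ne in auto)
  then obtain x where "\<And>N. x \<in> X N" by blast
  then have "(f ^^ n) x = (?L ^^ n) x" for n by (auto simp: X_def)
  then show ?thesis using that by blast
qed

section \<open>Frequency locking\<close>

lemma lift_lower_bound: "degree_one_lift f \<Longrightarrow> degree_one_lift (lower_bound f)"
  using continuous_lower_bound equivariant_lower_bound by (simp add: degree_one_lift_def equivariant_def)

lemma lift_upper_bound: "degree_one_lift f \<Longrightarrow> degree_one_lift (upper_bound f)"
  using continuous_upper_bound equivariant_upper_bound by (simp add: degree_one_lift_def equivariant_def)

lemma lift_equivariant: "degree_one_lift f \<Longrightarrow> equivariant f"
  by (simp add: degree_one_lift_def equivariant_def)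

lemma lift_continuous: "degree_one_lift f \<Longrightarrow> continuous_on UNIV f"
  by (simp add: degree_one_lift_def)

lemma continuous_on_funpow:
  fixes f :: "'a::topological_space \<Rightarrow> 'a"
  assumes "continuous_on UNIV f"
  shows "continuous_on UNIV (f ^^ n)"
  by (induction n) (auto intro: continuous_on_compose2[OF assms] simp: id_def o_def)

lemma Rot_reflect: "Rot (reflect f) = uminus ` Rot f"
proof -
  have *: "- w \<in> Rot (reflect f)" if w: "w \<in> Rot f" for w f
  proof -
    obtain x where x: "(\<lambda>m. ((f ^^ m) x - x) / real m) \<longlonglongrightarrow> w"
      using w unfolding Rot_def by blast
    have "(\<lambda>m. ((reflect f ^^ m) (- x) - (- x)) / real m) = (\<lambda>m. - (((f ^^ m) x - x) / real m))"
      by (simp add: reflect_funpow minus_divide_left)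
    then have "(\<lambda>m. ((reflect f ^^ m) (- x) - (- x)) / real m) \<longlonglongrightarrow> - w"
      using tendsto_minus[OF x] by simp
    then show ?thesis unfolding Rot_def by blast
  qed
  show ?thesis
  proof (intro antisym subsetI)
    fix w assume "w \<in> Rot (reflect f)"
    then have "- w \<in> Rot f" using *[of w "reflect f"] by simp
    then show "w \<in> uminus ` Rot f" by (metis imageI minus_minus)
  qed (use * in auto)
qed

text \<open>If the return map stayed strictly below translation by \<open>p\<close>, compactness
  would give a uniform deficit \<open>e\<close>, hence rotation number at most
  \<open>(p - e) / q\<close> for the lower bound. An orbit shared with \<open>f\<close> puts that
  rotation number into \<open>Rot f\<close>.\<close>

lemma Rot_eq_imp_lower_bound:
  fixes p :: int
  assumes f: "degree_one_lift f" and q: "q > 0" and Rot: "Rot f = {of_int p / of_nat q}"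
  shows "\<exists>x. (lower_bound f ^^ q) x \<ge> x + of_int p"
proof (rule ccontr)
  let ?L = "lower_bound f"
  assume "\<not> ?thesis"
  then have lt: "(?L ^^ q) x < x + of_int p" for x by (simp add: not_le)
  have mono: "mono ?L" and eq: "equivariant ?L"
    using mono_lower_bound equivariant_lower_bound f by auto
  obtain x where x: "\<And>n. (f ^^ n) x = (?L ^^ n) x" using lower_bound_common_orbit[OF f] by blast
  obtain w where w: "(\<lambda>n. ((?L ^^ n) x - x) / real n) \<longlonglongrightarrow> w"
    using rotation_limit_exists[OF mono eq, of x] by (auto simp: convergent_def)
  have "w \<in> Rot f" unfolding Rot_def mem_Collect_eq by (rule exI[of _ x]) (simp add: x w)
  then have weq: "w = of_int p / of_nat q" using Rot by simp
  have cq: "continuous_on {0..1} (\<lambda>z. (?L ^^ q) z - z)"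
    using continuous_on_funpow[OF continuous_lower_bound[OF f], of q]
    by (auto intro!: continuous_intros elim: continuous_on_subset)
  obtain z0 where z0: "\<And>z. z \<in> {0..1} \<Longrightarrow> (?L ^^ q) z - z \<le> (?L ^^ q) z0 - z0"
    using continuous_attains_sup[OF compact_Icc _ cq] by fastforce
  define e where "e = z0 + of_int p - (?L ^^ q) z0"
  have e: "e > 0" using lt[of z0] by (simp add: e_def)
  have le: "(?L ^^ q) z \<le> z + (of_int p - e)" for z
  proof -
    have "z = frac z + of_int \<lfloor>z\<rfloor>" by (simp add: frac_def)
    then have "(?L ^^ q) z - z = (?L ^^ q) (frac z) - frac z"
      using funpow_add_int[OF eq, of q "frac z" "\<lfloor>z\<rfloor>"] by simp
    then show ?thesis using z0[of "frac z"] frac_ge_0[of z] frac_lt_1[of z] by (simp add: e_def)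
  qed
  have iter: "(?L ^^ (n * q)) x - x \<le> real n * (of_int p - e)" for n
  proof (induction n)
    case (Suc n)
    have "(?L ^^ (Suc n * q)) x = (?L ^^ q) ((?L ^^ (n * q)) x)" by (simp add: funpow_add)
    then show ?case using Suc le[of "(?L ^^ (n * q)) x"] by (simp add: algebra_simps)
  qed simp
  \<comment> \<open>Sampling at positive multiples of \<open>q\<close> keeps the denominators
    nonzero.\<close>
  have "strict_mono (\<lambda>n. Suc n * q)" using q by (auto simp: strict_mono_def)
  from LIMSEQ_subseq_LIMSEQ[OF w this]
  have lim: "(\<lambda>n. ((?L ^^ (Suc n * q)) x - x) / real (Suc n * q)) \<longlonglongrightarrow> w" by (simp add: o_def)
  have "w \<le> (of_int p - e) / real q"
  proof (rule LIMSEQ_le_const2[OF lim])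
    show "\<exists>N. \<forall>n\<ge>N. ((?L ^^ (Suc n * q)) x - x) / real (Suc n * q) \<le> (of_int p - e) / real q"
    proof (intro exI allI impI)
      fix n :: nat
      have "((?L ^^ (Suc n * q)) x - x) / real (Suc n * q) \<le> (real (Suc n) * (of_int p - e)) / real (Suc n * q)"
        by (intro divide_right_mono iter) simp
      also have "\<dots> = (of_int p - e) / real q" unfolding of_nat_mult by (subst mult_divide_mult_cancel_left) (simp_all del: of_nat_Suc)
      finally show "((?L ^^ (Suc n * q)) x - x) / real (Suc n * q) \<le> (of_int p - e) / real q" .
    qed
  qed
  then show False using e q weq by (simp add: divide_le_cancel)
qed

text \<open>Orbits of \<open>f\<close> are squeezed between those of the two bounds. The hypotheses
  place the lower rotation number at or above p/q and the upper one at or below it; since the lower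
  cannot exceed the upper, both equal p/q, and every orbit of \<open>f\<close> has this
  limit.\<close>

lemma Rot_eq_if_bounds:
  fixes p :: int
  assumes f: "degree_one_lift f" and q: "q > 0"
    and lo: "(lower_bound f ^^ q) u \<ge> u + of_int p" and up: "(upper_bound f ^^ q) v \<le> v + of_int p"
  shows "Rot f = {of_int p / of_nat q}"
proof -
  let ?L = "lower_bound f" and ?U = "upper_bound f"
  have L: "mono ?L" "equivariant ?L" and U: "mono ?U" "equivariant ?U"
    using f mono_lower_bound equivariant_lower_bound mono_upper_bound equivariant_upper_bound by auto
  have between: "(?L ^^ n) x \<le> (f ^^ n) x" "(f ^^ n) x \<le> (?U ^^ n) x" for n x
  proof (induction n)
    case (Suc n)
    { case 1
      have "?L ((?L ^^ n) x) \<le> ?L ((f ^^ n) x)" using Suc(1) L(1) by (auto dest: monoD)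
      also have "\<dots> \<le> f ((f ^^ n) x)" by (rule lower_bound_le[OF f]) simp
      finally show ?case by simp }
    { case 2
      have "f ((f ^^ n) x) \<le> ?U ((f ^^ n) x)" by (rule upper_bound_ge[OF f]) simp
      also have "\<dots> \<le> ?U ((?U ^^ n) x)" using Suc(2) U(1) by (auto dest: monoD)
      finally show ?case by simp }
  qed simp_all
  have ge: "w \<ge> of_int p / of_nat q"
    if w: "(\<lambda>n. ((?L ^^ n) x - x) / real n) \<longlonglongrightarrow> w" for w x
  proof -
    \<comment> \<open>An integer translate of \<open>u\<close> lies below \<open>x\<close>; the
      estimate at \<open>u\<close> then transfers to \<open>x\<close> with an error that vanishes
      after division by the time.\<close>
    define k where "k = \<lceil>u - x\<rceil>"
    have k: "u - of_int k \<le> x" unfolding k_def by linarith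
    have "strict_mono (\<lambda>n. q * Suc n)" using q by (auto simp: strict_mono_def)
    from LIMSEQ_subseq_LIMSEQ[OF w this]
    have lim: "(\<lambda>n. ((?L ^^ (q * Suc n)) x - x) / real (q * Suc n)) \<longlonglongrightarrow> w" by (simp add: o_def)
    have ge: "real (Suc n) * of_int p + (u - of_int k - x) \<le> (?L ^^ (q * Suc n)) x - x" for n
    proof -
      have "u + of_int (int (Suc n) * p) \<le> (?L ^^ (q * Suc n)) u" by (rule funpow_ge_iterate[OF L lo])
      also have "\<dots> = (?L ^^ (q * Suc n)) (u - of_int k) + of_int k"
        using funpow_add_int[OF L(2), of "q * Suc n" "u - of_int k" k] by simp
      also have "\<dots> \<le> (?L ^^ (q * Suc n)) x + of_int k"
        using k mono_pow[OF L(1)] by (auto dest: monoD)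
      finally show ?thesis by simp
    qed
    have "(\<lambda>n. (real (Suc n) * of_int p + (u - of_int k - x)) / real (q * Suc n)) \<longlonglongrightarrow> of_int p / of_nat q"
    proof -
      have "(\<lambda>n. of_int p / of_nat q + ((u - of_int k - x) / of_nat q) * inverse (real (Suc n))) \<longlonglongrightarrow>
          of_int p / of_nat q + ((u - of_int k - x) / of_nat q) * 0"
        by (intro tendsto_intros LIMSEQ_inverse_real_of_nat)
      moreover have "of_int p / of_nat q + ((u - of_int k - x) / of_nat q) * inverse (real (Suc n)) =
          (real (Suc n) * of_int p + (u - of_int k - x)) / real (q * Suc n)" for n
        unfolding of_nat_mult using q by (simp add: field_simps del: of_nat_Suc)
      ultimately show ?thesis by simp
    qed
    then show ?thesis
      by (rule LIMSEQ_le[OF _ lim]) (use ge in \<open>auto intro!: exI[of _ 0] divide_right_mono simp del: of_nat_Suc mult_Suc_right\<close>)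
  qed
  have le: "w \<le> of_int p / of_nat q"
    if w: "(\<lambda>n. ((?U ^^ n) x - x) / real n) \<longlonglongrightarrow> w" for w x
  proof -
    define k where "k = \<lceil>x - v\<rceil>"
    have k: "x \<le> v + of_int k" unfolding k_def by linarith
    have "strict_mono (\<lambda>n. q * Suc n)" using q by (auto simp: strict_mono_def)
    from LIMSEQ_subseq_LIMSEQ[OF w this]
    have lim: "(\<lambda>n. ((?U ^^ (q * Suc n)) x - x) / real (q * Suc n)) \<longlonglongrightarrow> w" by (simp add: o_def)
    have ge: "(?U ^^ (q * Suc n)) x - x \<le> real (Suc n) * of_int p + (v + of_int k - x)" for n
    proof -
      have "(?U ^^ (q * Suc n)) x \<le> (?U ^^ (q * Suc n)) (v + of_int k)"
        using k mono_pow[OF U(1)] by (auto dest: monoD)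
      also have "\<dots> = (?U ^^ (q * Suc n)) v + of_int k" by (rule funpow_add_int[OF U(2)])
      also have "(?U ^^ (q * Suc n)) v \<le> v + of_int (int (Suc n) * p)"
        by (rule funpow_le_iterate[OF U up])
      finally show ?thesis by simp
    qed
    have "(\<lambda>n. (real (Suc n) * of_int p + (v + of_int k - x)) / real (q * Suc n)) \<longlonglongrightarrow> of_int p / of_nat q"
    proof -
      have "(\<lambda>n. of_int p / of_nat q + ((v + of_int k - x) / of_nat q) * inverse (real (Suc n))) \<longlonglongrightarrow>
          of_int p / of_nat q + ((v + of_int k - x) / of_nat q) * 0"
        by (intro tendsto_intros LIMSEQ_inverse_real_of_nat)
      moreover have "of_int p / of_nat q + ((v + of_int k - x) / of_nat q) * inverse (real (Suc n)) =
          (real (Suc n) * of_int p + (v + of_int k - x)) / real (q * Suc n)" for n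
        unfolding of_nat_mult using q by (simp add: field_simps del: of_nat_Suc)
      ultimately show ?thesis by simp
    qed
    then show ?thesis
      by (rule LIMSEQ_le[OF lim]) (use ge in \<open>auto intro!: exI[of _ 0] divide_right_mono simp del: of_nat_Suc mult_Suc_right\<close>)
  qed
  have main: "(\<lambda>n. ((f ^^ n) x - x) / real n) \<longlonglongrightarrow> of_int p / of_nat q" for x
  proof -
    obtain wl where wl: "(\<lambda>n. ((?L ^^ n) x - x) / real n) \<longlonglongrightarrow> wl"
      using rotation_limit_exists[OF L, of x] by (auto simp: convergent_def)
    obtain wu where wu: "(\<lambda>n. ((?U ^^ n) x - x) / real n) \<longlonglongrightarrow> wu"
      using rotation_limit_exists[OF U, of x] by (auto simp: convergent_def)
    have "wl \<le> wu"
      by (rule LIMSEQ_le[OF wl wu])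
        (use order_trans[OF between] in \<open>auto intro!: exI[of _ 0] divide_right_mono\<close>)
    then have "wl = of_int p / of_nat q" "wu = of_int p / of_nat q"
      using ge[OF wl] le[OF wu] by auto
    then have "(\<lambda>n. ((?L ^^ n) x - x) / real n) \<longlonglongrightarrow> of_int p / of_nat q"
      "(\<lambda>n. ((?U ^^ n) x - x) / real n) \<longlonglongrightarrow> of_int p / of_nat q" using wl wu by simp_all
    then show ?thesis
      by (rule real_tendsto_sandwich[rotated 2])
        (auto intro!: always_eventually divide_right_mono simp: between)
  qed
  show ?thesis
  proof (intro antisym subsetI)
    fix w assume "w \<in> Rot f"
    then obtain x where "(\<lambda>m. ((f ^^ m) x - x) / real m) \<longlonglongrightarrow> w" by (auto simp: Rot_def)
    then have "w = of_int p / of_nat q" using main LIMSEQ_unique by blast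
    then show "w \<in> {of_int p / of_nat q}" by simp
  next
    fix w :: real assume "w \<in> {of_int p / of_nat q}"
    then show "w \<in> Rot f" using main by (auto simp: Rot_def)
  qed
qed

lemma Rot_eq_iff:
  fixes p :: int
  assumes f: "degree_one_lift f" and q: "q > 0"
  shows "Rot f = {of_int p / of_nat q} \<longleftrightarrow>
    (\<exists>x. (lower_bound f ^^ q) x \<ge> x + of_int p) \<and> (\<exists>x. (upper_bound f ^^ q) x \<le> x + of_int p)"
proof
  assume Rot: "Rot f = {of_int p / of_nat q}"
  then have "Rot (reflect f) = {of_int (- p) / of_nat q}" by (simp add: Rot_reflect)
  from Rot_eq_imp_lower_bound[OF degree_one_lift_reflect[OF f] q this]
  obtain x where "(lower_bound (reflect f) ^^ q) x \<ge> x - of_int p" by auto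
  moreover have "(lower_bound (reflect f) ^^ q) x = - (upper_bound f ^^ q) (- x)"
    using reflect_funpow[where f="upper_bound f" and n=q and x=x] by (simp add: upper_bound_reflect)
  ultimately have "(upper_bound f ^^ q) (- x) \<le> - x + of_int p" by simp
  then show "(\<exists>x. (lower_bound f ^^ q) x \<ge> x + of_int p) \<and> (\<exists>x. (upper_bound f ^^ q) x \<le> x + of_int p)"
    using Rot_eq_imp_lower_bound[OF f q Rot] by blast
qed (use Rot_eq_if_bounds[OF f q] in blast)

section \<open>Translation families and their extremal parameters\<close>

abbreviation (input) translate :: "(real \<Rightarrow> real) \<Rightarrow> real \<Rightarrow> real \<Rightarrow> real" where
  "translate G a \<equiv> (\<lambda>x. G x + a)"

text \<open>The earlier steps only preserve the order; the full difference \<open>b - a\<close> is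
  gained at the last one.\<close>

lemma translate_funpow_gap:
  assumes "mono G" "a \<le> b" "n > 0"
  shows "(translate G a ^^ n) x + (b - a) \<le> (translate G b ^^ n) x"
proof -
  have le: "(translate G a ^^ n) x \<le> (translate G b ^^ n) x" for n
  proof (induction n)
    case (Suc n)
    then show ?case using assms(2) monoD[OF assms(1) Suc] by simp
  qed simp
  obtain m where "n = Suc m" using assms(3) gr0_conv_Suc by blast
  then show ?thesis using monoD[OF assms(1) le[of m]] by simp
qed

lemma translate_funpow_mono:
  assumes "mono G" "a \<le> b"
  shows "(translate G a ^^ n) x \<le> (translate G b ^^ n) x"
  using translate_funpow_gap[OF assms, of n x] assms(2) by (cases n) auto

lemma translate_funpow_strict:
  assumes "mono G" "a < b" "n > 0"
  shows "(translate G a ^^ n) x < (translate G b ^^ n) x"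
  using translate_funpow_gap[of G a b n x] assms by auto

lemma mono_translate: "mono G \<Longrightarrow> mono (translate G a)"
  by (auto simp: mono_def)

lemma equivariant_translate: "equivariant G \<Longrightarrow> equivariant (translate G a)"
  by (auto simp: equivariant_def)

lemma continuous_translate_funpow:
  assumes "continuous_on UNIV G"
  shows "continuous_on UNIV (\<lambda>(a, x). (translate G a ^^ n) x)"
proof (induction n)
  case (Suc n)
  have eq: "(\<lambda>(a, x). (translate G a ^^ Suc n) x) =
      (\<lambda>y. G ((\<lambda>(a, x). (translate G a ^^ n) x) y) + fst y)" by auto
  show ?case unfolding eq
    by (intro continuous_intros continuous_on_compose2[OF assms Suc]) auto
qed (auto simp: case_prod_beta intro: continuous_intros)

lemma continuous_translate_funpow_param:
  assumes "continuous_on UNIV G"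
  shows "continuous_on S (\<lambda>a. (translate G a ^^ n) x)"
proof -
  have "continuous_on S (\<lambda>a. (a, x))" by (intro continuous_intros)
  from continuous_on_compose2[OF continuous_translate_funpow[OF assms, of n] this] show ?thesis by simp
qed

text \<open>The parameters form an up-set, bounded below by the displacement estimate, and it
  contains its infimum because witnesses can be taken in the compact \<open>{0..1}\<close>. At the
  minimum no point moves by more than \<open>p\<close>: a strict inequality would survive a small
  decrease of the parameter.\<close>

lemma least_rotating_translate:
  fixes p :: int
  assumes G: "degree_one_lift G" "mono G" and q: "q > 0"
  obtains l where "{a. \<exists>x. (translate G a ^^ q) x \<ge> x + of_int p} = {l..}"
    and "\<And>x. (translate G l ^^ q) x \<le> x + of_int p"
proof -
  let ?Q = "\<lambda>a x. (translate G a ^^ q) x \<ge> x + of_int p"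
  define S where "S = {a. \<exists>x. ?Q a x}"
  have eq: "equivariant G" and cont: "continuous_on UNIV G"
    by (rule lift_equivariant[OF G(1)], rule lift_continuous[OF G(1)])
  obtain M where M: "\<And>x. \<bar>G x - x\<bar> \<le> M" using lift_displacement_bounded[OF G(1)] by blast
  have up: "b \<in> S" if "a \<in> S" "a \<le> b" for a b
  proof -
    obtain x where "?Q a x" using \<open>a \<in> S\<close> by (auto simp: S_def)
    then have "?Q b x" using translate_funpow_mono[OF G(2) that(2), where n=q and x=x] by linarith
    then show ?thesis by (auto simp: S_def)
  qed
  have Q01: "\<exists>x\<in>{0..1}. ?Q a x" if aS: "a \<in> S" for a
  proof -
    obtain x where x: "?Q a x" using aS by (auto simp: S_def)
    have "(translate G a ^^ q) x = (translate G a ^^ q) (frac x) + of_int \<lfloor>x\<rfloor>"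
      using funpow_add_int[OF equivariant_translate[OF eq], where n=q and x="frac x" and m="\<lfloor>x\<rfloor>"]
      by (simp add: frac_def)
    then have "?Q a (frac x)" using x by (simp add: frac_def)
    then show ?thesis using frac_ge_0[of x] frac_lt_1[of x] by (auto intro!: bexI[of _ "frac x"] simp: less_imp_le)
  qed
  \<comment> \<open>With this translation every step advances by at least
    \<open>\<bar>p\<bar>\<close>, so \<open>q\<close> steps suffice.\<close>
  have ne: "M + \<bar>of_int p\<bar> \<in> S"
  proof -
    have "(translate G (M + \<bar>of_int p\<bar>) ^^ n) 0 \<ge> real n * \<bar>of_int p\<bar>" for n
    proof (induction n)
      case (Suc n)
      then show ?case using M[of "(translate G (M + \<bar>of_int p\<bar>) ^^ n) 0"] by (simp add: algebra_simps)
    qed simp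
    from this[of q] have "(translate G (M + \<bar>of_int p\<bar>) ^^ q) 0 \<ge> real q * \<bar>of_int p\<bar>" .
    moreover have "1 * \<bar>of_int p\<bar> \<le> real q * \<bar>of_int p :: real\<bar>" using q by (intro mult_right_mono) auto
    ultimately show ?thesis unfolding S_def by (auto intro!: exI[of _ 0])
  qed
  have lower: "- M - \<bar>of_int p\<bar> \<le> a" if aS: "a \<in> S" for a
  proof (rule ccontr)
    assume "\<not> - M - \<bar>of_int p\<bar> \<le> a"
    then have a: "a < - M - \<bar>of_int p\<bar>" by simp
    obtain x where x: "?Q a x" using aS by (auto simp: S_def)
    have "(translate G a ^^ Suc n) x < x - real (Suc n) * \<bar>of_int p\<bar>" for n
    proof (induction n)
      case 0
      show ?case using M[of x] a by simp
    next
      case (Suc n)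
      then show ?case using M[of "(translate G a ^^ Suc n) x"] a by (simp add: algebra_simps)
    qed
    from this[of "q - 1"] have "(translate G a ^^ q) x < x - real q * \<bar>of_int p\<bar>" using q by simp
    moreover have "1 * \<bar>of_int p\<bar> \<le> real q * \<bar>of_int p :: real\<bar>" using q by (intro mult_right_mono) auto
    ultimately show False using x by linarith
  qed
  define l where "l = Inf S"
  have bdd: "bdd_below S" by (rule bdd_belowI) (rule lower)
  have l_le: "l \<le> a" if "a \<in> S" for a unfolding l_def using that bdd by (rule cInf_lower)
  \<comment> \<open>Cutting the parameter off at \<open>l + 1\<close> gives a compact set of pairs
    of a parameter and a witness; its projection is the lowest part of \<open>S\<close>.\<close>
  define A where "A = ({l..l + 1} \<times> {0..1}) \<inter> {z. snd z + of_int p \<le> (\<lambda>(a, x). (translate G a ^^ q) x) z}"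
  have "closed {z. snd z + of_int p \<le> (\<lambda>(a, x). (translate G a ^^ q) x) z}"
    by (rule closed_Collect_le) (use continuous_translate_funpow[OF cont, of q] in \<open>auto intro!: continuous_intros\<close>)
  then have "compact A" unfolding A_def by (intro compact_Int_closed compact_Times compact_Icc)
  then have comp: "compact (fst ` A)" by (intro compact_continuous_image continuous_intros)
  have sub: "S \<inter> {l..l + 1} = fst ` A"
  proof (intro antisym subsetI)
    fix a assume a: "a \<in> S \<inter> {l..l + 1}"
    then obtain x where "x \<in> {0..1}" "?Q a x" using Q01 by blast
    then have "(a, x) \<in> A" using a by (auto simp: A_def)
    then show "a \<in> fst ` A" by (metis fst_conv imageI)
  next
    fix a assume "a \<in> fst ` A"
    then show "a \<in> S \<inter> {l..l + 1}" by (auto simp: A_def S_def)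
  qed
  obtain s where s: "s \<in> S" "s < l + 1"
    using cInf_lessD[of S "l + 1"] ne unfolding l_def by auto
  have "s \<in> fst ` A" using s l_le unfolding sub[symmetric] by auto
  then obtain m where m: "m \<in> fst ` A" "\<And>t. t \<in> fst ` A \<Longrightarrow> m \<le> t"
    using compact_attains_inf[OF comp] by blast
  have mS: "m \<in> S" using m(1) sub by blast
  have "m \<le> a" if "a \<in> S" for a
  proof (cases "a \<le> l + 1")
    case True
    then have "a \<in> S \<inter> {l..l + 1}" using that l_le by simp
    then show ?thesis unfolding sub by (rule m(2))
  next
    case False
    moreover have "m \<le> l + 1" using m(1) unfolding sub[symmetric] by simp
    ultimately show ?thesis by simp
  qed
  then have Seq: "S = {m..}" using up mS by auto
  have "(translate G m ^^ q) x \<le> x + of_int p" for x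
  proof (rule ccontr)
    assume "\<not> ?thesis"
    then have gt: "(translate G m ^^ q) x > x + of_int p" by simp
    have "isCont (\<lambda>a. (translate G a ^^ q) x) m"
      using continuous_translate_funpow_param[OF cont, of UNIV q x]
      by (simp add: continuous_on_eq_continuous_at)
    then have "\<forall>\<^sub>F a in at m. (translate G a ^^ q) x > x + of_int p"
      using gt unfolding isCont_def by (rule order_tendstoD(1))
    then have "\<forall>\<^sub>F a in at_left m. (translate G a ^^ q) x > x + of_int p"
      by (simp add: eventually_at_split)
    moreover have "\<forall>\<^sub>F a in at_left m. a < m" by (simp add: eventually_at_filter)
    ultimately have "\<forall>\<^sub>F a in at_left m. a < m \<and> (translate G a ^^ q) x > x + of_int p"
      by eventually_elim auto
    then obtain a where "a < m" "(translate G a ^^ q) x > x + of_int p"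
      using eventually_happens[of _ "at_left m"] trivial_limit_at_left_real by blast
    then have "a \<in> S" by (auto simp: S_def intro!: exI[of _ x])
    then show False using Seq \<open>a < m\<close> by auto
  qed
  then show ?thesis using that[of m] Seq by (simp add: S_def)
qed

text \<open>Reflecting \<open>G\<close> turns translation by \<open>a\<close> into translation by
  \<open>- a\<close>, so a greatest parameter arises as the negative of a least one.\<close>

lemma greatest_rotating_translate:
  fixes p :: int
  assumes G: "degree_one_lift G" "mono G" and q: "q > 0"
  obtains u where "{a. \<exists>x. (translate G a ^^ q) x \<le> x + of_int p} = {..u}"
proof -
  obtain l where l: "{a. \<exists>x. (translate (reflect G) a ^^ q) x \<ge> x + of_int (- p)} = {l..}"
    using least_rotating_translate[OF degree_one_lift_reflect[OF G(1)] mono_reflect[OF G(2)] q] by blast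
  have "(\<exists>x. (translate G a ^^ q) x \<le> x + of_int p) \<longleftrightarrow> - a \<in> {l..}" for a
  proof -
    have refl: "translate (reflect G) (- a) = reflect (translate G a)" by (auto simp: reflect_def)
    have "- a \<in> {l..} \<longleftrightarrow> (\<exists>x. (reflect (translate G a) ^^ q) x \<ge> x - of_int p)"
      unfolding l[symmetric] refl[symmetric] by simp
    also have "\<dots> \<longleftrightarrow> (\<exists>x. (translate G a ^^ q) (- x) \<le> - x + of_int p)"
      unfolding reflect_funpow by (simp add: algebra_simps)
    also have "\<dots> \<longleftrightarrow> (\<exists>x. (translate G a ^^ q) x \<le> x + of_int p)" by (metis minus_minus)
    finally show ?thesis by simp
  qed
  then have "{a. \<exists>x. (translate G a ^^ q) x \<le> x + of_int p} = {..- l}" by auto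
  then show ?thesis using that by blast
qed

section \<open>Negative Schwarzian derivative and cross ratios\<close>

text \<open>The product of the middle and the total length over the product of the outer lengths,
  for \<open>a < b < c < d\<close>; it is invariant under Moebius maps that preserve the order of
  the four points.\<close>

definition cross_ratio :: "real \<Rightarrow> real \<Rightarrow> real \<Rightarrow> real \<Rightarrow> real" where
  "cross_ratio a b c d = ((c - b) * (d - a)) / ((b - a) * (d - c))"

lemma cross_ratio_plus_1:
  assumes "a < b" "c < d"
  shows "cross_ratio a b c d + 1 = (c - a) * (d - b) / ((b - a) * (d - c))"
proof -
  have "(c - b) * (d - a) + (b - a) * (d - c) = (c - a) * (d - b)" by algebra
  moreover have "(b - a) * (d - c) \<noteq> 0" using assms by simp
  ultimately show ?thesis unfolding cross_ratio_def by (metis add_divide_distrib divide_self)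
qed

text \<open>In this form the cross ratio depends only on the middle length relative to each outer
  one, so it visibly falls when the middle shrinks and the outer pieces grow.\<close>

lemma cross_ratio_alt:
  assumes "a < b" "c < d"
  shows "cross_ratio a b c d + 1 = (1 + (c - b) / (b - a)) * (1 + (c - b) / (d - c))"
proof -
  have "1 + (c - b) / (b - a) = (c - a) / (b - a)" "1 + (c - b) / (d - c) = (d - b) / (d - c)"
    using assms by (simp_all add: field_simps)
  then show ?thesis using cross_ratio_plus_1[OF assms] by simp
qed

lemma cross_ratio_add: "cross_ratio (a + t) (b + t) (c + t) (d + t) = cross_ratio a b c d"
  by (simp add: cross_ratio_def)

lemma cross_ratio_antimono:
  assumes "a < b" "b < c" "c < d"
    and "b - a \<le> b' - a'" "b' < c'" "c' - b' \<le> c - b" "d - c \<le> d' - c'"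
  shows "cross_ratio a' b' c' d' \<le> cross_ratio a b c d"
proof -
  have "(c' - b') / (b' - a') \<le> (c - b) / (b - a)" "(c' - b') / (d' - c') \<le> (c - b) / (d - c)"
    using assms by (auto intro!: frac_le)
  then have "(1 + (c' - b') / (b' - a')) * (1 + (c' - b') / (d' - c')) \<le>
      (1 + (c - b) / (b - a)) * (1 + (c - b) / (d - c))"
    using assms by (intro mult_mono) auto
  then show ?thesis using cross_ratio_alt[of a b c d] cross_ratio_alt[of a' b' c' d'] assms by simp
qed

text \<open>If \<open>h t \<ge> 0\<close>, the mean value theorem yields a nonnegative slope before
  \<open>t\<close> and a nonpositive one after it, while \<open>h'\<close> is strictly
  increasing.\<close>

lemma strictly_convex_below_chord:
  fixes h :: "real \<Rightarrow> real"
  assumes "x < t" "t < y"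
    and h': "\<And>s. x \<le> s \<Longrightarrow> s \<le> y \<Longrightarrow> (h has_real_derivative h' s) (at s)"
    and h'': "\<And>s. x \<le> s \<Longrightarrow> s \<le> y \<Longrightarrow> (h' has_real_derivative h'' s) (at s)"
    and pos: "\<And>s. x < s \<Longrightarrow> s < y \<Longrightarrow> h'' s > 0"
    and ends: "h x = 0" "h y = 0"
  shows "h t < 0"
proof (rule ccontr)
  assume "\<not> h t < 0"
  then have ht: "h t \<ge> 0" by simp
  obtain u where u: "x < u" "u < t" "h t - h x = (t - x) * h' u"
    using MVT2[of x t h h'] h' assms(1,2) by fastforce
  obtain v where v: "t < v" "v < y" "h y - h t = (y - t) * h' v"
    using MVT2[of t y h h'] h' assms(1,2) by fastforce
  have "h' u \<ge> 0"
  proof -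
    have "0 \<le> (t - x) * h' u" using u(3) ht ends by simp
    then show ?thesis using assms(1) by (simp add: zero_le_mult_iff)
  qed
  moreover have "h' v \<le> 0"
  proof -
    have "(y - t) * h' v \<le> 0" using v(3) ht ends by simp
    then show ?thesis using assms(2) by (simp add: mult_le_0_iff)
  qed
  moreover have "h' u < h' v"
  proof (rule DERIV_pos_imp_increasing_open[where f = h'])
    show "u < v" using u v by simp
    show "\<exists>z. (h' has_real_derivative z) (at s) \<and> z > 0" if "u < s" "s < v" for s
      using h''[of s] pos[of s] that u v by auto
    show "continuous_on {u..v} h'"
    proof (intro continuous_at_imp_continuous_on ballI)
      fix s assume "s \<in> {u..v}"
      then show "isCont h' s" using u v by (intro DERIV_isCont[OF h''[of s]]) auto
    qed
  qed
  ultimately show False by simp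
qed

text \<open>Negative Schwarzian derivative means that \<open>1 / sqrt f'\<close> is strictly convex; comparing \<open>f\<close>
  with the Moebius map for which this function is the chord gives the inequality.\<close>

lemma derivative_product_less_slope:
  fixes f :: "real \<Rightarrow> real"
  assumes xy: "x < y"
    and d1: "\<And>s. x \<le> s \<Longrightarrow> s \<le> y \<Longrightarrow> (f has_real_derivative f1 s) (at s)"
    and d2: "\<And>s. x \<le> s \<Longrightarrow> s \<le> y \<Longrightarrow> (f1 has_real_derivative f2 s) (at s)"
    and d3: "\<And>s. x \<le> s \<Longrightarrow> s \<le> y \<Longrightarrow> (f2 has_real_derivative f3 s) (at s)"
    and pos: "\<And>s. x \<le> s \<Longrightarrow> s \<le> y \<Longrightarrow> f1 s > 0"
    and S: "\<And>s. x \<le> s \<Longrightarrow> s \<le> y \<Longrightarrow> f3 s / f1 s - 3 / 2 * (f2 s / f1 s)\<^sup>2 < 0"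
  shows "f1 x * f1 y < ((f y - f x) / (y - x))\<^sup>2"
proof -
  define g where "g s = f1 s powr (- 1 / 2)" for s
  define g1 where "g1 s = - 1 / 2 * f1 s powr (- 3 / 2) * f2 s" for s
  define g2 where "g2 s = 3 / 4 * f1 s powr (- 5 / 2) * (f2 s)\<^sup>2 - 1 / 2 * f1 s powr (- 3 / 2) * f3 s" for s
  have gpos: "g s > 0" if "x \<le> s" "s \<le> y" for s using pos[OF that] by (simp add: g_def)
  have g1: "(g has_real_derivative g1 s) (at s)" if "x \<le> s" "s \<le> y" for s
  proof -
    have "((\<lambda>s. f1 s powr (- 1 / 2)) has_real_derivative
        (- 1 / 2) * f1 s powr (- 1 / 2 - of_nat 1) * f2 s) (at s)"
      by (rule DERIV_fun_powr[OF d2[OF that] pos[OF that]])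
    then show ?thesis by (simp add: g_def[abs_def] g1_def)
  qed
  have g2: "(g1 has_real_derivative g2 s) (at s)" if "x \<le> s" "s \<le> y" for s
  proof -
    have "((\<lambda>s. f1 s powr (- 3 / 2)) has_real_derivative
        (- 3 / 2) * f1 s powr (- 3 / 2 - of_nat 1) * f2 s) (at s)"
      by (rule DERIV_fun_powr[OF d2[OF that] pos[OF that]])
    then have "((\<lambda>s. f1 s powr (- 3 / 2)) has_real_derivative
        (- 3 / 2) * f1 s powr (- 5 / 2) * f2 s) (at s)" by simp
    from DERIV_cmult[OF DERIV_mult[OF this d3[OF that]], of "- 1 / 2"] show ?thesis
      by (simp add: g1_def[abs_def] g2_def power2_eq_square algebra_simps)
  qed
  have g2pos: "g2 s > 0" if "x \<le> s" "s \<le> y" for s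
  proof -
    have p: "f1 s > 0" by (rule pos[OF that])
    have e: "f1 s powr (- 3 / 2) = g s / f1 s" "f1 s powr (- 5 / 2) = g s / (f1 s)\<^sup>2"
    proof -
      have "f1 s powr (- 3 / 2) = f1 s powr (- 1 / 2 - 1)" by simp
      then show "f1 s powr (- 3 / 2) = g s / f1 s" using p unfolding g_def
        by (subst (asm) powr_diff) simp
      have "f1 s powr (- 5 / 2) = f1 s powr (- 1 / 2 - 2)" by simp
      then show "f1 s powr (- 5 / 2) = g s / (f1 s)\<^sup>2" using p unfolding g_def
        by (subst (asm) powr_diff) simp
    qed
    \<comment> \<open>This is the identity g'' = - (1/2) g S(f) for g = 1 / sqrt f', so a negative
      Schwarzian means convexity.\<close>
    have "g2 s = - 1 / 2 * g s * (f3 s / f1 s - 3 / 2 * (f2 s / f1 s)\<^sup>2)"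
      unfolding g2_def e using p by (simp add: field_simps power2_eq_square)
    then show ?thesis using S[OF that] gpos[OF that] by (simp add: mult_neg_pos mult_pos_neg)
  qed
  define k where "k = (g y - g x) / (y - x)"
  define l where "l s = g x + k * (s - x)" for s
  have lx: "l x = g x" and ly: "l y = g y" using xy by (simp_all add: l_def k_def)
  have below: "g t < l t" if "x < t" "t < y" for t
  proof -
    have "g t - l t < 0"
    proof (rule strictly_convex_below_chord[OF that, where h' = "\<lambda>s. g1 s - k" and h'' = g2])
      show "((\<lambda>t. g t - l t) has_real_derivative g1 s - k) (at s)" if "x \<le> s" "s \<le> y" for s
        unfolding l_def by (auto intro!: derivative_eq_intros g1[OF that])
      show "((\<lambda>s. g1 s - k) has_real_derivative g2 s) (at s)" if "x \<le> s" "s \<le> y" for s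
        by (auto intro!: derivative_eq_intros g2[OF that])
    qed (use g2pos lx ly in auto)
    then show ?thesis by simp
  qed
  have lpos: "l s > 0" if "x \<le> s" "s \<le> y" for s
    using that gpos below[of s] lx ly by (metis less_eq_real_def less_trans)
  \<comment> \<open>The Moebius map vanishing at \<open>x\<close> with derivative
    \<open>1 / (l s)\<^sup>2\<close>; this derivative agrees with \<open>f1\<close> at both ends and
    is smaller in between.\<close>
  define m where "m s = (s - x) / (g x * l s)" for s
  have m': "(m has_real_derivative 1 / (l s)\<^sup>2) (at s)" if "x \<le> s" "s \<le> y" for s
  proof -
    have p: "g x > 0" "l s > 0" using gpos lpos that xy by auto
    have "((\<lambda>s. g x * l s) has_real_derivative g x * k) (at s)"
      unfolding l_def by (auto intro!: derivative_eq_intros)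
    moreover have "((\<lambda>s. s - x) has_real_derivative 1) (at s)" by (auto intro!: derivative_eq_intros)
    ultimately have "(m has_real_derivative
        (1 * (g x * l s) - (s - x) * (g x * k)) / ((g x * l s) * (g x * l s))) (at s)"
      unfolding m_def using p by (intro DERIV_divide) auto
    moreover have "1 * (g x * l s) - (s - x) * (g x * k) = g x * g x"
      by (simp add: l_def algebra_simps)
    ultimately show ?thesis using p by (simp add: power2_eq_square)
  qed
  have gsq: "f1 s = 1 / (g s)\<^sup>2" if "x \<le> s" "s \<le> y" for s
  proof -
    have "(g s)\<^sup>2 = f1 s powr (- 1)" unfolding g_def
      by (simp add: power2_eq_square flip: powr_add)
    then show ?thesis using pos[OF that] by (simp add: powr_minus_divide)
  qed
  have "f x - m x < f y - m y"
  proof (rule DERIV_pos_imp_increasing_open[where f = "\<lambda>s. f s - m s", OF xy])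
    fix s assume s: "x < s" "s < y"
    have "(g s)\<^sup>2 < (l s)\<^sup>2" using below[OF s] gpos[of s] s by (intro power_strict_mono) auto
    then have "f1 s - 1 / (l s)\<^sup>2 > 0"
      using gsq[of s] gpos[of s] s by (simp add: frac_less2)
    then show "\<exists>z. ((\<lambda>s. f s - m s) has_real_derivative z) (at s) \<and> z > 0"
      using s by (intro exI[of _ "f1 s - 1 / (l s)\<^sup>2"] conjI DERIV_diff d1 m') auto
  next
    show "continuous_on {x..y} (\<lambda>s. f s - m s)"
      using d1 m' by (intro continuous_at_imp_continuous_on ballI continuous_intros DERIV_isCont) auto
  qed
  then have gt: "(y - x) / (g x * g y) < f y - f x" by (simp add: m_def ly)
  have gg: "g x * g y > 0" using gpos xy by simp
  have "1 / (g x * g y) < (f y - f x) / (y - x)"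
    using gt xy gg by (simp add: pos_less_divide_eq)
  then have "(1 / (g x * g y))\<^sup>2 < ((f y - f x) / (y - x))\<^sup>2"
    using gg by (intro power_strict_mono) auto
  moreover have "(1 / (g x * g y))\<^sup>2 = f1 x * f1 y"
    using gsq[of x] gsq[of y] xy by (simp add: power_mult_distrib power_divide)
  ultimately show ?thesis by simp
qed

text \<open>The logarithm of \<open>1 + 1 / cross_ratio\<close> is a mixed second difference of
  \<open>ln (y - x)\<close>; the preceding inequality says that the mixed partial derivative of
  \<open>ln (f y - f x) - ln (y - x)\<close> is negative.\<close>

lemma negative_schwarzian_cross_ratio:
  fixes f :: "real \<Rightarrow> real"
  assumes abcd: "a < b" "b < c" "c < d"
    and d1: "\<And>s. a \<le> s \<Longrightarrow> s \<le> d \<Longrightarrow> (f has_real_derivative f1 s) (at s)"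
    and d2: "\<And>s. a \<le> s \<Longrightarrow> s \<le> d \<Longrightarrow> (f1 has_real_derivative f2 s) (at s)"
    and d3: "\<And>s. a \<le> s \<Longrightarrow> s \<le> d \<Longrightarrow> (f2 has_real_derivative f3 s) (at s)"
    and pos: "\<And>s. a \<le> s \<Longrightarrow> s \<le> d \<Longrightarrow> f1 s > 0"
    and S: "\<And>s. a \<le> s \<Longrightarrow> s \<le> d \<Longrightarrow> f3 s / f1 s - 3 / 2 * (f2 s / f1 s)\<^sup>2 < 0"
  shows "cross_ratio a b c d < cross_ratio (f a) (f b) (f c) (f d)"
proof -
  have incr: "f x < f y" if "a \<le> x" "x < y" "y \<le> d" for x y
  proof (rule DERIV_pos_imp_increasing[OF that(2)])
    fix s assume "x \<le> s" "s \<le> y"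
    then show "\<exists>z. (f has_real_derivative z) (at s) \<and> z > 0"
      using d1[of s] pos[of s] that by (intro exI[of _ "f1 s"]) simp
  qed
  \<comment> \<open>The derivative in \<open>y\<close> of
    \<open>ln (f y - f x) - ln (y - x)\<close>.\<close>
  define Q where "Q x y = f1 y / (f y - f x) - 1 / (y - x)" for x y
  have Q_dec: "Q b y < Q a y" if y: "c \<le> y" "y \<le> d" for y
  proof (rule DERIV_neg_imp_decreasing[where f = "\<lambda>x. Q x y", OF abcd(1)])
    fix x assume x: "a \<le> x" "x \<le> b"
    have xy: "x < y" "f x < f y" using x y abcd incr by auto
    have "f1 x * f1 y < ((f y - f x) / (y - x))\<^sup>2"
      by (rule derivative_product_less_slope[where ?f2.0 = f2 and ?f3.0 = f3]) (use d1 d2 d3 pos S x y xy in auto)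
    then have "f1 x * f1 y / (f y - f x)\<^sup>2 - 1 / (y - x)\<^sup>2 < 0"
      using xy by (simp add: field_simps)
    moreover have "((\<lambda>x. Q x y) has_real_derivative f1 x * f1 y / (f y - f x)\<^sup>2 - 1 / (y - x)\<^sup>2) (at x)"
      unfolding Q_def using x y xy abcd
      by (auto intro!: derivative_eq_intros d1 simp: power2_eq_square)
    ultimately show "\<exists>z. ((\<lambda>x. Q x y) has_real_derivative z) (at x) \<and> z < 0" by blast
  qed
  define D where "D x y = ln (f y - f x) - ln (y - x)" for x y
  have D': "((\<lambda>y. D x y) has_real_derivative Q x y) (at y)" if "a \<le> x" "x \<le> b" "c \<le> y" "y \<le> d" for x y
  proof -
    have "x < y" "f x < f y" using that abcd incr by auto
    then show ?thesis unfolding D_def Q_def using that abcd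
      by (auto intro!: derivative_eq_intros d1)
  qed
  have "D b d - D a d < D b c - D a c"
  proof (rule DERIV_neg_imp_decreasing[where f = "\<lambda>y. D b y - D a y", OF abcd(3)])
    fix y assume y: "c \<le> y" "y \<le> d"
    then show "\<exists>z. ((\<lambda>y. D b y - D a y) has_real_derivative z) (at y) \<and> z < 0"
      using Q_dec[OF y] abcd by (intro exI[of _ "Q b y - Q a y"] conjI DERIV_diff D') auto
  qed
  then have ln: "ln (f d - f b) + ln (f c - f a) + ln (c - b) + ln (d - a) <
      ln (d - b) + ln (c - a) + ln (f c - f b) + ln (f d - f a)"
    by (simp add: D_def)
  have f: "f a < f b" "f b < f c" "f c < f d" using incr abcd by auto
  define A where "A = (f d - f b) * (f c - f a)"
  define B where "B = (c - b) * (d - a)"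
  define A' where "A' = (f c - f b) * (f d - f a)"
  define B' where "B' = (d - b) * (c - a)"
  have ppos: "A > 0" "B > 0" "A' > 0" "B' > 0" using f abcd by (auto simp: A_def B_def A'_def B'_def)
  have "ln (A * B) < ln (A' * B')"
    using ln f abcd ppos by (simp add: A_def B_def A'_def B'_def ln_mult)
  then have prod: "A * B < A' * B'" using ppos by simp
  define E where "E = (f b - f a) * (f d - f c)"
  define E' where "E' = (b - a) * (d - c)"
  have E: "E > 0" "E' > 0" using f abcd by (auto simp: E_def E'_def)
  \<comment> \<open>Two instances of (d - b)(c - a) = (c - b)(d - a) + (b - a)(d - c). Substituted
    into \<open>A * B < A' * B'\<close>, the common term \<open>A' * B\<close> cancels and the
    comparison of cross ratios remains.\<close>
  have "A = A' + E" "B' = B + E'" unfolding A_def A'_def B_def B'_def E_def E'_def by algebra+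
  then have "E * B < A' * E'" using prod by (simp add: algebra_simps)
  then have "B / E' < A' / E" using E by (simp add: field_simps)
  then show ?thesis by (simp add: cross_ratio_def B_def E'_def A'_def E_def)
qed

section \<open>Farey arithmetic\<close>

lemma den_pos [simp]: "den x > 0"
  by (simp add: den_def quotient_of_denom_pos')

lemma den_nonzero [simp]: "den x \<noteq> 0"
  using den_pos[of x] by linarith

lemma den_nonneg [simp]: "0 \<le> den x"
  using den_pos[of x] by linarith

lemma coprime_num_den: "coprime (num x) (den x)"
  unfolding num_def den_def by (rule quotient_of_coprime) (simp add: prod_eq_iff)

lemma rat_eq_num_den: "x = Fract (num x) (den x)"
  unfolding num_def den_def
  by (metis Fract_of_int_quotient prod.collapse quotient_of_div)

lemma num_den_Fract:
  assumes "d > 0" "coprime n d"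
  shows "num (Fract n d) = n" "den (Fract n d) = d"
  using assms by (simp_all add: num_def den_def quotient_of_Fract normalize_def Let_def)

lemma rat_eqI: "num x = num y \<Longrightarrow> den x = den y \<Longrightarrow> x = y"
  by (metis rat_eq_num_den)

lemma rat_less_num_den: "x < y \<longleftrightarrow> num x * den y < num y * den x"
proof -
  have "Fract (num x) (den x) < Fract (num y) (den y) \<longleftrightarrow> num x * den y < num y * den x"
    by (subst less_rat) (simp_all add: mult.commute mult.left_commute)
  then show ?thesis by (metis rat_eq_num_den)
qed

lemma num_den_0_1 [simp]: "num 0 = 0" "den 0 = 1" "num 1 = 1" "den 1 = 1"
  by (simp_all add: num_def den_def)

lemma unit_interval_num_den: "x \<in> {0..1} \<longleftrightarrow> 0 \<le> num x \<and> num x \<le> den x"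
proof -
  have "0 \<le> x \<longleftrightarrow> 0 \<le> num x" using rat_less_num_den[of x 0] by (auto simp: not_less[symmetric])
  moreover have "x \<le> 1 \<longleftrightarrow> num x \<le> den x" using rat_less_num_den[of 1 x] by (auto simp: not_less[symmetric])
  ultimately show ?thesis by simp
qed

lemma farey_neighbors_less:
  assumes "farey_neighbors x y" "x < y"
  shows "num y * den x - num x * den y = 1"
  using assms by (auto simp: farey_neighbors_def rat_less_num_den)

lemma farey_neighbors_commute: "farey_neighbors x y \<longleftrightarrow> farey_neighbors y x"
  by (auto simp: farey_neighbors_def)

lemma farey_neighbors_imp_neq: "farey_neighbors x y \<Longrightarrow> x \<noteq> y"
  by (auto simp: farey_neighbors_def)

lemma farey_sum_commute: "farey_sum x y = farey_sum y x"
  by (simp add: farey_sum_def add.commute)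

lemma coprime_of_det:
  fixes a b c d :: int
  assumes "a * d - b * c = 1"
  shows "coprime a b"
proof (rule coprimeI)
  fix e assume "e dvd a" "e dvd b"
  then have "e dvd a * d - b * c" by simp
  then show "is_unit e" using assms by simp
qed

text \<open>The mediant has determinant 1 or -1 with each summand, so the fraction of the sums is
  already reduced.\<close>

lemma num_den_farey_sum:
  assumes "farey_neighbors x y"
  shows "num (farey_sum x y) = num x + num y" "den (farey_sum x y) = den x + den y"
proof -
  have "coprime (num x + num y) (den x + den y)"
  proof (cases "num x * den y - num y * den x = 1")
    case True
    then have "(num x + num y) * den y - (den x + den y) * num y = 1" by algebra
    then show ?thesis by (rule coprime_of_det)
  next
    case False
    then have "num y * den x - num x * den y = 1"
      using assms by (auto simp: farey_neighbors_def)
    then have "(num x + num y) * den x - (den x + den y) * num x = 1" by algebra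
    then show ?thesis by (rule coprime_of_det)
  qed
  from num_den_Fract[OF _ this]
  show "num (farey_sum x y) = num x + num y" "den (farey_sum x y) = den x + den y"
    unfolding farey_sum_def using add_pos_pos[OF den_pos den_pos] by auto
qed

lemma farey_sum_neighbors:
  assumes "farey_neighbors x y"
  shows "farey_neighbors (farey_sum x y) y" "farey_neighbors x (farey_sum x y)"
  using assms by (simp_all add: farey_neighbors_def num_den_farey_sum[OF assms] algebra_simps)

section \<open>Farey parents and first children\<close>

text \<open>Both left parents solve \<open>num x * d - n * den x = 1\<close>. Solutions differ by
  multiples of \<open>(num x, den x)\<close>, and both denominators lie strictly between 0 and
  \<open>den x\<close>, so they coincide.\<close>

lemma farey_parents_unique:
  assumes "farey_parents x l r" "farey_parents x l' r'"
  shows "l = l' \<and> r = r'"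
proof -
  have n: "farey_neighbors l r" "farey_neighbors l' r'" "l < r" "l' < r'"
    "x = farey_sum l r" "x = farey_sum l' r'"
    using assms by (auto simp: farey_parents_def)
  have s: "num x = num l + num r" "den x = den l + den r" "num x = num l' + num r'" "den x = den l' + den r'"
    using num_den_farey_sum[OF n(1)] num_den_farey_sum[OF n(2)] n(5,6) by auto
  have "num x * den l - num l * den x = 1"
    unfolding s(1,2) using farey_neighbors_less[OF n(1,3)] by (simp add: algebra_simps)
  moreover have "num x * den l' - num l' * den x = 1"
    unfolding s(3,4) using farey_neighbors_less[OF n(2,4)] by (simp add: algebra_simps)
  ultimately have d: "num x * den l - num l * den x = 1" "num x * den l' - num l' * den x = 1" .
  have eq: "num x * (den l - den l') = (num l - num l') * den x" using d by algebra
  then have "den x dvd num x * (den l - den l')" by simp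
  then have "den x dvd den l - den l'"
    using coprime_dvd_mult_right_iff[of "den x" "num x"] coprime_num_den[of x] by (metis coprime_commute)
  moreover have "\<bar>den l - den l'\<bar> < den x"
    using s den_pos[of l] den_pos[of r] den_pos[of l'] den_pos[of r'] by linarith
  ultimately have dl: "den l = den l'" using dvd_imp_le_int[of "den l - den l'" "den x"] by fastforce
  then have nl: "num l = num l'" using eq den_pos[of x] by simp
  then show ?thesis using s dl by (auto intro: rat_eqI)
qed

lemma farey_parents_den_ne:
  assumes "farey_parents x l r" "\<not> (l = 0 \<and> r = 1)"
  shows "den l \<noteq> den r"
proof
  assume eq: "den l = den r"
  have det: "num r * den l - num l * den r = 1"
    using assms(1) by (auto simp: farey_parents_def farey_neighbors_less)
  then have "(num r - num l) * den l = 1" using eq by (simp add: algebra_simps)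
  then have "den l = 1" using den_pos[of l] by (simp add: pos_zmult_eq_1_iff_lemma zmult_eq_1_iff)
  moreover have "num r = num l + 1" using det eq calculation by simp
  moreover have "0 \<le> num l" "num r \<le> den r"
    using assms(1) unit_interval_num_den by (auto simp: farey_parents_def)
  ultimately have "l = 0" "r = 1" using eq by (auto intro!: rat_eqI)
  then show False using assms(2) by simp
qed

text \<open>The tree edge to \<open>y\<close> starts from the Farey parent of \<open>y\<close> with the larger denominator; the only
  tie is at \<open>1/2\<close>, a child of both ends of the unit interval.\<close>

lemma first_child_cases:
  assumes "first_child x y"
  obtains s where "x \<in> {0..1}" "s \<in> {0..1}" "farey_neighbors x s" "y = farey_sum x s"
    "den s < den x \<or> (x = 0 \<and> s = 1) \<or> (x = 1 \<and> s = 0)"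
  using assms
proof cases
  case zero
  then show ?thesis using that[of 1] by (simp add: farey_neighbors_def)
next
  case one
  then show ?thesis using that[of 0] by (simp add: farey_neighbors_def)
next
  case (left l r)
  then have p: "farey_neighbors l r" "x = farey_sum l r" "l \<in> {0..1}" "r \<in> {0..1}"
    by (auto simp: farey_parents_def)
  show ?thesis
  proof (rule that[of l])
    show "farey_neighbors x l" using farey_sum_neighbors(2)[OF p(1)] p(2) farey_neighbors_commute by simp
    show "x \<in> {0..1}" using p num_den_farey_sum[OF p(1)] unfolding unit_interval_num_den by auto
    show "den l < den x \<or> (x = 0 \<and> l = 1) \<or> (x = 1 \<and> l = 0)"
      using p num_den_farey_sum[OF p(1)] by simp
  qed (use left p in auto)
next
  case (right l r)
  then have p: "farey_neighbors l r" "x = farey_sum l r" "l \<in> {0..1}" "r \<in> {0..1}"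
    by (auto simp: farey_parents_def)
  show ?thesis
  proof (rule that[of r])
    show "farey_neighbors x r" using farey_sum_neighbors(1)[OF p(1)] p(2) by simp
    show "x \<in> {0..1}" using p num_den_farey_sum[OF p(1)] unfolding unit_interval_num_den by auto
    show "den r < den x \<or> (x = 0 \<and> r = 1) \<or> (x = 1 \<and> r = 0)"
      using p num_den_farey_sum[OF p(1)] by simp
  qed (use right p in auto)
qed

lemma farey_parents_of_sum:
  assumes "farey_neighbors x s" "x \<in> {0..1}" "s \<in> {0..1}"
  shows "farey_parents (farey_sum x s) (min x s) (max x s)"
proof (cases "x < s")
  case True
  then show ?thesis using assms by (simp add: farey_parents_def)
next
  case False
  then have "s < x" using farey_neighbors_imp_neq[OF assms(1)] by simp
  then show ?thesis using assms farey_neighbors_commute farey_sum_commute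
    by (auto simp: farey_parents_def min_def max_def)
qed

text \<open>The sum determines the unordered pair of Farey parents, and the tree parent is the one
  with the larger denominator; only the pair 0, 1 leaves a choice.\<close>

lemma first_child_unique:
  assumes "first_child x y" "first_child x' y"
  shows "x = x' \<or> {x, x'} = {0, 1}"
proof -
  obtain s where s: "x \<in> {0..1}" "s \<in> {0..1}" "farey_neighbors x s" "y = farey_sum x s"
    "den s < den x \<or> (x = 0 \<and> s = 1) \<or> (x = 1 \<and> s = 0)" using first_child_cases[OF assms(1)] by blast
  obtain s' where s': "x' \<in> {0..1}" "s' \<in> {0..1}" "farey_neighbors x' s'" "y = farey_sum x' s'"
    "den s' < den x' \<or> (x' = 0 \<and> s' = 1) \<or> (x' = 1 \<and> s' = 0)" using first_child_cases[OF assms(2)] by blast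
  have "min x s = min x' s'" "max x s = max x' s'"
    using farey_parents_unique farey_parents_of_sum[OF s(3,1,2)] farey_parents_of_sum[OF s'(3,1,2)] s(4) s'(4)
    by metis+
  then have "(x = x' \<and> s = s') \<or> (x = s' \<and> s = x')" by (auto simp: min_def max_def split: if_splits)
  then show ?thesis using s(5) s'(5) by auto
qed

lemma first_child_interior:
  assumes "first_child x y"
  shows "y \<noteq> 0" "y \<noteq> 1"
proof -
  obtain s where s: "x \<in> {0..1}" "s \<in> {0..1}" "farey_neighbors x s" "y = farey_sum x s"
    using first_child_cases[OF assms] by blast
  have "den y = den x + den s" using num_den_farey_sum[OF s(3)] s(4) by simp
  then have "den y > 1" using den_pos[of x] den_pos[of s] by linarith
  then show "y \<noteq> 0" "y \<noteq> 1" by auto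
qed

text \<open>The left parent \<open>p / q\<close> comes from the inverse \<open>q\<close> of
  \<open>n\<close> modulo \<open>d\<close>, for which \<open>n * q - p * d = 1\<close>; the right
  parent is the difference \<open>(n - p) / (d - q)\<close>. The remaining estimates place both in
  the unit interval.\<close>

lemma farey_parents_exist:
  assumes "x \<in> {0..1}" "x \<noteq> 0" "x \<noteq> 1"
  obtains l r where "farey_parents x l r"
proof -
  define n d where "n = num x" and "d = den x"
  have nd: "coprime n d" "0 \<le> n" "n \<le> d" "d > 0"
    using coprime_num_den assms(1) unit_interval_num_den by (auto simp: n_def d_def)
  have "d \<noteq> 1"
  proof
    assume "d = 1"
    then have "n = 0 \<or> n = 1" using nd by auto
    then show False using \<open>d = 1\<close> assms(2,3) rat_eqI[of x 0] rat_eqI[of x 1] by (auto simp: n_def d_def)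
  qed
  then have d1: "d > 1" using nd by simp
  have n0: "n > 0" using nd d1 by (cases "n = 0") auto
  have nlt: "n < d" using nd d1 by (cases "n = d") auto
  obtain u v where uv: "u * n + v * d = 1" using bezout_int[of n d] nd(1) by auto
  define q where "q = u mod d"
  \<comment> \<open>With this choice, reducing \<open>u\<close> modulo \<open>d\<close> turns
    \<open>u * n + v * d = 1\<close> into \<open>n * q - p * d = 1\<close>.\<close>
  define p where "p = - v - (u div d) * n"
  have "u = u div d * d + q" by (simp add: q_def)
  have "q = u - u div d * d" using \<open>u = u div d * d + q\<close> by linarith
  then have det: "n * q - p * d = 1" unfolding p_def using uv by algebra
  have q: "0 \<le> q" "q < d" using nd by (auto simp: q_def)
  have "q \<noteq> 0"
  proof
    assume "q = 0"
    then have "- p * d = 1" using det by simp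
    then show False using d1 by (metis mult.commute zmult_eq_1_iff nlt n0 less_irrefl neg_equal_iff_equal
        pos_zmult_eq_1_iff nd(4))
  qed
  then have qp: "q > 0" using q by simp
  have p0: "p \<ge> 0"
  proof (rule ccontr)
    assume "\<not> p \<ge> 0"
    then have "- p * d \<ge> 1 * d" using nd by (intro mult_right_mono) auto
    moreover have "n * q > 0" using n0 qp by simp
    ultimately show False using det d1 by linarith
  qed
  have plt: "p < q"
  proof (rule ccontr)
    assume "\<not> p < q"
    then have "p * d \<ge> q * d" using nd by (intro mult_right_mono) auto
    moreover have "n * q \<le> d * q" using nlt q by (intro mult_right_mono) auto
    ultimately show False using det by (simp add: mult.commute)
  qed
  have pn: "p < n"
  proof (rule ccontr)
    assume "\<not> p < n"
    then have "p * d \<ge> n * d" using nd by (intro mult_right_mono) auto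
    moreover have "n * q \<le> n * d" using q n0 by (intro mult_left_mono) auto
    ultimately show False using det by linarith
  qed
  have np: "n - p \<le> d - q"
  proof (rule ccontr)
    assume "\<not> n - p \<le> d - q"
    then have "(n - p) * d \<ge> (d - q + 1) * d" using nd by (intro mult_right_mono) auto
    moreover have "(n - p) * d = n * (d - q) + 1" using det by (simp add: algebra_simps)
    moreover have "n * (d - q) \<le> d * (d - q)" using nlt q by (intro mult_right_mono) auto
    ultimately show False using d1 by (simp add: algebra_simps)
  qed
  define l r where "l = Fract p q" and "r = Fract (n - p) (d - q)"
  have "(- d) * p - (- n) * q = 1" using det by (simp add: algebra_simps)
  have cpq: "coprime p q"
  proof -
    have "q * n - p * d = 1" using det by (simp add: mult.commute)
    then have "coprime q p" by (rule coprime_of_det)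
    then show ?thesis by (simp add: coprime_commute)
  qed
  have crs: "coprime (n - p) (d - q)"
  proof -
    have "(n - p) * d - (d - q) * n = 1" using det by (simp add: algebra_simps)
    then show ?thesis by (rule coprime_of_det)
  qed
  have l: "num l = p" "den l = q" using num_den_Fract[OF qp cpq] by (simp_all add: l_def)
  have r: "num r = n - p" "den r = d - q" using num_den_Fract[OF _ crs] q by (simp_all add: r_def)
  have lr: "num r * den l - num l * den r = 1" using det by (simp add: l r algebra_simps)
  have nb: "farey_neighbors l r" using lr by (simp add: farey_neighbors_def)
  have "x = farey_sum l r"
    by (rule rat_eqI) (simp_all add: num_den_farey_sum[OF nb] l r n_def d_def)
  moreover have "l < r" using lr by (simp add: rat_less_num_den)
  moreover have "l \<in> {0..1}" "r \<in> {0..1}"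
    unfolding unit_interval_num_den l r using p0 plt pn np by auto
  ultimately have "farey_parents x l r" using nb by (simp add: farey_parents_def)
  then show ?thesis by (rule that)
qed

section \<open>Levels and descent along the tree\<close>

text \<open>Induction on the denominator. The parent with the larger denominator is itself the sum
  of the smaller one and a fraction \<open>s\<close> obtained by subtraction, so \<open>x\<close> is
  its first child.\<close>

lemma farey_row_exists: "x \<in> {0..1} \<Longrightarrow> \<exists>n. x \<in> farey_row n"
proof (induction "nat (den x)" arbitrary: x rule: less_induct)
  case less
  show ?case
  proof (cases "x = 0 \<or> x = 1")
    case True
    then show ?thesis by (intro exI[of _ 0]) auto
  next
    case False
    then obtain l r where lr: "farey_parents x l r" using farey_parents_exist less.prems by blast
    then have p: "farey_neighbors l r" "x = farey_sum l r" "l < r" "l \<in> {0..1}" "r \<in> {0..1}"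
      by (auto simp: farey_parents_def)
    have det: "num r * den l - num l * den r = 1" by (rule farey_neighbors_less[OF p(1,3)])
    have nonneg: "0 \<le> num l" "num l \<le> den l" "0 \<le> num r" "num r \<le> den r"
      using p(4,5) unit_interval_num_den by auto
    have step: ?thesis if y: "y \<in> {0..1}" "den y < den x" "first_child y x" for y
    proof -
      obtain n where "y \<in> farey_row n" using less.hyps[of y] y den_pos[of y] by auto
      then have "x \<in> farey_row (Suc n)" using y(3) by auto
      then show ?thesis by blast
    qed
    have dx: "den l < den x" "den r < den x" using num_den_farey_sum[OF p(1)] p(2) by simp_all
    consider "l = 0 \<and> r = 1" | "den l > den r" | "den r > den l"
      using farey_parents_den_ne[OF lr] by fastforce
    then show ?thesis
    proof cases
      case 1
      then have "first_child 0 x" using p(2) first_child.zero by simp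
      then show ?thesis using step[of 0] p(4) 1 dx by simp
    next
      case 2
      define s where "s = Fract (num l - num r) (den l - den r)"
      have "(num l - num r) * (- den r) - (den l - den r) * (- num r) = 1"
        using det by (simp add: algebra_simps)
      then have cop: "coprime (num l - num r) (den l - den r)" by (rule coprime_of_det)
      have s: "num s = num l - num r" "den s = den l - den r"
        using num_den_Fract[OF _ cop] 2 by (simp_all add: s_def)
      have nb: "num r * den s - num s * den r = 1" using det by (simp add: s algebra_simps)
      have nb': "farey_neighbors s r" using nb by (simp add: farey_neighbors_def)
      have "num s \<ge> 0"
      proof (rule ccontr)
        assume "\<not> num s \<ge> 0"
        then have "num s \<le> - 1" by simp
        then have "num s * den r \<le> - 1 * den r" by (intro mult_right_mono) (auto simp: less_imp_le)
        moreover have "num r * den s \<ge> 0" using nonneg by (auto simp: less_imp_le)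
        ultimately have "den r \<le> 1" "num r * den s = 0" using nb den_pos[of r] by linarith+
        then have "num r = 0" using den_pos[of s] by simp
        then show False using det nonneg mult_nonneg_nonneg[of "num l" "den r"] den_pos[of r] by simp
      qed
      moreover have "num s \<le> den s"
      proof (rule ccontr)
        assume "\<not> num s \<le> den s"
        then have "num s * den r \<ge> (den s + 1) * den r" by (intro mult_right_mono) (auto simp: less_imp_le)
        moreover have "num r * den s \<le> den r * den s" using nonneg by (intro mult_right_mono) (auto simp: less_imp_le)
        moreover have "(den s + 1) * den r = den r * den s + den r" by (simp add: algebra_simps)
        ultimately show False using nb den_pos[of r] by linarith
      qed
      ultimately have s01: "s \<in> {0..1}" unfolding unit_interval_num_den by simp
      have "l = farey_sum s r" by (rule rat_eqI) (simp_all add: num_den_farey_sum[OF nb'] s)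
      moreover have "s < r" using nb by (simp add: rat_less_num_den)
      ultimately have "farey_parents l s r" using nb' s01 p(5) by (simp add: farey_parents_def)
      then have "first_child l x" using first_child.right p(2) by simp
      then show ?thesis using step[of l] p(4) dx by simp
    next
      case 3
      define s where "s = Fract (num r - num l) (den r - den l)"
      have "(num r - num l) * den l - (den r - den l) * num l = 1"
        using det by (simp add: algebra_simps)
      then have cop: "coprime (num r - num l) (den r - den l)" by (rule coprime_of_det)
      have s: "num s = num r - num l" "den s = den r - den l"
        using num_den_Fract[OF _ cop] 3 by (simp_all add: s_def)
      have nb: "num s * den l - num l * den s = 1" using det by (simp add: s algebra_simps)
      have nb': "farey_neighbors l s" using nb by (simp add: farey_neighbors_def)
      have "num s > 0"
      proof (rule ccontr)
        assume "\<not> num s > 0"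
        then have "num s * den l \<le> 0" by (auto simp: mult_le_0_iff less_imp_le)
        moreover have "num l * den s \<ge> 0" using nonneg by (auto simp: less_imp_le)
        ultimately show False using nb by linarith
      qed
      moreover have "num s \<le> den s"
      proof (rule ccontr)
        assume "\<not> num s \<le> den s"
        then have "num s * den l \<ge> (den s + 1) * den l" by (intro mult_right_mono) (auto simp: less_imp_le)
        moreover have "num l * den s \<le> den l * den s" using nonneg by (intro mult_right_mono) (auto simp: less_imp_le)
        moreover have "(den s + 1) * den l = den l * den s + den l" by (simp add: algebra_simps)
        ultimately have "den l \<le> 1" "num l * den s = den l * den s" using nb den_pos[of l] by linarith+
        moreover have "den l = 1" using \<open>den l \<le> 1\<close> den_pos[of l] by linarith
        ultimately show False using det nonneg by simp
      qed
      ultimately have s01: "s \<in> {0..1}" unfolding unit_interval_num_den by simp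
      have "r = farey_sum l s" by (rule rat_eqI) (simp_all add: num_den_farey_sum[OF nb'] s)
      moreover have "l < s" using nb by (simp add: rat_less_num_den)
      ultimately have "farey_parents r l s" using nb' s01 p(4) by (simp add: farey_parents_def)
      then have "first_child r x" using first_child.left p(2) farey_sum_commute by metis
      then show ?thesis using step[of r] p(5) dx by simp
    qed
  qed
qed

text \<open>The least row containing \<open>y\<close> is reached from some parent one row higher.
  That parent is \<open>x\<close>, or else \<open>y\<close> is 1/2 and \<open>x\<close> lies in row
  0.\<close>

lemma first_child_level:
  assumes "first_child x y" "y \<in> {0..1}"
  shows "farey_level x < farey_level y"
proof -
  have yr: "y \<in> farey_row (farey_level y)"
    unfolding farey_level_def by (rule LeastI_ex) (rule farey_row_exists[OF assms(2)])
  have "farey_level y \<noteq> 0"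
  proof
    assume "farey_level y = 0"
    then have "y \<in> farey_row 0" using yr by metis
    then show False using first_child_interior[OF assms(1)] by simp
  qed
  then obtain n where n: "farey_level y = Suc n" using not0_implies_Suc by blast
  then have "y \<in> farey_row (Suc n)" using yr by metis
  then obtain x' where x': "x' \<in> farey_row n" "first_child x' y" by auto
  have "farey_level x \<le> n"
  proof (cases "x = x'")
    case True
    then show ?thesis using x'(1) unfolding farey_level_def by (auto intro: Least_le)
  next
    case False
    then have "x \<in> farey_row 0" using first_child_unique[OF assms(1) x'(2)] by auto
    then have "farey_level x \<le> 0" unfolding farey_level_def by (rule Least_le)
    then show ?thesis by simp
  qed
  then show ?thesis using n by simp
qed

text \<open>Sorted levels force each edge of the path to run from parent to child, so a property
  passed from child to parent climbs the whole path. The conclusion stops at a child of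
  \<open>x\<close>, because the last step will have to yield more than \<open>P x\<close>.\<close>

lemma farey_higher_descend:
  assumes "farey_higher x y" "P y" and step: "\<And>x y. first_child x y \<Longrightarrow> P y \<Longrightarrow> P x"
  obtains z where "first_child x z" "P z"
proof -
  obtain xs where xs: "farey_path xs" "hd xs = x" "last xs = y" "sorted (map farey_level xs)"
    and lvl: "farey_level x < farey_level y"
    using assms(1) by (auto simp: farey_higher_def)
  have main: "P (hd xs) \<and> (tl xs \<noteq> [] \<longrightarrow> (\<exists>z. first_child (hd xs) z \<and> P z))"
    using xs(1,4) \<open>P y\<close>[folded xs(3)]
  proof (induction xs)
    case (Cons a ys)
    show ?case
    proof (cases ys)
      case Nil
      then show ?thesis using Cons.prems by simp
    next
      case (Cons b zs)
      have path: "farey_path ys" "farey_edge a b" "a \<in> {0..1}"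
        using Cons.prems(1) Cons by (auto simp: farey_path_def)
      have "P b" using Cons.IH path(1) Cons.prems(2,3) Cons by simp
      moreover have "first_child a b"
      proof (rule ccontr)
        assume "\<not> first_child a b"
        then have "first_child b a" using path(2) by (simp add: farey_edge_def)
        then have "farey_level b < farey_level a" using first_child_level path(3) by blast
        then show False using Cons.prems(2) Cons by simp
      qed
      ultimately show ?thesis using step by auto
    qed
  qed (simp add: farey_path_def)
  have "tl xs \<noteq> []"
  proof
    assume "tl xs = []"
    then have "xs = [x]" using xs by (cases xs) (auto simp: farey_path_def)
    then show False using xs lvl by simp
  qed
  then show ?thesis using main xs(2) that by auto
qed

section \<open>Bimodal lifts\<close>

text \<open>What the dynamics uses of Class B: one decreasing and one increasing branch per period,
  and strict growth of cross ratios inside the increasing branch. All of it survives adding a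
  constant, so the locale can be entered at every parameter.\<close>

locale bimodal_lift =
  fixes f :: "real \<Rightarrow> real" and C K :: real
  assumes lift: "degree_one_lift f"
    and C_less_K: "C < K" and K_less_C1: "K < C + 1"
    and decr: "\<And>x y. C \<le> x \<Longrightarrow> x < y \<Longrightarrow> y \<le> K \<Longrightarrow> f y < f x"
    and incr: "\<And>x y. K \<le> x \<Longrightarrow> x < y \<Longrightarrow> y \<le> C + 1 \<Longrightarrow> f x < f y"
    and expand: "\<And>a b c d. K < a \<Longrightarrow> a < b \<Longrightarrow> b < c \<Longrightarrow> c < d \<Longrightarrow> d < C + 1 \<Longrightarrow>
      cross_ratio a b c d < cross_ratio (f a) (f b) (f c) (f d)"
begin

abbreviation "L \<equiv> lower_bound f"
abbreviation "U \<equiv> upper_bound f"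

lemma eqv [simp]: "equivariant f" "equivariant L" "equivariant U"
  using lift by (auto intro: lift_equivariant equivariant_lower_bound equivariant_upper_bound)

lemma cont: "continuous_on S f" "continuous_on S L" "continuous_on S U"
  using lift_continuous[OF lift] continuous_lower_bound[OF lift] continuous_upper_bound[OF lift]
  by (auto elim: continuous_on_subset)

lemma mono_LU [simp]: "mono L" "mono U"
  using lift by (auto intro: mono_lower_bound mono_upper_bound)

lemma shift: "f (x + of_int m) = f x + of_int m" "L (x + of_int m) = L x + of_int m"
    "U (x + of_int m) = U x + of_int m"
  by (simp_all add: equivariant_add_int)

lemma incr_left: "K - 1 \<le> x \<Longrightarrow> x < y \<Longrightarrow> y \<le> C \<Longrightarrow> f x < f y"
  using incr[of "x + 1" "y + 1"] shift(1)[of x 1] shift(1)[of y 1] by simp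

lemma ex_preimages:
  "\<exists>x. K - 1 < x \<and> x < C \<and> f x = f K" "\<exists>x. K < x \<and> x < C + 1 \<and> f x = f C"
proof -
  have KC: "f K < f C" by (rule decr) (use C_less_K in auto)
  have sh: "f (K - 1) = f K - 1" "f (C + 1) = f C + 1"
    using shift(1)[of "K - 1" 1] shift(1)[of C 1] by simp_all
  obtain x where x: "K - 1 \<le> x" "x \<le> C" "f x = f K"
    using IVT'[of f "K - 1" "f K" C] sh KC K_less_C1 cont by force
  then have "x \<noteq> K - 1" "x \<noteq> C" using sh KC by auto
  then show "\<exists>x. K - 1 < x \<and> x < C \<and> f x = f K" using x by (intro exI[of _ x]) auto
  obtain y where y: "K \<le> y" "y \<le> C + 1" "f y = f C"
    using IVT'[of f K "f C" "C + 1"] sh KC K_less_C1 cont by force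
  then have "y \<noteq> K" "y \<noteq> C + 1" using sh KC by auto
  then show "\<exists>x. K < x \<and> x < C + 1 \<and> f x = f C" using y by (intro exI[of _ y]) auto
qed

text \<open>The choice is unique, since \<open>f\<close> is strictly increasing on
  \<open>[K - 1, C]\<close>. \<open>Km\<close> is the left end of the flat piece of
  \<open>L\<close>, and \<open>Cp\<close> the right end of that of \<open>U\<close>.\<close>

definition "Km = (SOME x. K - 1 < x \<and> x < C \<and> f x = f K)"
definition "Cp = (SOME x. K < x \<and> x < C + 1 \<and> f x = f C)"

lemma Km: "K - 1 < Km" "Km < C" "f Km = f K"
  using someI_ex[OF ex_preimages(1)] by (simp_all add: Km_def)

lemma Cp: "K < Cp" "Cp < C + 1" "f Cp = f C"
  using someI_ex[OF ex_preimages(2)] by (simp_all add: Cp_def)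

section \<open>The bounds on their flat and increasing pieces\<close>

lemma min_right: "K \<le> z \<Longrightarrow> f K \<le> f z"
proof -
  assume z: "K \<le> z"
  define n where "n = \<lfloor>z - K\<rfloor>"
  have n: "n \<ge> 0" using z by (simp add: n_def)
  have w: "K \<le> z - of_int n" "z - of_int n < K + 1" unfolding n_def by linarith+
  have "f K \<le> f (z - of_int n)"
  proof (cases "z - of_int n \<le> C + 1")
    case True
    then show ?thesis using incr[of K "z - of_int n"] w by (cases "z - of_int n = K") auto
  next
    case False
    then have "f (K + 1) \<le> f (z - of_int n)"
      using decr[of "z - of_int n - 1" K] w shift(1)[of "z - of_int n - 1" 1] shift(1)[of K 1] by auto
    then show ?thesis using shift(1)[of K 1] by simp
  qed
  moreover have "f z = f (z - of_int n) + of_int n" using shift(1)[of "z - of_int n" n] by simp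
  ultimately show ?thesis using n by simp
qed

lemma max_left: "z \<le> C \<Longrightarrow> f z \<le> f C"
proof -
  assume z: "z \<le> C"
  define n where "n = \<lfloor>C - z\<rfloor>"
  have n: "n \<ge> 0" using z by (simp add: n_def)
  have w: "z + of_int n \<le> C" "C - 1 < z + of_int n" unfolding n_def by linarith+
  have "f (z + of_int n) \<le> f C"
  proof (cases "K - 1 \<le> z + of_int n")
    case True
    then show ?thesis using incr_left[of "z + of_int n" C] w by (cases "z + of_int n = C") auto
  next
    case False
    then have "f (z + of_int n) \<le> f (C - 1)"
      using decr[of C "z + of_int n + 1"] w shift(1)[of "z + of_int n" 1] shift(1)[of "C - 1" 1] by auto
    then show ?thesis using shift(1)[of "C - 1" 1] by simp
  qed
  then show ?thesis using n shift(1)[of z n] by simp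
qed

text \<open>Here \<open>f\<close> is increasing and at most \<open>f (Km + 1) = f K + 1\<close>, a
  value that \<open>f\<close> never undercuts to the right of \<open>C + 1\<close>.\<close>

lemma L_eq_f: "K \<le> x \<Longrightarrow> x \<le> Km + 1 \<Longrightarrow> L x = f x"
proof (rule lower_bound_eqI[OF lift order_refl])
  fix z assume x: "K \<le> x" "x \<le> Km + 1" "x \<le> z"
  have top: "f (Km + 1) = f K + 1" using shift(1)[of Km 1] Km by simp
  show "f x \<le> f z"
  proof (cases "z \<le> C + 1")
    case True
    then show ?thesis using incr[of x z] x by (cases "x = z") auto
  next
    case False
    have "f x \<le> f K + 1" using incr[of x "Km + 1"] x Km top by (cases "x = Km + 1") auto
    also have "\<dots> \<le> f z"
    proof (cases "z \<le> K + 1")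
      case True
      then show ?thesis using decr[of "z - 1" K] False shift(1)[of "z - 1" 1] by (cases "z = K + 1") auto
    next
      case False
      then show ?thesis using min_right[of "z - 1"] shift(1)[of "z - 1" 1] by simp
    qed
    finally show ?thesis .
  qed
qed

lemma L_flat: "Km \<le> x \<Longrightarrow> x \<le> K \<Longrightarrow> L x = f K"
proof (rule lower_bound_eqI[OF lift])
  fix z assume x: "Km \<le> x" "x \<le> K" "x \<le> z"
  consider "z \<le> C" | "C < z" "z \<le> K" | "K \<le> z" by linarith
  then show "f K \<le> f z"
  proof cases
    case 1
    then show ?thesis using incr_left[of Km z] x Km by (cases "Km = z") auto
  next
    case 2
    then show ?thesis using decr[of z K] by (cases "z = K") auto
  qed (rule min_right)
qed

lemma U_eq_f: "Cp \<le> x \<Longrightarrow> x \<le> C + 1 \<Longrightarrow> U x = f x"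
proof (rule upper_bound_eqI[OF lift order_refl])
  fix z assume x: "Cp \<le> x" "x \<le> C + 1" "z \<le> x"
  have fx: "f C \<le> f x" using incr[of Cp x] x Cp by (cases "Cp = x") auto
  consider "z \<le> C" | "C < z" "z \<le> K" | "K < z" by linarith
  then show "f z \<le> f x"
  proof cases
    case 1
    then show ?thesis using max_left fx by force
  next
    case 2
    then show ?thesis using decr[of C z] fx by auto
  next
    case 3
    then show ?thesis using incr[of z x] x by (cases "z = x") auto
  qed
qed

lemma U_flat: "C \<le> x \<Longrightarrow> x \<le> Cp \<Longrightarrow> U x = f C"
proof (rule upper_bound_eqI[OF lift])
  fix z assume x: "C \<le> x" "x \<le> Cp" "z \<le> x"
  consider "z \<le> C" | "C < z" "z \<le> K" | "K < z" by linarith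
  then show "f z \<le> f C"
  proof cases
    case 2
    then show ?thesis using decr[of C z] by auto
  next
    case 3
    then show ?thesis using incr[of z Cp] x Cp by (cases "z = Cp") auto
  qed (rule max_left)
qed

lemma L_eq_f_shift: "K + of_int m \<le> x \<Longrightarrow> x \<le> Km + 1 + of_int m \<Longrightarrow> L x = f x"
  using L_eq_f[of "x - of_int m"] shift[of "x - of_int m" m] by simp

lemma U_eq_f_shift: "Cp + of_int m \<le> x \<Longrightarrow> x \<le> C + 1 + of_int m \<Longrightarrow> U x = f x"
  using U_eq_f[of "x - of_int m"] shift[of "x - of_int m" m] by simp

lemma incr_shift: "K + of_int m \<le> x \<Longrightarrow> x < y \<Longrightarrow> y \<le> C + 1 + of_int m \<Longrightarrow> f x < f y"
  using incr[of "x - of_int m" "y - of_int m"] shift(1)[of "x - of_int m" m] shift(1)[of "y - of_int m" m]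
  by simp

lemma expand_shift:
  assumes "K + of_int m < a" "a < b" "b < c" "c < d" "d < C + 1 + of_int m"
  shows "cross_ratio a b c d < cross_ratio (f a) (f b) (f c) (f d)"
proof -
  have e: "f z = f (z - of_int m) + of_int m" for z using shift(1)[of "z - of_int m" m] by simp
  have "cross_ratio (a - of_int m) (b - of_int m) (c - of_int m) (d - of_int m) <
      cross_ratio (f (a - of_int m)) (f (b - of_int m)) (f (c - of_int m)) (f (d - of_int m))"
    by (rule expand) (use assms in auto)
  then show ?thesis
    unfolding e[of a] e[of b] e[of c] e[of d] cross_ratio_add
    using cross_ratio_add[of a "- of_int m" b c d] by simp
qed

text \<open>Only the outer points have to stay in the branch, since order preservation keeps
  \<open>b\<close> and \<open>c\<close> between them. The integer \<open>m\<close> may change from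
  one time to the next.\<close>

lemma expand_iterate:
  assumes abcd: "a < b" "b < c" "c < d"
    and branch: "\<And>n. n < N \<Longrightarrow> \<exists>m::int. K + of_int m < (f ^^ n) a \<and> (f ^^ n) d < C + 1 + of_int m"
    and "N > 0"
  shows "(f ^^ N) a < (f ^^ N) b \<and> (f ^^ N) b < (f ^^ N) c \<and> (f ^^ N) c < (f ^^ N) d \<and>
    cross_ratio a b c d < cross_ratio ((f ^^ N) a) ((f ^^ N) b) ((f ^^ N) c) ((f ^^ N) d)"
  using \<open>N > 0\<close> branch
proof (induction N)
  case (Suc N)
  obtain m :: int where m: "K + of_int m < (f ^^ N) a" "(f ^^ N) d < C + 1 + of_int m"
    using Suc.prems(2)[of N] by blast
  have prev: "(f ^^ N) a < (f ^^ N) b \<and> (f ^^ N) b < (f ^^ N) c \<and> (f ^^ N) c < (f ^^ N) d \<and>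
    cross_ratio a b c d \<le> cross_ratio ((f ^^ N) a) ((f ^^ N) b) ((f ^^ N) c) ((f ^^ N) d)"
  proof (cases "N = 0")
    case True
    then show ?thesis using abcd by simp
  next
    case False
    then show ?thesis using Suc.IH Suc.prems(2) by fastforce
  qed
  have "cross_ratio ((f ^^ N) a) ((f ^^ N) b) ((f ^^ N) c) ((f ^^ N) d) <
      cross_ratio (f ((f ^^ N) a)) (f ((f ^^ N) b)) (f ((f ^^ N) c)) (f ((f ^^ N) d))"
    by (rule expand_shift[where m = m]) (use m prev in auto)
  moreover have "f ((f ^^ N) a) < f ((f ^^ N) b)" "f ((f ^^ N) b) < f ((f ^^ N) c)" "f ((f ^^ N) c) < f ((f ^^ N) d)"
    by (rule incr_shift[where m = m]; use m prev in simp)+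
  ultimately show ?case using prev by simp
qed simp

lemma L_le_U_funpow: "(L ^^ n) x \<le> (U ^^ n) x"
proof (induction n)
  case (Suc n)
  have "L z \<le> U z" for z
    using lower_bound_le[OF lift, of z z] upper_bound_ge[OF lift, of z z] by simp
  then have "L ((L ^^ n) x) \<le> U ((L ^^ n) x)" .
  also have "\<dots> \<le> U ((U ^^ n) x)" by (rule monoD[OF mono_LU(2) Suc])
  finally show ?case by simp
qed simp

lemma L_flat_funpow:
  assumes "Km \<le> x" "x \<le> K" "n > 0"
  shows "(L ^^ n) x = (L ^^ n) K"
proof -
  obtain k where k: "n = Suc k" using assms(3) gr0_conv_Suc by blast
  have "L x = L K" using L_flat[of x] L_flat[of K] assms Km C_less_K by simp
  then show ?thesis unfolding k funpow_Suc_right by simp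
qed

lemma U_flat_funpow:
  assumes "C \<le> x" "x \<le> Cp" "n > 0"
  shows "(U ^^ n) x = (U ^^ n) Cp"
proof -
  obtain k where k: "n = Suc k" using assms(3) gr0_conv_Suc by blast
  have "U x = U Cp" using U_flat[of x] U_flat[of Cp] assms Cp C_less_K by simp
  then show ?thesis unfolding k funpow_Suc_right by simp
qed

lemmas mono_L_funpow = monoD[OF mono_pow[OF mono_LU(1)]]
lemmas mono_U_funpow = monoD[OF mono_pow[OF mono_LU(2)]]

lemma bimodal_translate: "bimodal_lift (translate f a) C K"
proof
  show "degree_one_lift (translate f a)" by (rule degree_one_lift_add[OF lift])
  fix p q r s assume "K < p" "p < q" "q < r" "r < s" "s < C + 1"
  then show "cross_ratio p q r s < cross_ratio (f p + a) (f q + a) (f r + a) (f s + a)"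
    using expand cross_ratio_add by simp
qed (use C_less_K K_less_C1 decr incr in auto)

lemma translate_points: "bimodal_lift.Km (translate f a) C K = Km" "bimodal_lift.Cp (translate f a) C K = Cp"
  unfolding bimodal_lift.Km_def[OF bimodal_translate] bimodal_lift.Cp_def[OF bimodal_translate] Km_def Cp_def
  by simp_all

end

text \<open>Residues are normalized to 1, ..., q instead of 0, ..., q - 1: the points
  \<open>x 1\<close>, ..., \<open>x q = x 0 + 1\<close> lie in one block to the right of the gap
  between \<open>x 0\<close> and \<open>x 1\<close>.\<close>

lemma cyclic_orbit_interval:
  assumes "cyclic_orbit G p q x" "q > 0"
  shows "x (1 + k) = x (1 + k mod int q) + of_int (k div int q)"
  using cyclic_orbit_shift[OF assms(1), of "1 + k mod int q" "k div int q"]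
  by (simp add: add.assoc)

lemma cyclic_orbit_step:
  assumes "cyclic_orbit G p q x" "int n * p = k + m * int q"
  shows "(G ^^ n) (x i) = x (i + k) + of_int m"
  using cyclic_orbit_funpow[OF assms(1), of n i] cyclic_orbit_shift[OF assms(1), of "i + k" m] assms(2)
  by (simp add: add.assoc)

lemma eventually_at_left_funpow_greater:
  fixes G :: "real \<Rightarrow> real"
  assumes "continuous_on UNIV G" "c < (G ^^ n) z"
  shows "\<forall>\<^sub>F u in at_left z. c < (G ^^ n) u"
proof -
  have "isCont (G ^^ n) z"
    using continuous_on_funpow[OF assms(1), of n] by (simp add: continuous_on_eq_continuous_at)
  then have "\<forall>\<^sub>F u in at z. c < (G ^^ n) u"
    using assms(2) unfolding isCont_def by (rule order_tendstoD(1))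
  then show ?thesis by (simp add: eventually_at_split)
qed

section \<open>The orbit of the locked child spans both flat pieces\<close>

context bimodal_lift
begin

text \<open>At the left end of a locking interval of the lower bound, with \<open>x 0\<close> and \<open>x 1\<close> the two points
  of a periodic orbit around the flat piece: if \<open>x 1\<close> were left of \<open>Cp\<close>, then the return map
  \<open>f\<^sup>q - p\<close> would be an increasing branch near \<open>x 1\<close> whose graph lies below the diagonal just left
  of \<open>x 1\<close>, meets it at \<open>x 1\<close>, lies weakly below it at a later point \<open>y\<close> and above it further right.
  This contradicts the expansion of cross ratios.\<close>

lemma locked_orbit_avoids_flat_top:
  fixes p1 p2 :: int and q1 q2 :: nat and x :: "int \<Rightarrow> real"
  assumes q1: "q1 > 0" and q2: "q2 > 0" and det: "p2 * int q1 - p1 * int q2 = 1"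
    and p: "p = p1 + p2" and q: "q = q1 + q2"
    and left_end: "\<And>z. (L ^^ q) z \<le> z + of_int p"
    and x: "cyclic_orbit L p q x" and x0: "x 0 \<le> Km" and x1: "Km < x 1"
    and top: "(U ^^ q) v \<le> v + of_int p"
  shows "Cp \<le> x 1"
proof (rule ccontr)
  assume "\<not> Cp \<le> x 1"
  then have x1_Cp: "x 1 < Cp" by simp
  have qpos: "q > 0" "q \<ge> 2" using q q1 q2 by auto
  have modq: "k mod int q < int q" "0 \<le> k mod int q" for k using qpos by simp_all
  \<comment> \<open>This and the next identity say that \<open>q1\<close> iterates move one place to
    the right and \<open>q2\<close> iterates one place to the left.\<close>
  have index1: "int q1 * p = 1 + p1 * int q"
    using det unfolding p q by (simp add: algebra_simps)
  have index2: "int q2 * p = p2 * int q - 1"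
    using det unfolding p q by (simp add: algebra_simps)
  have cop: "coprime p (int q)"
  proof (rule coprimeI)
    fix e assume "e dvd p" "e dvd int q"
    then have "e dvd int q1 * p - p1 * int q" by simp
    then show "is_unit e" using index1 by simp
  qed
  have sm: "strict_mono x" using x by (simp add: cyclic_orbit_def)
  have less_x: "x i < x j \<longleftrightarrow> i < j" and le_x: "x i \<le> x j \<longleftrightarrow> i \<le> j" for i j
    using sm by (simp_all add: strict_mono_less strict_mono_less_eq)
  have Lx: "(L ^^ n) (x i) = x (i + int n * p)" for n i by (rule cyclic_orbit_funpow[OF x])
  have xsh: "x (i + m * int q) = x i + of_int m" for i m by (rule cyclic_orbit_shift[OF x])
  have stepq: "(L ^^ q) (x i) = x i + of_int p" for i
    using cyclic_orbit_step[OF x, of q 0 p i] by (simp add: mult.commute)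
  have step1: "(L ^^ q1) (x i) = x (i + 1) + of_int p1" for i
    by (rule cyclic_orbit_step[OF x index1])
  have step2: "(L ^^ q2) (x i) = x (i - 1) + of_int p2" for i
    using cyclic_orbit_step[OF x, of q2 "-1" p2 i] index2 by simp
  have xq: "x (int q) = x 0 + 1" using xsh[of 0 1] by simp
  \<comment> \<open>Otherwise \<open>x 1\<close> and \<open>Km\<close> would share an image, and
    \<open>L ^^ q\<close> would send \<open>Km\<close> to \<open>x 1 + p\<close>, above the bound
    valid at the left end.\<close>
  have x1_K: "K < x 1"
  proof (rule ccontr)
    assume "\<not> K < x 1"
    then have "(L ^^ q) (x 1) = (L ^^ q) K" using L_flat_funpow[of "x 1" q] x1 qpos by simp
    also have "\<dots> = (L ^^ q) Km" using L_flat_funpow[of Km q] Km C_less_K qpos by simp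
    also have "\<dots> \<le> Km + of_int p" by (rule left_end)
    also have "(L ^^ q) (x 1) = x 1 + of_int p" by (rule stepq)
    finally show False using x1 by simp
  qed
  have xi: "K < x i" "x i \<le> Km + 1" if "1 \<le> i" "i \<le> int q" for i
    using that x1_K x0 xq le_x[of 1 i] le_x[of i "int q"] by linarith+
  have nodvd: "\<not> int q dvd 1 + int n * p" if "n < q2" for n
  proof
    assume "int q dvd 1 + int n * p"
    have "int q dvd p2 * int q - (1 + int n * p)" using \<open>int q dvd 1 + int n * p\<close> by simp
    moreover have "p2 * int q - (1 + int n * p) = (int q2 - int n) * p"
      using index2 by (simp add: left_diff_distrib)
    ultimately have "int q dvd (int q2 - int n) * p" by simp
    then have "int q dvd int q2 - int n"
      using coprime_dvd_mult_left_iff[of "int q" p] cop by (metis coprime_commute)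
    then have "int q \<le> int q2 - int n" using that by (intro zdvd_imp_le) auto
    then show False using q q1 by simp
  qed
  have nodvd': "\<not> int q dvd int n * p" if "0 < n" "n < q" for n
  proof
    assume "int q dvd int n * p"
    then have "int q dvd int n"
      using coprime_dvd_mult_left_iff[of "int q" p] cop by (metis coprime_commute)
    then show False using that zdvd_imp_le[of "int q" "int n"] by simp
  qed
  \<comment> \<open>Such a point would give \<open>U\<close> rotation number at least p2/q2, which
    is larger than p/q.\<close>
  have noU2: "\<not> (U ^^ q2) z \<ge> z + of_int p2" for z
  proof
    assume "(U ^^ q2) z \<ge> z + of_int p2"
    from rotation_compare[OF mono_LU(2) eqv(3) this top] have "p2 * int q \<le> p * int q2" .
    then show False using index2 by (simp add: mult.commute)
  qed
  \<comment> \<open>If the flat piece of \<open>U\<close> contained both points,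
    \<open>U ^^ q2\<close> would send \<open>x 1\<close> as far as \<open>x 2\<close>, that is, at
    least to \<open>x 1 + p2\<close>.\<close>
  have x2_Cp: "Cp < x 2"
  proof (rule ccontr)
    assume "\<not> Cp < x 2"
    then have "(U ^^ q2) (x 1) = (U ^^ q2) (x 2)"
      using U_flat_funpow[of "x 1" q2] U_flat_funpow[of "x 2" q2] x1_Cp x1_K C_less_K less_x[of 1 2] q2 by simp
    also have "\<dots> \<ge> (L ^^ q2) (x 2)" by (rule L_le_U_funpow)
    also have "(L ^^ q2) (x 2) = x 1 + of_int p2"
      using step2[of 2] by simp
    finally show False using noU2 by simp
  qed
  \<comment> \<open>\<open>[x 1, x 2]\<close> reaches the flat piece of \<open>L\<close> only after \<open>q2\<close> steps, as \<open>1 + n p\<close> is not divisible by \<open>q\<close> before\<close>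
  have gap: "\<exists>i m. 1 + int n * p = i + m * int q \<and> 1 \<le> i \<and> i < int q \<and> m = (int n * p) div int q"
    if "n < q2" for n
  proof -
    define i where "i = 1 + (int n * p) mod int q"
    have "1 + int n * p = i + ((int n * p) div int q) * int q" by (simp add: i_def)
    moreover have "i \<le> int q" using modq(1)[of "int n * p"] unfolding i_def by linarith
    moreover have "i \<noteq> int q"
    proof
      assume "i = int q"
      then have "1 + int n * p = (1 + (int n * p) div int q) * int q"
        using calculation(1) by (simp add: algebra_simps)
      then have "int q dvd 1 + int n * p" by simp
      then show False using nodvd[OF that] by simp
    qed
    moreover have "1 \<le> i" using modq(2)[of "int n * p"] unfolding i_def by linarith
    ultimately show ?thesis by (intro exI[of _ i] exI[of _ "(int n * p) div int q"]) auto
  qed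
  have H_between: "x (1 + int n * p) \<le> (L ^^ n) y" "(L ^^ n) y \<le> x (2 + int n * p)"
    if "x 1 \<le> y" "y \<le> x 2" for n y
    using mono_L_funpow[OF that(1), of n] mono_L_funpow[OF that(2), of n] Lx by simp_all
  have H_region: "K + of_int ((int n * p) div int q) \<le> (L ^^ n) y"
      "(L ^^ n) y \<le> Km + 1 + of_int ((int n * p) div int q)"
    if y12: "x 1 \<le> y" "y \<le> x 2" "n < q2" for n y
  proof -
    obtain i m where im: "1 + int n * p = i + m * int q" "1 \<le> i" "i < int q" "m = (int n * p) div int q"
      using gap[OF y12(3)] by auto
    have "2 + int n * p = (i + 1) + m * int q" using im(1) by simp
    then have "x (1 + int n * p) = x i + of_int m" "x (2 + int n * p) = x (i + 1) + of_int m"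
      using im(1) xsh by metis+
    then show "K + of_int ((int n * p) div int q) \<le> (L ^^ n) y"
      "(L ^^ n) y \<le> Km + 1 + of_int ((int n * p) div int q)"
      using H_between[OF y12(1,2), of n] xi[of i] xi[of "i + 1"] im by auto
  qed
  have Lf: "(f ^^ n) y = (L ^^ n) y" if "x 1 \<le> y" "y \<le> x 2" "n \<le> q2" for n y
    using that(3)
  proof (induction n)
    case (Suc n)
    have "L ((L ^^ n) y) = f ((L ^^ n) y)"
      using H_region[OF that(1,2), of n] Suc.prems by (intro L_eq_f_shift[of "(int n * p) div int q"]) auto
    then show ?case using Suc by simp
  qed simp
  have L_strict: "(L ^^ n) y < (L ^^ n) z" if "x 1 \<le> y" "y < z" "z \<le> x 2" "n \<le> q2" for n y z
    using that(4)
  proof (induction n)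
    case (Suc n)
    have yz: "y \<le> x 2" "x 1 \<le> z" using that by auto
    have n: "n < q2" using Suc.prems by simp
    have "f ((L ^^ n) y) < f ((L ^^ n) z)"
      using H_region[OF that(1) yz(1) n] H_region[OF yz(2) that(3) n] Suc Km
      by (intro incr_shift[of "(int n * p) div int q"]) auto
    then show ?case
      using Lf[OF that(1) yz(1), of "Suc n"] Lf[OF yz(2) that(3), of "Suc n"]
        Lf[OF that(1) yz(1), of n] Lf[OF yz(2) that(3), of n] Suc.prems by simp
  qed (use that in simp)
  \<comment> \<open>To the right of \<open>Cp\<close> the upper bound agrees as well: for
    \<open>0 < n < q2\<close> the orbit index of the left endpoint is at least 2 modulo full turns,
    hence past \<open>Cp\<close>.\<close>
  have UL: "(U ^^ n) y = (L ^^ n) y" if "Cp \<le> y" "y \<le> x 2" "n \<le> q2" for n y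
    using that(3)
  proof (induction n)
    case (Suc n)
    have y: "x 1 \<le> y" using that(1) x1_Cp by simp
    have "U ((L ^^ n) y) = f ((L ^^ n) y)"
    proof (cases "n = 0")
      case True
      have "y \<le> Km + 1" using that(2) xi(2)[of 2] qpos by simp
      then show ?thesis using True U_eq_f[of y] that(1) Km C_less_K by simp
    next
      case False
      obtain i m where im: "1 + int n * p = i + m * int q" "1 \<le> i" "i < int q" using gap[of n] Suc.prems by auto
      have "i \<noteq> 1"
      proof
        assume "i = 1"
        then have "int n * p = m * int q" using im(1) by simp
        then show False using nodvd'[of n] False Suc.prems q by simp
      qed
      then have i: "2 \<le> i" using im(2) by simp
      have "2 + int n * p = (i + 1) + m * int q" using im(1) by simp
      then have "x (1 + int n * p) = x i + of_int m" "x (2 + int n * p) = x (i + 1) + of_int m"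
        using im(1) xsh by metis+
      moreover have "x 2 \<le> x i" "x (i + 1) \<le> Km + 1" using i im le_x[of 2 i] xi(2)[of "i + 1"] by auto
      ultimately have "Cp + of_int m \<le> (L ^^ n) y" "(L ^^ n) y \<le> C + 1 + of_int m"
        using H_between[OF y that(2), of n] x2_Cp Km by linarith+
      then show ?thesis by (rule U_eq_f_shift)
    qed
    also have "\<dots> = L ((L ^^ n) y)" using Lf[OF y that(2), of "Suc n"] Lf[OF y that(2), of n] Suc.prems by simp
    finally show ?case using Suc by simp
  qed simp
  have H1: "(L ^^ q2) (x 1) = x 0 + of_int p2"
    using step2[of 1] by simp
  have H2: "(L ^^ q2) (x 2) = x 1 + of_int p2"
    using step2[of 2] by simp
  \<comment> \<open>\<open>L ^^ q2\<close> maps \<open>[x 1, x 2]\<close> onto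
    \<open>[x 0, x 1] + p2\<close>, which contains the translated maximum \<open>C\<close>;
    \<open>al\<close> is a preimage of that maximum.\<close>
  obtain al where al: "x 1 \<le> al" "al \<le> x 2" "(L ^^ q2) al = C + of_int p2"
  proof -
    have "continuous_on {x 1..x 2} (L ^^ q2)"
      using continuous_on_funpow[OF cont(2)] by (rule continuous_on_subset) simp
    then show ?thesis
      using IVT'[of "L ^^ q2" "x 1" "C + of_int p2" "x 2"] H1 H2 x0 Km x1_K C_less_K less_x[of 1 2] that by auto
  qed
  have al2: "al < x 2" using al H2 x1_K C_less_K by (cases "al = x 2") auto
  have Cp_al: "Cp < al"
  proof (rule ccontr)
    assume "\<not> Cp < al"
    then have "(L ^^ q2) al \<le> (L ^^ q2) Cp" by (intro mono_L_funpow) simp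
    also have "\<dots> = (U ^^ q2) Cp" using UL[of Cp q2] x2_Cp by simp
    also have "\<dots> = (U ^^ q2) C" using U_flat_funpow[of C q2] Cp C_less_K q2 by simp
    finally show False using noU2[of C] al(3) by simp
  qed
  \<comment> \<open>during the other \<open>q1\<close> steps \<open>[x 0, C]\<close> avoids the flat piece of \<open>U\<close>, as \<open>n p\<close> is neither 0 nor 1 modulo \<open>q\<close>\<close>
  have U_C: "(U ^^ n) C < C + of_int ((int n * p) div int q) + 1" if "0 < n" "n < q1" for n
  proof (rule ccontr)
    let ?m = "(int n * p) div int q"
    assume "\<not> ?thesis"
    then have "(U ^^ n) C \<ge> C + of_int (?m + 1)" by simp
    from rotation_compare[OF mono_LU(2) eqv(3) this top] have "(?m + 1) * int q \<le> p * int n" .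
    moreover have "int n * p < (?m + 1) * int q"
      using modq(1)[of "int n * p"] div_mult_mod_eq[of "int n * p" "int q"]
      unfolding distrib_right by linarith
    ultimately show False by (simp add: mult.commute)
  qed
  have E_region: "Cp + of_int ((int n * p) div int q) < (U ^^ n) y \<and>
      (U ^^ n) y < C + of_int ((int n * p) div int q) + 1"
    if y: "x 0 \<le> y" "y \<le> C" and n: "0 < n" "n < q1" for n y
  proof -
    define m where "m = (int n * p) div int q"
    define i where "i = (int n * p) mod int q"
    have im: "int n * p = i + m * int q" by (simp add: i_def m_def)
    have i: "0 \<le> i" "i < int q" using qpos by (simp_all add: i_def)
    have "i \<noteq> 0" using nodvd'[of n] n q by (auto simp: i_def dvd_eq_mod_eq_0)
    moreover have "i \<noteq> 1"
    proof
      assume "i = 1"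
      then have "(int q1 - int n) * p = (p1 - m) * int q"
        using im index1 by (simp add: left_diff_distrib)
      then have "int q dvd int (q1 - n) * p" using n by (simp add: of_nat_diff)
      moreover have "0 < q1 - n" "q1 - n < q" using n q q2 by arith+
      ultimately show False using nodvd' by blast
    qed
    ultimately have "2 \<le> i" using i by simp
    then have "Cp + of_int m < x i + of_int m" using x2_Cp le_x[of 2 i] by simp
    also have "\<dots> = (L ^^ n) (x 0)" using Lx[of n 0] xsh[of i m] im by simp
    also have "\<dots> \<le> (U ^^ n) (x 0)" by (rule L_le_U_funpow)
    also have "\<dots> \<le> (U ^^ n) y" by (rule mono_U_funpow[OF y(1)])
    finally have lower: "Cp + of_int m < (U ^^ n) y" .
    have "(U ^^ n) y \<le> (U ^^ n) C" by (rule mono_U_funpow[OF y(2)])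
    then show ?thesis using lower U_C[OF n] by (simp add: m_def)
  qed
  have Uf: "(f ^^ n) y = (U ^^ n) y" if y: "x 0 \<le> y" "y \<le> C" and "n \<le> q1" for n y
    using \<open>n \<le> q1\<close>
  proof (induction n)
    case (Suc n)
    have "U ((U ^^ n) y) = f ((U ^^ n) y)"
    proof (cases "n = 0")
      case True
      have "x 2 \<le> x 0 + 1" using le_x[of 2 "int q"] qpos xq by simp
      then show ?thesis using U_eq_f_shift[of "-1" y] y True x2_Cp by simp
    next
      case False
      then show ?thesis using E_region[OF y, of n] Suc.prems
        by (intro U_eq_f_shift[of "(int n * p) div int q"]) auto
    qed
    then show ?case using Suc by simp
  qed simp
  have fU: "(f ^^ q) y = (U ^^ q) y" if y: "Cp \<le> y" "y \<le> al" for y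
  proof -
    have y12: "x 1 \<le> y" "y \<le> x 2" using y x1_Cp al by auto
    define d where "d = (L ^^ q2) y - of_int p2"
    have d: "(L ^^ q2) y = d + of_int p2" by (simp add: d_def)
    have "x 0 \<le> d" "d \<le> C"
      using mono_L_funpow[OF y12(1), of q2] mono_L_funpow[OF y(2), of q2] H1 al(3) d by simp_all
    then have "(f ^^ q1) d = (U ^^ q1) d" by (intro Uf) auto
    then have "(f ^^ q1) ((L ^^ q2) y) = (U ^^ q1) ((L ^^ q2) y)"
      unfolding d by (simp add: funpow_add_int)
    then show ?thesis using Lf[OF y12, of q2] UL[OF y(1) y12(2), of q2] by (simp add: q funpow_add)
  qed
  \<comment> \<open>After \<open>q2\<close> steps \<open>al\<close> sits on the flat piece of
    \<open>U\<close>, so from there it moves like \<open>Cp\<close> and hence at least as far as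
    \<open>x 1\<close>, which reaches \<open>x 2 > al\<close> (up to translation) in the remaining
    \<open>q1\<close> steps.\<close>
  have above: "(f ^^ q) al > al + of_int p"
  proof -
    have "(f ^^ q) al = (U ^^ q1) ((U ^^ q2) al)"
      using fU[of al] Cp_al by (simp add: q funpow_add)
    also have "(U ^^ q2) al = C + of_int p2" using UL[of al q2] Cp_al al by simp
    also have "(U ^^ q1) (C + of_int p2) = (U ^^ q1) Cp + of_int p2"
      using U_flat_funpow[of C q1] Cp C_less_K q1 by (simp add: funpow_add_int)
    also have "\<dots> \<ge> (U ^^ q1) (x 1) + of_int p2"
      using mono_U_funpow[of "x 1" Cp q1] x1_Cp by simp
    finally have "(f ^^ q) al \<ge> (U ^^ q1) (x 1) + of_int p2" .
    moreover have "(U ^^ q1) (x 1) \<ge> (L ^^ q1) (x 1)" by (rule L_le_U_funpow)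
    moreover have "(L ^^ q1) (x 1) = x 2 + of_int p1"
      using step1[of 1] by simp
    ultimately show ?thesis using al2 by (simp add: p)
  qed
  \<comment> \<open>\<open>Cp\<close> itself serves if it moves by at most \<open>p\<close>. If not,
    a periodic orbit of \<open>U\<close> misses the flat piece, and its first point to the right of
    \<open>C\<close> serves.\<close>
  obtain y where y: "Cp \<le> y" "y < al" "(U ^^ q) y \<le> y + of_int p"
  proof (cases "(U ^^ q) Cp \<le> Cp + of_int p")
    case True
    then show ?thesis using that[of Cp] Cp_al by simp
  next
    case False
    have "\<exists>r. (U ^^ q) r - r = of_int p"
    proof -
      have c: "continuous_on S (\<lambda>r. (U ^^ q) r - r)" for S
        using continuous_on_funpow[OF cont(3), of q] by (intro continuous_intros) (auto elim: continuous_on_subset)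
      have "(U ^^ q) (x 1) - x 1 \<ge> of_int p"
        using L_le_U_funpow[of q "x 1"] stepq[of 1] by simp
      then show ?thesis
        using IVT'[of "\<lambda>r. (U ^^ q) r - r" v "of_int p" "x 1"]
          IVT2'[of "\<lambda>r. (U ^^ q) r - r" v "of_int p" "x 1"] top c by (cases "v \<le> x 1") fastforce+
    qed
    then obtain r where r: "(U ^^ q) r = r + of_int p" by (auto simp: algebra_simps)
    obtain R where R: "cyclic_orbit U p q R"
      using cyclic_orbit_exists[OF mono_LU(2) eqv(3) r qpos(1) cop] by blast
    obtain j where j: "R j \<le> C" "C < R (j + 1)" using cyclic_orbit_bracket[OF R qpos(1)] by blast
    have Rq: "(U ^^ q) (R i) = R i + of_int p" for i
      using cyclic_orbit_step[OF R, of q 0 p i] by (simp add: mult.commute)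
    have R2: "(U ^^ q2) (R i) = R (i - 1) + of_int p2" for i
      using cyclic_orbit_step[OF R, of q2 "-1" p2 i] index2 by simp
    have noflat: "\<not> (C \<le> R i \<and> R i \<le> Cp)" for i
    proof
      assume i: "C \<le> R i \<and> R i \<le> Cp"
      then have "(U ^^ q) Cp = (U ^^ q) (R i)" using U_flat_funpow[of "R i" q] qpos by simp
      also have "\<dots> = R i + of_int p" by (rule Rq)
      finally show False using False i by simp
    qed
    have Rj: "R j < C" "Cp < R (j + 1)" using noflat[of j] noflat[of "j + 1"] j Cp C_less_K by auto
    have "(U ^^ q2) (R (j + 1)) = R j + of_int p2"
      using R2[of "j + 1"] by simp
    also have "\<dots> < (U ^^ q2) al" using UL[of al q2] Cp_al al Rj by simp
    \<comment> \<open>\<open>U ^^ q2\<close> sends this point to \<open>R j + p2\<close>, below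
      \<open>C + p2\<close>, which is the image of \<open>al\<close>.\<close>
    finally have "R (j + 1) < al" using mono_U_funpow[of al "R (j + 1)" q2] by (meson not_less)
    moreover have "(U ^^ q) (R (j + 1)) = R (j + 1) + of_int p"
      by (rule Rq)
    ultimately show ?thesis using that[of "R (j + 1)"] Rj by simp
  qed
  obtain be where be: "y < be" "be < al" "(f ^^ q) be > be + of_int p"
  proof -
    have "isCont (\<lambda>z. (f ^^ q) z - z) al"
      using continuous_on_funpow[OF cont(1), of q] by (auto intro!: continuous_intros simp: continuous_on_eq_continuous_at)
    then have "\<forall>\<^sub>F z in at al. of_int p < (f ^^ q) z - z"
      using above unfolding isCont_def by (intro order_tendstoD(1)) auto
    then have "\<forall>\<^sub>F z in at_left al. of_int p < (f ^^ q) z - z" by (simp add: eventually_at_split)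
    moreover have "\<forall>\<^sub>F z in at_left al. z \<in> {y<..<al}" by (rule eventually_at_left_real[OF y(2)])
    ultimately have "\<forall>\<^sub>F z in at_left al. z \<in> {y<..<al} \<and> of_int p < (f ^^ q) z - z"
      by eventually_elim auto
    then obtain z where "z \<in> {y<..<al}" "of_int p < (f ^^ q) z - z"
      using eventually_happens[of _ "at_left al"] trivial_limit_at_left_real by blast
    then show ?thesis using that[of z] by auto
  qed
  have low: "K + of_int ((int n * p) div int q) < (L ^^ n) (x 1)"
      "(L ^^ n) (x 1) \<le> Km + 1 + of_int ((int n * p) div int q)" for n
  proof -
    have "(L ^^ n) (x 1) = x (1 + (int n * p) mod int q) + of_int ((int n * p) div int q)"
      unfolding Lx by (rule cyclic_orbit_interval[OF x qpos(1)])
    moreover have "1 \<le> 1 + (int n * p) mod int q" "1 + (int n * p) mod int q \<le> int q"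
      using modq[of "int n * p"] by linarith+
    ultimately show "K + of_int ((int n * p) div int q) < (L ^^ n) (x 1)"
      "(L ^^ n) (x 1) \<le> Km + 1 + of_int ((int n * p) div int q)"
      using xi[of "1 + (int n * p) mod int q"] by simp_all
  qed
  \<comment> \<open>The first \<open>q\<close> images of \<open>x 1\<close> lie strictly right of
    translates of \<open>K\<close>, and by continuity so do those of a point slightly to the
    left.\<close>
  obtain u where u: "u < x 1" "\<And>n. n < q \<Longrightarrow> K + of_int ((int n * p) div int q) < (L ^^ n) u"
  proof -
    have "\<forall>\<^sub>F u in at_left (x 1). \<forall>n\<in>{..<q}. K + of_int ((int n * p) div int q) < (L ^^ n) u"
      by (intro eventually_ball_finite ballI eventually_at_left_funpow_greater cont low(1)) auto
    moreover have "\<forall>\<^sub>F u in at_left (x 1). u < x 1" by (simp add: eventually_at_filter)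
    ultimately have "\<forall>\<^sub>F u in at_left (x 1). u < x 1 \<and> (\<forall>n\<in>{..<q}. K + of_int ((int n * p) div int q) < (L ^^ n) u)"
      by eventually_elim auto
    then show ?thesis
      using that eventually_happens[of _ "at_left (x 1)"] trivial_limit_at_left_real by blast
  qed
  have fu: "(f ^^ n) u = (L ^^ n) u" if "n \<le> q" for n
    using that
  proof (induction n)
    case (Suc n)
    have "(L ^^ n) u \<le> Km + 1 + of_int ((int n * p) div int q)"
      using low(2)[of n] mono_L_funpow[of u "x 1" n] u(1) by simp
    then have "L ((L ^^ n) u) = f ((L ^^ n) u)"
      using u(2)[of n] Suc.prems by (intro L_eq_f_shift[of "(int n * p) div int q"]) auto
    then show ?case using Suc by simp
  qed simp
  have branch: "\<exists>m::int. K + of_int m < (f ^^ n) u \<and> (f ^^ n) be < C + 1 + of_int m" if "n < q" for n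
  proof (intro exI[of _ "(int n * p) div int q"] conjI)
    show "K + of_int ((int n * p) div int q) < (f ^^ n) u" using u(2) fu that by simp
    have be12: "x 1 \<le> be" "be \<le> x 2" "Cp \<le> be" using be y x1_Cp al by auto
    show "(f ^^ n) be < C + 1 + of_int ((int n * p) div int q)"
    proof (cases "n < q2")
      case True
      then show ?thesis using H_region(2)[OF be12(1,2), of n] Lf[OF be12(1,2), of n] Km by simp
    next
      case False
      define k where "k = n - q2"
      have n: "n = k + q2" and k: "k < q1" using False that q by (auto simp: k_def)
      define d where "d = (L ^^ q2) be - of_int p2"
      have d: "(f ^^ q2) be = d + of_int p2" using Lf[OF be12(1,2), of q2] by (simp add: d_def)
      have "(L ^^ q2) be < C + of_int p2" using L_strict[of be al q2] be be12 al by simp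
      then have dC: "x 0 \<le> d" "d < C"
        using mono_L_funpow[OF be12(1), of q2] H1 by (simp_all add: d_def)
      have fn: "(f ^^ n) be = (U ^^ k) d + of_int p2"
        using Uf[of d k] dC k by (simp add: n funpow_add d funpow_add_int)
      have np: "int n * p = (int k * p - 1) + p2 * int q" using index2 by (simp add: n algebra_simps)
      show ?thesis
      proof (cases "k = 0")
        case True
        \<comment> \<open>At time \<open>q2\<close> the index is -1 modulo \<open>q\<close>, so the
          quotient is \<open>p2 - 1\<close>: the images lie on the branch that ends at
          \<open>C + p2\<close>.\<close>
        have "(int n * p) div int q = p2 - 1"
        proof -
          have "int n * p = (int q - 1) + (p2 - 1) * int q" using np True by (simp add: algebra_simps)
          then show ?thesis using qpos by (simp only: div_mult_self1) simp
        qed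
        then show ?thesis using fn True dC by simp
      next
        case False
        have "\<not> int q dvd int k * p" using nodvd'[of k] False k q by simp
        then have "(int k * p - 1) div int q = (int k * p) div int q"
        proof -
          define i where "i = (int k * p) mod int q"
          assume "\<not> int q dvd int k * p"
          then have "i \<noteq> 0" by (simp add: i_def dvd_eq_mod_eq_0)
          moreover have "0 \<le> i" "i < int q" using qpos by (simp_all add: i_def)
          moreover have "int k * p - 1 = (i - 1) + (int k * p) div int q * int q" by (simp add: i_def algebra_simps)
          ultimately show ?thesis by (simp only: div_mult_self1) simp
        qed
        then have "(int n * p) div int q = (int k * p) div int q + p2"
          using qpos by (simp only: np div_mult_self1)
        then show ?thesis using E_region[of d k] dC False k fn by simp
      qed
    qed
  qed
  have u1: "u < x 1" and "x 1 < y" and "y < be" using u y x1_Cp be by auto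
  note ex = expand_iterate[OF this branch qpos(1)]
  have fq1: "(f ^^ q) (x 1) = x 1 + of_int p"
  proof -
    have "(f ^^ n) (x 1) = (L ^^ n) (x 1)" for n
    proof (induction n)
      case (Suc n)
      have "L ((L ^^ n) (x 1)) = f ((L ^^ n) (x 1))"
        using low[of n] by (intro L_eq_f_shift[of "(int n * p) div int q"]) auto
      then show ?case using Suc by simp
    qed simp
    then show ?thesis using stepq[of 1] by simp
  qed
  \<comment> \<open>Relative to translation by \<open>p\<close>, \<open>u\<close> and
    \<open>y\<close> do not move right, \<open>x 1\<close> is fixed and \<open>be\<close> moves
    right. The outer intervals do not shrink and the middle one does not grow, against strict
    expansion.\<close>
  have "(f ^^ q) u \<le> u + of_int p" using fu[of q] left_end[of u] by simp
  moreover have "(f ^^ q) y \<le> y + of_int p" using fU[of y] y by simp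
  ultimately have "cross_ratio ((f ^^ q) u) ((f ^^ q) (x 1)) ((f ^^ q) y) ((f ^^ q) be) \<le> cross_ratio u (x 1) y be"
    using ex fq1 be \<open>x 1 < y\<close> u1 by (intro cross_ratio_antimono) auto
  then show False using ex by simp
qed

end

section \<open>From a locked child to a locking interval of its parent\<close>

context bimodal_lift
begin

text \<open>Modulo 1 every orbit point lies in the interval from \<open>Cp\<close> to
  \<open>Km + 1\<close>, where \<open>L\<close>, \<open>U\<close> and \<open>f\<close> agree. Were
  the return map translation by \<open>p\<close> on a left neighborhood of \<open>Km\<close>, it
  would preserve cross ratios there.\<close>

lemma orbit_outside_flat_pieces:
  fixes p :: int and x :: "int \<Rightarrow> real"
  assumes q: "q > 0"
    and x: "cyclic_orbit L p q x" and x0: "x 0 = Km" and x1: "Cp < x 1"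
  shows "(U ^^ q) Km = Km + of_int p"
    and "\<exists>z. (U ^^ q) z = (L ^^ q) z \<and> (L ^^ q) z \<noteq> z + of_int p"
proof -
  \<comment> \<open>Subtracting 1 assigns residue 0 to the right end \<open>Km + 1\<close> of the
    block, from which the common branch extends to the left.\<close>
  define m where "m n = (int n * p - 1) div int q" for n
  have sm: "strict_mono x" using x by (simp add: cyclic_orbit_def)
  have xq: "x (int q) = Km + 1" using cyclic_orbit_shift[OF x, of 0 1] x0 by simp
  have Lx: "(L ^^ n) Km = x (int n * p)" for n using cyclic_orbit_funpow[OF x, of n 0] x0 by simp
  have orb: "Cp + of_int (m n) < (L ^^ n) Km" "(L ^^ n) Km \<le> Km + 1 + of_int (m n)" for n
  proof -
    define i where "i = 1 + (int n * p - 1) mod int q"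
    have "(int n * p - 1) mod int q < int q" "0 \<le> (int n * p - 1) mod int q" using q by simp_all
    then have i: "1 \<le> i" "i \<le> int q" unfolding i_def by linarith+
    have "int n * p = i + m n * int q"
      using div_mult_mod_eq[of "int n * p - 1" "int q"] by (simp add: i_def m_def)
    then have "(L ^^ n) Km = x i + of_int (m n)" using Lx cyclic_orbit_shift[OF x] by metis
    moreover have "x 1 \<le> x i" "x i \<le> x (int q)" using i sm by (simp_all add: strict_mono_less_eq)
    ultimately show "Cp + of_int (m n) < (L ^^ n) Km" "(L ^^ n) Km \<le> Km + 1 + of_int (m n)"
      using x1 xq by simp_all
  qed
  have eqs: "L w = f w" "U w = f w" if "Cp + of_int (m n) \<le> w" "w \<le> Km + 1 + of_int (m n)" for n w
    using L_eq_f_shift[of "m n" w] U_eq_f_shift[of "m n" w] that Cp Km by simp_all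
  have UKm: "(U ^^ n) Km = (L ^^ n) Km" for n
  proof (induction n)
    case (Suc n)
    then show ?case using eqs[of n "(L ^^ n) Km"] orb[of n] by simp
  qed simp
  show "(U ^^ q) Km = Km + of_int p"
    using UKm[of q] Lx[of q] cyclic_orbit_shift[OF x, of 0 p] x0 by (simp add: mult.commute)
  \<comment> \<open>Only the left side is available: to the right of \<open>Km\<close> the lower
    bound is flat and leaves the graph of \<open>f\<close>.\<close>
  have "\<forall>\<^sub>F u in at_left Km. \<forall>n\<in>{..<q}. Cp + of_int (m n) < (L ^^ n) u"
    by (intro eventually_ball_finite ballI eventually_at_left_funpow_greater cont orb(1)) auto
  then obtain e where e: "e < Km" "\<And>u n. e < u \<Longrightarrow> u < Km \<Longrightarrow> n < q \<Longrightarrow> Cp + of_int (m n) < (L ^^ n) u"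
    unfolding eventually_at_left_field by auto
  have near: "(f ^^ n) u = (L ^^ n) u \<and> (U ^^ n) u = (L ^^ n) u" if u: "e < u" "u < Km" "n \<le> q" for u n
    using u(3)
  proof (induction n)
    case (Suc n)
    have "(L ^^ n) u \<le> Km + 1 + of_int (m n)" using orb(2)[of n] mono_L_funpow[of u Km n] u(2) by simp
    then have "L ((L ^^ n) u) = f ((L ^^ n) u)" "U ((L ^^ n) u) = f ((L ^^ n) u)"
      using eqs[of n "(L ^^ n) u"] e(2)[OF u(1,2), of n] Suc.prems by simp_all
    then show ?case using Suc by simp
  qed simp
  show "\<exists>z. (U ^^ q) z = (L ^^ q) z \<and> (L ^^ q) z \<noteq> z + of_int p"
  proof (rule ccontr)
    assume "\<not> ?thesis"
    then have id: "(f ^^ q) u = u + of_int p" if "e < u" "u < Km" for u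
      using near[of u q] that by auto
    \<comment> \<open>Four equally spaced points of the interval \<open>(e, Km)\<close>, all at
      positive distance from its ends.\<close>
    define s where "s j = e + (Km - e) * (j / 5)" for j :: real
    have s: "s 1 < s 2" "s 2 < s 3" "s 3 < s 4" "e < s 1" "s 4 < Km"
      using e(1) by (simp_all add: s_def field_simps)
    have "(f ^^ q) (s 1) < (f ^^ q) (s 2) \<and> (f ^^ q) (s 2) < (f ^^ q) (s 3) \<and> (f ^^ q) (s 3) < (f ^^ q) (s 4) \<and>
      cross_ratio (s 1) (s 2) (s 3) (s 4) <
      cross_ratio ((f ^^ q) (s 1)) ((f ^^ q) (s 2)) ((f ^^ q) (s 3)) ((f ^^ q) (s 4))"
    proof (rule expand_iterate[OF s(1-3) _ q])
      fix n assume n: "n < q"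
      have "Cp + of_int (m n) < (f ^^ n) (s 1)" using e(2)[of "s 1" n] near[of "s 1" n] s n by simp
      moreover have "(f ^^ n) (s 4) \<le> Km + 1 + of_int (m n)"
        using near[of "s 4" n] orb(2)[of n] mono_L_funpow[of "s 4" Km n] s n by simp
      ultimately show "\<exists>m::int. K + of_int m < (f ^^ n) (s 1) \<and> (f ^^ n) (s 4) < C + 1 + of_int m"
        using Cp Km by (intro exI[of _ "m n"]) simp
    qed
    then show False using id s cross_ratio_add by simp
  qed
qed

abbreviation "La \<equiv> translate L"
abbreviation "Ua \<equiv> translate U"

definition locked :: "int \<Rightarrow> nat \<Rightarrow> real \<Rightarrow> bool" where
  "locked p q a \<longleftrightarrow> (\<exists>x. (La a ^^ q) x \<ge> x + of_int p) \<and> (\<exists>x. (Ua a ^^ q) x \<le> x + of_int p)"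

lemma Rot_translate_iff_locked:
  "q > 0 \<Longrightarrow> Rot (translate f a) = {of_int p / of_nat q} \<longleftrightarrow> locked p q a"
  using Rot_eq_iff[OF degree_one_lift_add[OF lift], of q a p]
  by (simp add: locked_def lower_bound_add[OF lift] upper_bound_add[OF lift])

text \<open>The lower condition cuts out a half-line to the right and the upper one a half-line to
  the left; \<open>u < l\<close> encodes that no parameter is locked. The bound at \<open>l\<close>
  is exported as the starting point of the child argument.\<close>

lemma locked_interval:
  assumes "q > 0"
  obtains l u where "\<And>a. locked p q a \<longleftrightarrow> l \<le> a \<and> a \<le> u"
    and "\<And>x. (La l ^^ q) x \<le> x + of_int p"
proof -
  obtain l where l: "{a. \<exists>x. (La a ^^ q) x \<ge> x + of_int p} = {l..}"
    and l': "\<And>x. (La l ^^ q) x \<le> x + of_int p"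
    using least_rotating_translate[OF lift_lower_bound[OF lift] mono_LU(1) assms] by blast
  obtain u where u: "{a. \<exists>x. (Ua a ^^ q) x \<le> x + of_int p} = {..u}"
    using greatest_rotating_translate[OF lift_upper_bound[OF lift] mono_LU(2) assms] by blast
  have "locked p q a \<longleftrightarrow> l \<le> a \<and> a \<le> u" for a
    using l u unfolding locked_def by (simp add: set_eq_iff)
  then show ?thesis using that l' by blast
qed

text \<open>The image depends continuously on the parameter and grows at least as fast as it, so
  changing the parameter by the absolute value of the deficit \<open>v\<close> brackets the
  target.\<close>

lemma exists_periodic_flat:
  assumes "q > 0"
  obtains a where "(La a ^^ q) K = Km + of_int p"
proof -
  define v where "v = Km + of_int p - (La 0 ^^ q) K"
  have "(La (- \<bar>v\<bar>) ^^ q) K \<le> Km + of_int p" "Km + of_int p \<le> (La \<bar>v\<bar> ^^ q) K"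
    using translate_funpow_gap[OF mono_LU(1) _ assms, of "- \<bar>v\<bar>" 0 K]
      translate_funpow_gap[OF mono_LU(1) _ assms, of 0 "\<bar>v\<bar>" K] unfolding v_def by linarith+
  then show ?thesis
    using IVT'[of "\<lambda>a. (La a ^^ q) K" "- \<bar>v\<bar>" "Km + of_int p" "\<bar>v\<bar>"]
      continuous_translate_funpow_param[OF cont(2)] that by auto
qed

lemma locked_parent:
  fixes p1 p2 p :: int and q1 q2 q :: nat
  assumes q1: "q1 > 0" and q2: "q2 > 0" and det: "p2 * int q1 - p1 * int q2 = 1"
    and child: "locked (p1 + p2) (q1 + q2) a'"
    and pq: "p = p1 \<and> q = q1 \<or> p = p2 \<and> q = q2"
  obtains a b where "a < b" "locked p q a" "locked p q b"
proof -
  have q: "q > 0" using pq q1 q2 by auto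
  define p' q' where "p' = p1 + p2" and "q' = q1 + q2"
  have q': "q' > 0" using q1 by (simp add: q'_def)
  have cop': "coprime p' (int q')"
  proof (rule coprimeI)
    fix e assume "e dvd p'" "e dvd int q'"
    then have "e dvd p' * int q1 - p1 * int q'" by simp
    moreover have "p' * int q1 - p1 * int q' = 1" using det by (simp add: p'_def q'_def algebra_simps)
    ultimately show "is_unit e" by simp
  qed
  have cop: "coprime p (int q)"
  proof (rule coprimeI)
    fix e assume e: "e dvd p" "e dvd int q"
    then have "e dvd p2 * int q1 - p1 * int q2" using pq by auto
    then show "is_unit e" using det by simp
  qed
  have eqa [simp]: "equivariant (La a)" "mono (La a)" "mono (Ua a)" for a
    by (simp_all add: equivariant_translate mono_translate)
  obtain l u where lu: "\<And>a. locked p' q' a \<longleftrightarrow> l \<le> a \<and> a \<le> u"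
    and l: "\<And>x. (La l ^^ q') x \<le> x + of_int p'" using locked_interval[OF q'] by blast
  have locked_l: "locked p' q' l" using child lu by (auto simp: p'_def q'_def)
  then obtain z where "(La l ^^ q') z \<ge> z + of_int p'" by (auto simp: locked_def)
  then have z: "(La l ^^ q') z = z + of_int p'" using l[of z] by simp
  obtain v where v: "(Ua l ^^ q') v \<le> v + of_int p'" using locked_l by (auto simp: locked_def)
  obtain y0 where y0: "cyclic_orbit (La l) p' q' y0"
    using cyclic_orbit_exists[OF eqa(2,1) z q' cop'] by blast
  obtain j where j: "y0 j \<le> Km" "Km < y0 (j + 1)" using cyclic_orbit_bracket[OF y0 q'] by blast
  define y where "y i = y0 (i + j)" for i
  have y: "cyclic_orbit (La l) p' q' y" unfolding y_def[abs_def] by (rule cyclic_orbit_reindex[OF y0])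
  have yK: "y 0 \<le> Km" "Km < y 1" using j by (simp_all add: y_def add.commute)
  interpret child: bimodal_lift "translate f l" C K by (rule bimodal_translate)
  have y1: "Cp \<le> y 1"
    by (rule child.locked_orbit_avoids_flat_top[unfolded translate_points
        lower_bound_add[OF lift] upper_bound_add[OF lift], OF q1 q2 det p'_def q'_def l y yK v])
  obtain a where a: "(La a ^^ q) K = Km + of_int p" using exists_periodic_flat[OF q] by blast
  have aKm: "(La a ^^ q) Km = Km + of_int p"
  proof -
    have "La a Km = La a K" using L_flat[of Km] L_flat[of K] Km C_less_K by simp
    moreover obtain k where "q = Suc k" using q gr0_conv_Suc by blast
    ultimately show ?thesis using a by (simp only: funpow_Suc_right o_apply)
  qed
  obtain x where x: "cyclic_orbit (La a) p q x" and x0: "x 0 = Km"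
    using cyclic_orbit_exists[OF eqa(2,1) aKm q cop] by blast
  have "y 1 < x 1"
    using pq
  proof
    assume pq1: "p = p1 \<and> q = q1"
    \<comment> \<open>At \<open>a\<close> the lower bound rotates by p1/q1, less than p'/q', whereas
      at \<open>l\<close> and beyond it rotates at least by p'/q'.\<close>
    have "a < l"
    proof (rule ccontr)
      assume "\<not> a < l"
      then have "(La a ^^ q') z \<ge> z + of_int p'"
        using translate_funpow_mono[OF mono_LU(1), of l a q' z] z by simp
      from rotation_compare[OF eqa(2,1) this, of q Km p] aKm
      have "p' * int q \<le> p * int q'" by simp
      then show False using pq1 det by (simp add: p'_def q'_def algebra_simps)
    qed
    show ?thesis
    proof (rule ccontr)
      assume "\<not> y 1 < x 1"
      \<comment> \<open>For the left parent the comparison runs through \<open>q2\<close> iterates,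
        which move \<open>x 1\<close> to \<open>x 0 = Km\<close> and \<open>y 1\<close> to
        \<open>y 0 \<le> Km\<close>, both up to translation by \<open>p2\<close>.\<close>
      then have "(La a ^^ q2) (x 1) \<le> (La a ^^ q2) (y 1)" by (intro monoD[OF mono_pow[OF eqa(2)]]) simp
      also have "\<dots> < (La l ^^ q2) (y 1)" by (rule translate_funpow_strict[OF mono_LU(1) \<open>a < l\<close> q2])
      also have "\<dots> = y 0 + of_int p2"
        using cyclic_orbit_step[OF y, of q2 "-1" p2 1] det by (simp add: p'_def q'_def algebra_simps)
      also have "(La a ^^ q2) (x 1) = x 0 + of_int p2"
        using cyclic_orbit_step[OF x, of q2 "-1" p2 1] det pq1 by (simp add: algebra_simps)
      finally show False using x0 yK by simp
    qed
  next
    assume pq2: "p = p2 \<and> q = q2"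
    have "l < a"
    proof (rule ccontr)
      assume "\<not> l < a"
      then have "(La l ^^ q) Km \<ge> Km + of_int p"
        using translate_funpow_mono[OF mono_LU(1), of a l q Km] aKm by simp
      from rotation_compare[OF eqa(2,1) this l[of z]]
      have "p * int q' \<le> p' * int q" .
      then show False using pq2 det by (simp add: p'_def q'_def algebra_simps)
    qed
    \<comment> \<open>For the right parent it runs through \<open>q1\<close> iterates, which move
      index 0 to index 1 in both orbits.\<close>
    have "y 1 + of_int p1 = (La l ^^ q1) (y 0)"
      using cyclic_orbit_step[OF y, of q1 1 p1 0] det by (simp add: p'_def q'_def algebra_simps)
    also have "\<dots> \<le> (La l ^^ q1) Km" by (rule monoD[OF mono_pow[OF eqa(2)] yK(1)])
    also have "\<dots> < (La a ^^ q1) Km" by (rule translate_funpow_strict[OF mono_LU(1) \<open>l < a\<close> q1])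
    also have "\<dots> = x 1 + of_int p1"
      using cyclic_orbit_step[OF x, of q1 1 p1 0] det pq2 x0 by (simp add: algebra_simps)
    finally show ?thesis by simp
  qed
  then have x1: "Cp < x 1" using y1 by simp
  interpret parent: bimodal_lift "translate f a" C K by (rule bimodal_translate)
  note out = parent.orbit_outside_flat_pieces[unfolded translate_points
      lower_bound_add[OF lift] upper_bound_add[OF lift], OF q x x0 x1]
  have la: "locked p q a" unfolding locked_def using aKm out(1) by (intro conjI exI[of _ Km]) auto
  obtain w where w: "(Ua a ^^ q) w = (La a ^^ q) w" "(La a ^^ q) w \<noteq> w + of_int p" using out(2) by blast
  have contL: "isCont (\<lambda>b. (La b ^^ q) w) a" and contU: "isCont (\<lambda>b. (Ua b ^^ q) w) a"
    using continuous_translate_funpow_param[OF cont(2), of UNIV q w]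
      continuous_translate_funpow_param[OF cont(3), of UNIV q w]
    by (simp_all add: continuous_on_eq_continuous_at)
  show ?thesis
  \<comment> \<open>The sign of the displacement at \<open>w\<close> selects the side. If it is
    positive, the strict lower condition at \<open>w\<close> survives a small decrease of the
    parameter, and the upper condition at \<open>Km\<close> only improves; if negative, the roles
    and the direction are exchanged.\<close>
  proof (cases "(La a ^^ q) w > w + of_int p")
    case True
    then have "\<forall>\<^sub>F b in at a. (La b ^^ q) w > w + of_int p"
      using contL unfolding isCont_def by (intro order_tendstoD(1))
    then have "\<forall>\<^sub>F b in at_left a. (La b ^^ q) w > w + of_int p" by (simp add: eventually_at_split)
    moreover have "\<forall>\<^sub>F b in at_left a. b < a" by (simp add: eventually_at_filter)
    ultimately have "\<forall>\<^sub>F b in at_left a. b < a \<and> (La b ^^ q) w > w + of_int p" by eventually_elim auto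
    then obtain b where b: "b < a" "(La b ^^ q) w > w + of_int p"
      using eventually_happens[of _ "at_left a"] trivial_limit_at_left_real by blast
    have "(Ua b ^^ q) Km \<le> Km + of_int p"
      using translate_funpow_mono[OF mono_LU(2), of b a q Km] b(1) out(1) by simp
    then have "locked p q b" unfolding locked_def using b(2) by (auto intro: less_imp_le)
    then show ?thesis using that b(1) la by blast
  next
    case False
    then have "(Ua a ^^ q) w < w + of_int p" using w by simp
    then have "\<forall>\<^sub>F b in at a. (Ua b ^^ q) w < w + of_int p"
      using contU unfolding isCont_def by (intro order_tendstoD(2))
    then have "\<forall>\<^sub>F b in at_right a. (Ua b ^^ q) w < w + of_int p" by (simp add: eventually_at_split)
    moreover have "\<forall>\<^sub>F b in at_right a. a < b" by (simp add: eventually_at_filter)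
    ultimately have "\<forall>\<^sub>F b in at_right a. a < b \<and> (Ua b ^^ q) w < w + of_int p" by eventually_elim auto
    then obtain b where b: "a < b" "(Ua b ^^ q) w < w + of_int p"
      using eventually_happens[of _ "at_right a"] trivial_limit_at_right_real by blast
    have "Km + of_int p \<le> (La b ^^ q) Km"
      using translate_funpow_mono[OF mono_LU(1), of a b q Km] b(1) aKm by simp
    then have "locked p q b" unfolding locked_def using b(2) by (auto intro: less_imp_le)
    then show ?thesis using that b(1) la by blast
  qed
qed

end

section \<open>Families in Class N\<close>

lemma lower_bound_mono_eq: "degree_one_lift f \<Longrightarrow> mono f \<Longrightarrow> lower_bound f = f"
  by (rule ext, rule lower_bound_eqI) (auto dest: monoD)

lemma upper_bound_mono_eq: "degree_one_lift f \<Longrightarrow> mono f \<Longrightarrow> upper_bound f = f"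
  by (rule ext, rule upper_bound_eqI) (auto dest: monoD)

lemma bound_gap_mono_eq_0:
  assumes "degree_one_lift f" "mono f"
  shows "bound_gap f = 0"
proof -
  have "(\<lambda>x. infdist x (graph_of f)) ` graph_of f = {0}"
    by (auto simp: graph_of_def image_iff)
  then show ?thesis
    unfolding bound_gap_def hausdorff_dist_def lower_bound_mono_eq[OF assms] upper_bound_mono_eq[OF assms]
    by simp
qed

text \<open>With zero distance the graph of the upper bound lies in the closed graph of the lower
  one, so the bounds coincide and \<open>f\<close>, caught between them, is monotone.\<close>

lemma mono_if_bound_gap_le_0:
  assumes f: "degree_one_lift f" and gap: "bound_gap f \<le> 0"
  shows "mono f"
proof -
  let ?L = "lower_bound f" and ?U = "upper_bound f"
  obtain M where M: "\<And>x. \<bar>?L x - x\<bar> \<le> M" using lift_displacement_bounded[OF lift_lower_bound[OF f]] by blast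
  obtain N where N: "\<And>x. \<bar>?U x - x\<bar> \<le> N" using lift_displacement_bounded[OF lift_upper_bound[OF f]] by blast
  \<comment> \<open>The real supremum dominates its members only if the distances are bounded, which
    periodicity of the displacements ensures.\<close>
  have bdd: "bdd_above ((\<lambda>z. infdist z (graph_of ?L)) ` graph_of ?U)"
  proof (rule bdd_aboveI2)
    fix z assume "z \<in> graph_of ?U"
    then obtain x where x: "z = (x, ?U x)" by (auto simp: graph_of_def)
    have "infdist z (graph_of ?L) \<le> dist z (x, ?L x)" by (rule infdist_le) (simp add: graph_of_def)
    also have "\<dots> = \<bar>?U x - ?L x\<bar>" by (simp add: x dist_Pair_Pair dist_real_def)
    also have "\<dots> \<le> M + N" using M[of x] N[of x] by linarith
    finally show "infdist z (graph_of ?L) \<le> M + N" .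
  qed
  have closed: "closed (graph_of ?L)"
  proof -
    have "graph_of ?L = {z. snd z = ?L (fst z)}" by (auto simp: graph_of_def image_iff)
    moreover have "closed {z. snd z = ?L (fst z)}"
      by (intro closed_Collect_eq continuous_intros continuous_on_compose2[OF continuous_lower_bound[OF f]]) auto
    ultimately show ?thesis by simp
  qed
  have UL: "?U x = ?L x" for x
  proof -
    have "infdist (x, ?U x) (graph_of ?L) \<le> (SUP z\<in>graph_of ?U. infdist z (graph_of ?L))"
      using bdd by (intro cSUP_upper) (auto simp: graph_of_def)
    also have "\<dots> \<le> bound_gap f" by (simp add: bound_gap_def hausdorff_dist_def)
    finally have "infdist (x, ?U x) (graph_of ?L) = 0" using gap infdist_nonneg[of "(x, ?U x)" "graph_of ?L"] by linarith
    then have "(x, ?U x) \<in> graph_of ?L"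
      using in_closed_iff_infdist_zero[OF closed] by (auto simp: graph_of_def)
    then show ?thesis by (auto simp: graph_of_def)
  qed
  show ?thesis
  proof (rule monoI)
    fix x y :: real assume "x \<le> y"
    have "f x \<le> ?U x" by (rule upper_bound_ge[OF f]) simp
    also have "\<dots> \<le> f y" unfolding UL by (rule lower_bound_le[OF f \<open>x \<le> y\<close>])
    finally show "f x \<le> f y" .
  qed
qed

text \<open>Monotonicity is a closed condition on \<open>b\<close>, being a family of weak
  inequalities between continuous functions, and a gap above 1 bounds it from above. The greatest
  parameter with gap 0 is therefore attained, so \<open>critical_level\<close> is a genuine
  maximum.\<close>

lemma not_mono_above_critical_level:
  assumes N: "class_N F" and b0: "b0 > critical_level F"
  shows "\<not> mono (F 0 b0)"
proof
  assume m0: "mono (F 0 b0)"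
  have lift: "degree_one_lift (F 0 b)" for b using N unfolding class_N_def class_B_def by blast
  have cont: "continuous_on UNIV (\<lambda>(a, b, x). F a b x)" using N unfolding class_N_def by blast
  have gap: "mono (\<lambda>b. bound_gap (F 0 b))" using N unfolding class_N_def by blast
  obtain B where B: "bound_gap (F 0 B) > 1" using N unfolding class_N_def by blast
  define S where "S = {b. bound_gap (F 0 b) = 0}"
  have S_iff: "b \<in> S \<longleftrightarrow> mono (F 0 b)" for b
    using bound_gap_mono_eq_0[OF lift] mono_if_bound_gap_le_0[OF lift] by (auto simp: S_def)
  have bdd: "bdd_above S"
  proof (rule bdd_aboveI)
    fix b assume "b \<in> S"
    then have "bound_gap (F 0 b) = 0" by (simp add: S_def)
    then show "b \<le> B" using B monoD[OF gap, of B b] by (cases "b \<le> B") auto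
  qed
  have ne: "S \<noteq> {}" using m0 S_iff by blast
  have "Sup S \<in> S"
    unfolding S_iff
  proof (rule monoI)
    fix x y :: real assume "x \<le> y"
    have cx: "continuous_on UNIV (\<lambda>b. F 0 b x)" for x
      using continuous_on_compose2[OF cont, of UNIV "\<lambda>b. (0, b, x)"] by (simp add: continuous_intros)
    have "closed {b. F 0 b x \<le> F 0 b y}" by (intro closed_Collect_le cx)
    moreover have "S \<subseteq> {b. F 0 b x \<le> F 0 b y}" using \<open>x \<le> y\<close> by (auto simp: S_iff dest: monoD)
    ultimately have "closure S \<subseteq> {b. F 0 b x \<le> F 0 b y}" by (rule closure_minimal[rotated])
    then show "F 0 (Sup S) x \<le> F 0 (Sup S) y" using closure_contains_Sup[OF ne bdd] by auto
  qed
  then have "critical_level F = Sup S"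
    unfolding critical_level_def
    using cSup_upper[OF _ bdd] by (intro Greatest_equality) (simp_all add: S_def)
  moreover have "b0 \<le> Sup S" using m0 S_iff bdd by (intro cSup_upper) auto
  ultimately show False using b0 by simp
qed

section \<open>The shape of Class B maps with two turning points\<close>

lemma deriv_periodic:
  assumes "\<And>x. (f has_real_derivative f' x) (at x)" "\<And>x. f (x + 1) = f x + (1::real)"
  shows "f' (x + 1) = f' x"
proof -
  have "((\<lambda>x. f (x + 1)) has_real_derivative f' (x + 1)) (at x)"
    using assms(1)[of "x + 1"] by (simp add: DERIV_shift)
  then have "((\<lambda>x. f x + 1) has_real_derivative f' (x + 1)) (at x)" by (simp add: assms(2))
  moreover have "((\<lambda>x. f x + 1) has_real_derivative f' x) (at x)"
    by (auto intro!: derivative_eq_intros assms(1))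
  ultimately show ?thesis by (rule DERIV_unique)
qed

lemma nonvanishing_sign:
  fixes g :: "real \<Rightarrow> real"
  assumes "continuous_on UNIV g" "\<And>x. a < x \<Longrightarrow> x < b \<Longrightarrow> g x \<noteq> 0"
  shows "(\<forall>x. a < x \<longrightarrow> x < b \<longrightarrow> g x > 0) \<or> (\<forall>x. a < x \<longrightarrow> x < b \<longrightarrow> g x < 0)"
proof (rule ccontr)
  assume "\<not> ?thesis"
  then obtain x y where xy: "a < x" "x < b" "g x \<le> 0" "a < y" "y < b" "g y \<ge> 0" by (auto simp: not_less)
  have c: "continuous_on {u..v} g" for u v using assms(1) by (rule continuous_on_subset) simp
  obtain z where "min x y \<le> z" "z \<le> max x y" "g z = 0"
  proof (cases "x \<le> y")
    case True
    then show ?thesis using IVT'[of g x 0 y] xy c that by (auto simp: min_def max_def)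
  next
    case False
    then show ?thesis using IVT2'[of g x 0 y] xy c that by (auto simp: min_def max_def)
  qed
  then show False using assms(2)[of z] xy by (auto simp: min_def max_def split: if_splits)
qed

lemma turning_max_derivative_zero:
  assumes "turning_max f c" "(f has_real_derivative d) (at c)"
  shows "d = 0"
proof -
  obtain e where e: "e > 0" "strict_mono_on {c - e..c} f" "strict_antimono_on {c..c + e} f"
    using assms(1) by (auto simp: turning_max_def)
  show ?thesis
  proof (rule DERIV_local_max[OF assms(2) e(1)], intro allI impI)
    fix y assume y: "\<bar>c - y\<bar> < e"
    consider "y < c" | "y = c" | "c < y" by linarith
    then show "f y \<le> f c"
    proof cases
      case 1
      then show ?thesis using strict_mono_onD[OF e(2), of y c] y e(1) by auto
    next
      case 3
      then show ?thesis using monotone_onD[OF e(3), of c y] y e(1) by auto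
    qed simp
  qed
qed

lemma turning_min_derivative_zero:
  assumes "turning_min f c" "(f has_real_derivative d) (at c)"
  shows "d = 0"
proof -
  obtain e where e: "e > 0" "strict_antimono_on {c - e..c} f" "strict_mono_on {c..c + e} f"
    using assms(1) by (auto simp: turning_min_def)
  show ?thesis
  proof (rule DERIV_local_min[OF assms(2) e(1)], intro allI impI)
    fix y assume y: "\<bar>c - y\<bar> < e"
    consider "y < c" | "y = c" | "c < y" by linarith
    then show "f c \<le> f y"
    proof cases
      case 1
      then show ?thesis using monotone_onD[OF e(2), of y c] y e(1) by auto
    next
      case 3
      then show ?thesis using strict_mono_onD[OF e(3), of c y] y e(1) by auto
    qed simp
  qed
qed

text \<open>The derivative is negative somewhere and has mean 1 over a period, so within one period
  it changes sign twice and gives two critical points that are distinct modulo 1.\<close>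

lemma class_B_not_mono_card:
  assumes B: "class_B f" and nm: "\<not> mono f"
  shows "card (critical_points f) = 2"
proof -
  have lift: "degree_one_lift f" and C3: "C3 f" and fin: "finite (critical_points f)"
    and card: "card (critical_points f) \<le> 2" using B by (auto simp: class_B_def)
  have per: "f (x + 1) = f x + 1" for x using lift by (simp add: degree_one_lift_def)
  have d: "(f has_real_derivative deriv f x) (at x)" for x
    using C3 unfolding C3_def by (auto simp: DERIV_deriv_iff_real_differentiable dest: spec[of _ 0])
  have "(deriv f) differentiable (at x)" for x
    using C3 unfolding C3_def by (auto dest: spec[of _ 1])
  then have cd: "continuous_on UNIV (deriv f)"
    by (auto simp: continuous_on_eq_continuous_at intro: differentiable_imp_continuous_within)
  have cs: "continuous_on {u..v} (deriv f)" for u v using cd by (rule continuous_on_subset) simp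
  have dper: "deriv f (x + 1) = deriv f x" for x by (rule deriv_periodic[OF d per])
  have dper_int: "deriv f (x + of_int m) = deriv f x" for x m
  proof -
    have nat: "deriv f (x + real n) = deriv f x" for n x
    proof (induction n)
      case (Suc n)
      then show ?case using dper[of "x + real n"] by (simp add: add.commute add.left_commute)
    qed simp
    show ?thesis
    proof (cases "m \<ge> 0")
      case True
      then show ?thesis using nat[of x "nat m"] by simp
    next
      case False
      then show ?thesis using nat[of "x + of_int m" "nat (- m)"] by simp
    qed
  qed
  obtain x where x: "deriv f x < 0"
  proof (rule ccontr)
    assume "\<not> thesis"
    then have "deriv f x \<ge> 0" for x using that not_less by blast
    then have "mono f" using d by (intro monoI DERIV_nonneg_imp_nondecreasing[of _ _ f]) blast+
    then show False using nm by simp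
  qed
  obtain y where "f 1 - f 0 = (1 - 0) * deriv f y" using MVT2[of 0 1 f "deriv f"] d by auto
  then have y: "deriv f y > 0" using per[of 0] by simp
  \<comment> \<open>The point of positive slope is translated into \<open>[x, x + 1)\<close>,
    between two points of negative slope.\<close>
  define y' where "y' = y - of_int \<lfloor>y - x\<rfloor>"
  have y': "x \<le> y'" "y' < x + 1" "deriv f y' > 0"
    using dper_int[of y' "\<lfloor>y - x\<rfloor>"] y unfolding y'_def by (linarith, linarith, simp)
  obtain c1 where c1: "x \<le> c1" "c1 \<le> y'" "deriv f c1 = 0"
    using IVT'[of "deriv f" x 0 y'] x y' cs by auto
  obtain c2 where c2: "y' \<le> c2" "c2 \<le> x + 1" "deriv f c2 = 0"
    using IVT2'[of "deriv f" "x + 1" 0 y'] x y' cs dper[of x] by auto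
  have ne: "c1 \<noteq> y'" "c2 \<noteq> y'" "c1 \<noteq> x" using c1 c2 x y' by auto
  have "frac c1 \<noteq> frac c2"
  proof
    assume "frac c1 = frac c2"
    then have "c2 - c1 = of_int (\<lfloor>c2\<rfloor> - \<lfloor>c1\<rfloor>)" by (simp add: frac_def)
    moreover have "0 < c2 - c1" "c2 - c1 < 1" using c1 c2 ne by linarith+
    ultimately have "0 < \<lfloor>c2\<rfloor> - \<lfloor>c1\<rfloor>" "\<lfloor>c2\<rfloor> - \<lfloor>c1\<rfloor> < 1"
      by (simp_all only: of_int_0_less_iff of_int_less_1_iff)
    then show False by simp
  qed
  moreover have "frac c \<in> critical_points f" if "deriv f c = 0" for c
    using that dper_int[of "frac c" "\<lfloor>c\<rfloor>"] frac_ge_0[of c] frac_lt_1[of c]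
    by (simp add: critical_points_def frac_def)
  ultimately have "{frac c1, frac c2} \<subseteq> critical_points f" "card {frac c1, frac c2} = 2" using c1 c2 by auto
  then have "2 \<le> card (critical_points f)" using card_mono[OF fin] by metis
  then show ?thesis using card by simp
qed

text \<open>The two turning points exhaust the critical points, so the derivative keeps one sign on
  each of \<open>(C, K)\<close> and \<open>(K, C + 1)\<close>; the turning behavior at an endpoint
  tells which. On the increasing branch the Schwarzian condition becomes expansion of cross
  ratios.\<close>

lemma class_B_bimodal_lift:
  assumes B: "class_B f" and card: "card (critical_points f) = 2"
    and CK: "0 \<le> C" "C < K" "K < 1" and tC: "turning_max f C" and tK: "turning_min f K"
  shows "bimodal_lift f C K"
proof -
  have lift: "degree_one_lift f" and C3: "C3 f" and fin: "finite (critical_points f)"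
    and S: "\<And>x. deriv f x \<noteq> 0 \<Longrightarrow> schwarzian f x < 0" using B card by (auto simp: class_B_def)
  have per: "f (x + 1) = f x + 1" for x using lift by (simp add: degree_one_lift_def)
  have diff: "(deriv ^^ k) f differentiable (at x)" if "k < 3" for k x
    using C3 that by (simp add: C3_def)
  have d1: "(f has_real_derivative deriv f x) (at x)" for x
    using diff[of 0 x] by (simp add: DERIV_deriv_iff_real_differentiable)
  have d2: "(deriv f has_real_derivative (deriv ^^ 2) f x) (at x)" for x
    using diff[of 1 x] by (simp add: DERIV_deriv_iff_real_differentiable numeral_2_eq_2)
  have d3: "((deriv ^^ 2) f has_real_derivative (deriv ^^ 3) f x) (at x)" for x
    using diff[of 2 x] by (simp add: DERIV_deriv_iff_real_differentiable numeral_3_eq_3 numeral_2_eq_2)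
  have cf: "continuous_on X f" for X
    using d1 by (intro continuous_at_imp_continuous_on ballI DERIV_isCont)
  have cd: "continuous_on UNIV (deriv f)"
    using d2 by (intro continuous_at_imp_continuous_on ballI DERIV_isCont)
  have dper: "deriv f (x + 1) = deriv f x" for x by (rule deriv_periodic[OF d1 per])
  have "C \<in> critical_points f" "K \<in> critical_points f"
    using turning_max_derivative_zero[OF tC d1] turning_min_derivative_zero[OF tK d1] CK
    by (auto simp: critical_points_def)
  then have crit: "critical_points f = {C, K}"
    using card_subset_eq[OF fin, of "{C, K}"] card CK by auto
  have nz: "deriv f x \<noteq> 0" if "0 \<le> x" "x < 1" "x \<noteq> C" "x \<noteq> K" for x
  proof
    assume "deriv f x = 0"
    then have "x \<in> critical_points f" using that by (simp add: critical_points_def)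
    then show False using crit that by simp
  qed
  have nz1: "deriv f x \<noteq> 0" if "C < x" "x < K" for x
    using that CK by (intro nz) auto
  have nz2: "deriv f x \<noteq> 0" if "K < x" "x < C + 1" for x
  proof (cases "x < 1")
    case True
    then show ?thesis using that CK by (intro nz) auto
  next
    case False
    then have "deriv f (x - 1) \<noteq> 0" using that CK by (intro nz) auto
    then show ?thesis using dper[of "x - 1"] by simp
  qed
  obtain e where e: "e > 0" "strict_antimono_on {C..C + e} f" using tC by (auto simp: turning_max_def)
  obtain e' where e': "e' > 0" "strict_mono_on {K..K + e'} f" using tK by (auto simp: turning_min_def)
  have pos_incr: "f x < f y" if "\<And>z. u < z \<Longrightarrow> z < v \<Longrightarrow> deriv f z > 0" "u \<le> x" "x < y" "y \<le> v" for u v x y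
    using that d1 by (intro DERIV_pos_imp_increasing_open[of x y f] cf) force+
  have neg_decr: "f y < f x" if "\<And>z. u < z \<Longrightarrow> z < v \<Longrightarrow> deriv f z < 0" "u \<le> x" "x < y" "y \<le> v" for u v x y
    using that d1 by (intro DERIV_neg_imp_decreasing_open[of x y f] cf) force+
  have neg: "deriv f x < 0" if "C < x" "x < K" for x
  proof -
    have "\<not> (\<forall>x. C < x \<longrightarrow> x < K \<longrightarrow> deriv f x > 0)"
    proof
      assume "\<forall>x. C < x \<longrightarrow> x < K \<longrightarrow> deriv f x > 0"
      \<comment> \<open>The minimum keeps the test point both in the interval of known sign and in
        the neighborhood supplied by the turning point.\<close>
      then have "f C < f (min K (C + e))" using e(1) CK by (intro pos_incr[of C K]) auto
      moreover have "f (min K (C + e)) < f C" using e CK monotone_onD[OF e(2), of C "min K (C + e)"] by auto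
      ultimately show False by simp
    qed
    then show ?thesis using nonvanishing_sign[OF cd nz1] that by blast
  qed
  have pos: "deriv f x > 0" if "K < x" "x < C + 1" for x
  proof -
    have "\<not> (\<forall>x. K < x \<longrightarrow> x < C + 1 \<longrightarrow> deriv f x < 0)"
    proof
      assume "\<forall>x. K < x \<longrightarrow> x < C + 1 \<longrightarrow> deriv f x < 0"
      then have "f (min (C + 1) (K + e')) < f K" using e'(1) CK by (intro neg_decr[of K "C + 1"]) auto
      moreover have "f K < f (min (C + 1) (K + e'))"
        using e' CK strict_mono_onD[OF e'(2), of K "min (C + 1) (K + e')"] by auto
      ultimately show False by simp
    qed
    then show ?thesis using nonvanishing_sign[OF cd nz2] that by blast
  qed
  show ?thesis
  proof
    show "degree_one_lift f" by (rule lift)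
    show "C < K" "K < C + 1" using CK by auto
    show "f y < f x" if "C \<le> x" "x < y" "y \<le> K" for x y using neg that by (rule neg_decr)
    show "f x < f y" if "K \<le> x" "x < y" "y \<le> C + 1" for x y using pos that by (rule pos_incr)
    fix a b c d assume abcd: "K < a" "a < b" "b < c" "c < d" "d < C + 1"
    show "cross_ratio a b c d < cross_ratio (f a) (f b) (f c) (f d)"
    proof (rule negative_schwarzian_cross_ratio[OF abcd(2-4) d1 d2 d3])
      fix s assume s: "a \<le> s" "s \<le> d"
      then show "deriv f s > 0" using pos abcd by simp
      then show "(deriv ^^ 3) f s / deriv f s - 3 / 2 * ((deriv ^^ 2) f s / deriv f s)\<^sup>2 < 0"
        using S[of s] by (simp add: schwarzian_def)
    qed
  qed
qed

lemma of_rat_num_den: "(of_rat r :: real) = of_int (num r) / of_nat (nat (den r))"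
proof -
  have "of_rat (Fract (num r) (den r)) = (of_int (num r) / of_int (den r) :: real)" by (rule of_rat_rat) simp
  then show ?thesis using rat_eq_num_den[of r] by (simp add: of_nat_nat)
qed

theorem theorem4:
  fixes F :: "real \<Rightarrow> real \<Rightarrow> real \<Rightarrow> real" and b\<^sub>0 :: real and r r' :: rat
  assumes "class_N F"
    and "b\<^sub>0 > critical_level F"
    and "farey_higher r r'"
    and "\<exists>a. Rot (F a b\<^sub>0) = {of_rat r'}"
  shows "\<exists>a\<^sub>1 a\<^sub>2. a\<^sub>1 < a\<^sub>2 \<and>
           Lock F (of_rat r) \<inter> (UNIV \<times> {b\<^sub>0}) = closed_segment (a\<^sub>1, b\<^sub>0) (a\<^sub>2, b\<^sub>0)"
proof -
  define f where "f = F 0 b\<^sub>0"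
  have B: "class_B f" using assms(1) unfolding class_N_def f_def by blast
  have card: "card (critical_points f) = 2"
    using class_B_not_mono_card[OF B] not_mono_above_critical_level[OF assms(1,2)] by (simp add: f_def)
  have "normalized_origin F" using assms(1) unfolding class_N_def by blast
  then obtain C K where "0 \<le> C" "C < K" "K < 1" "turning_max f C" "turning_min f K"
    using card unfolding normalized_origin_def f_def by metis
  then interpret bimodal_lift f C K using class_B_bimodal_lift[OF B card] by blast
  have tr: "F a b\<^sub>0 = translate f a" for a
  proof
    fix x
    have "\<forall>a b x. F a b x = F 0 b x + a" using assms(1) unfolding class_N_def by blast
    then show "F a b\<^sub>0 x = f x + a" unfolding f_def by blast
  qed
  have Rot_iff: "Rot (F a b\<^sub>0) = {of_rat t} \<longleftrightarrow> locked (num t) (nat (den t)) a" for a t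
    unfolding tr of_rat_num_den by (rule Rot_translate_iff_locked) simp
  have step: "\<exists>a b. a < b \<and> locked (num t) (nat (den t)) a \<and> locked (num t) (nat (den t)) b"
    if tc: "first_child t c" and locked_c: "\<exists>a. Rot (F a b\<^sub>0) = {of_rat c}" for t c
  proof -
    obtain s where s: "farey_neighbors t s" "c = farey_sum t s" using first_child_cases[OF tc] by metis
    obtain a where a: "locked (num c) (nat (den c)) a" using locked_c Rot_iff by blast
    have nd: "num c = num t + num s" "nat (den c) = nat (den t) + nat (den s)"
      using num_den_farey_sum[OF s(1)] s(2) by (simp_all add: nat_add_distrib)
    have q: "nat (den t) > 0" "nat (den s) > 0" by simp_all
    have i: "int (nat (den t)) = den t" "int (nat (den s)) = den s"
      by simp_all
    show ?thesis
    \<comment> \<open>The tree parent \<open>t\<close> may be either Farey parent of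
      \<open>c\<close>; its order relative to \<open>s\<close> decides the sign of the
      determinant.\<close>
    proof (cases "t < s")
      case True
      have det: "num s * int (nat (den t)) - num t * int (nat (den s)) = 1"
        using farey_neighbors_less[OF s(1) True] by (simp only: i)
      show ?thesis using locked_parent[OF q det, of a] a unfolding nd by blast
    next
      case False
      then have "s < t" using farey_neighbors_imp_neq[OF s(1)] by simp
      then have det: "num t * int (nat (den s)) - num s * int (nat (den t)) = 1"
        using farey_neighbors_less[of s t] s(1) farey_neighbors_commute by (simp only: i)
      have "locked (num s + num t) (nat (den s) + nat (den t)) a" using a by (simp add: nd add.commute)
      then show ?thesis using locked_parent[OF q(2,1) det] by blast
    qed
  qed
  have up: "\<exists>a. Rot (F a b\<^sub>0) = {of_rat t}"
    if "first_child t c" "\<exists>a. Rot (F a b\<^sub>0) = {of_rat c}" for t c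
    using step[OF that] unfolding Rot_iff by blast
  \<comment> \<open>The climb uses only the existence of a locked parameter. Stopping at a first
    child of \<open>r\<close> leaves one more application of \<open>step\<close>, which supplies two
    distinct parameters.\<close>
  obtain c where c: "first_child r c" "\<exists>a. Rot (F a b\<^sub>0) = {of_rat c}"
    by (rule farey_higher_descend[where P = "\<lambda>t. \<exists>a. Rot (F a b\<^sub>0) = {of_rat t}", OF assms(3,4) up])
  obtain a b where ab: "a < b" "locked (num r) (nat (den r)) a" "locked (num r) (nat (den r)) b"
    using step[OF c] by blast
  have "nat (den r) > 0" by simp
  then obtain l u where lu: "\<And>a. locked (num r) (nat (den r)) a \<longleftrightarrow> l \<le> a \<and> a \<le> u"
    by (rule locked_interval[where p = "num r"]) (rule that)
  have "l < u" using ab lu[of a] lu[of b] by simp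
  moreover have "z \<in> Lock F (of_rat r) \<inter> (UNIV \<times> {b\<^sub>0}) \<longleftrightarrow> z \<in> {l..u} \<times> {b\<^sub>0}" for z
    using Rot_iff[of "fst z" r] lu[of "fst z"]
    by (cases z; cases "snd z = b\<^sub>0") (simp_all add: Lock_def)
  then have "Lock F (of_rat r) \<inter> (UNIV \<times> {b\<^sub>0}) = {l..u} \<times> {b\<^sub>0}" by (rule set_eqI)
  moreover have "{l..u} \<times> {b\<^sub>0} = closed_segment (l, b\<^sub>0) (u, b\<^sub>0)"
  proof -
    have "closed_segment (l, b\<^sub>0) (u, b\<^sub>0) = closed_segment l u \<times> {b\<^sub>0}"
    proof (rule set_eqI)
      fix z :: "real \<times> real"
      have "(1 - t) * b\<^sub>0 + t * b\<^sub>0 = b\<^sub>0" for t by (simp add: algebra_simps)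
      then show "z \<in> closed_segment (l, b\<^sub>0) (u, b\<^sub>0) \<longleftrightarrow> z \<in> closed_segment l u \<times> {b\<^sub>0}"
        by (cases z) (auto simp: in_segment)
    qed
    then show ?thesis using \<open>l < u\<close> by (simp add: closed_segment_eq_real_ivl)
  qed
  ultimately show ?thesis by metis
qed

end
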